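(* Let $N\ge 1$ be an integer and $p>1$ a real number. Suppose that $u$ is a bounded $p$-harmonic function in $\mathbb{R}^N$. Then $u$ is constant.
   Context: A function $u$ is $p$-harmonic in a domain $\Omega\subset\mathbb{R}^N$ if $u\in W^{1,p}_{\rm loc}(\Omega)$ and $-\operatorname{div}(|\nabla u|^{p-2}\nabla u)=0$ in $\Omega$ in the weak sense, i.e. $\int_\Omega|\nabla u|^{p-2}\nabla u\cdot\nabla\varphi\,dx=0$ for all $\varphi\in C_c^\infty(\Omega)$. *)

theory Defs
  imports "HOL-Analysis.Analysis"
begin

definition gradient :: "('a::euclidean_space \<Rightarrow> real) \<Rightarrow> 'a \<Rightarrow> 'a" where
  "gradient f x = (\<Sum>i\<in>Basis. frechet_derivative f (at x) i *\<^sub>R i)"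

primrec C_k :: "nat \<Rightarrow> ('a::euclidean_space \<Rightarrow> real) \<Rightarrow> bool" where
  "C_k 0 f \<longleftrightarrow> continuous_on UNIV f"
| "C_k (Suc k) f \<longleftrightarrow>
     f differentiable_on UNIV \<and> (\<forall>i\<in>Basis. C_k k (\<lambda>x. frechet_derivative f (at x) i))"

text \<open>
  \<open>C_c_infinity \<Omega>\<close> is the space of test functions on an open set \<open>\<Omega>\<close>. Its elements are taken
  to be defined on the whole space, being extended by zero outside \<open>\<Omega>\<close>.
\<close>
definition C_c_infinity :: "'a::euclidean_space set \<Rightarrow> ('a \<Rightarrow> real) set" where
  "C_c_infinity \<Omega> =
     {\<phi>. (\<forall>k. C_k k \<phi>) \<and> compact (closure {x. \<phi> x \<noteq> 0}) \<and> closure {x. \<phi> x \<noteq> 0} \<subseteq> \<Omega>}"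

definition Lp_loc ::
    "real \<Rightarrow> 'a::euclidean_space set \<Rightarrow> ('a \<Rightarrow> 'b::euclidean_space) set" where
  "Lp_loc p \<Omega> =
     {f. f \<in> borel_measurable (lebesgue_on \<Omega>) \<and>
         (\<forall>K. compact K \<and> K \<subseteq> \<Omega> \<longrightarrow> set_integrable lebesgue K (\<lambda>x. norm (f x) powr p))}"

text \<open>The integration by parts formula below is an identity between vectors.\<close>
definition has_weak_gradient ::
    "'a::euclidean_space set \<Rightarrow> ('a \<Rightarrow> real) \<Rightarrow> ('a \<Rightarrow> 'a) \<Rightarrow> bool" where
  "has_weak_gradient \<Omega> u g \<longleftrightarrow>
     u \<in> Lp_loc 1 \<Omega> \<and> g \<in> Lp_loc 1 \<Omega> \<and>
     (\<forall>\<phi>\<in>C_c_infinity \<Omega>.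
        (LINT x:\<Omega>|lebesgue. u x *\<^sub>R gradient \<phi> x) = - (LINT x:\<Omega>|lebesgue. \<phi> x *\<^sub>R g x))"

definition W1p_loc :: "real \<Rightarrow> 'a::euclidean_space set \<Rightarrow> ('a \<Rightarrow> real) set" where
  "W1p_loc p \<Omega> = {u. u \<in> Lp_loc p \<Omega> \<and> (\<exists>g\<in>Lp_loc p \<Omega>. has_weak_gradient \<Omega> u g)}"

text \<open>
  The set \<open>\<Omega>\<close> is meant to be a domain. The weak gradient is unique up to null sets, so the
  choice of \<open>g\<close> does not matter. Where \<open>g x = 0\<close>, the vector
  \<open>norm (g x) powr (p - 2) *\<^sub>R g x\<close> is zero, which is the usual convention for \<open>p < 2\<close>.
\<close>
definition p_harmonic_on :: "real \<Rightarrow> 'a::euclidean_space set \<Rightarrow> ('a \<Rightarrow> real) \<Rightarrow> bool" where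
  "p_harmonic_on p \<Omega> u \<longleftrightarrow>
     u \<in> W1p_loc p \<Omega> \<and>
     (\<exists>g\<in>Lp_loc p \<Omega>. has_weak_gradient \<Omega> u g \<and>
        (\<forall>\<phi>\<in>C_c_infinity \<Omega>.
           (LINT x:\<Omega>|lebesgue. (norm (g x) powr (p - 2) *\<^sub>R g x) \<bullet> gradient \<phi> x) = 0))"

text \<open>
  Elements of Sobolev spaces are functions modulo equality almost everywhere, so boundedness and
  constancy are understood almost everywhere as well.
\<close>
definition ess_bounded_on :: "'a::euclidean_space set \<Rightarrow> ('a \<Rightarrow> real) \<Rightarrow> bool" where
  "ess_bounded_on \<Omega> u \<longleftrightarrow> (\<exists>M. AE x in lebesgue. x \<in> \<Omega> \<longrightarrow> \<bar>u x\<bar> \<le> M)"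

definition ess_constant_on :: "'a::euclidean_space set \<Rightarrow> ('a \<Rightarrow> real) \<Rightarrow> bool" where
  "ess_constant_on \<Omega> u \<longleftrightarrow> (\<exists>c. AE x in lebesgue. x \<in> \<Omega> \<longrightarrow> u x = c)"

end

theory Submission
  imports Defs
begin

text \<open>
  Normalise the solution so that its essential infimum and supremum are \<open>0\<close> and \<open>1\<close>. At
  every scale \<open>R\<close>, one of \<open>u\<close> and \<open>1 - u\<close> is at most \<open>1/2\<close> on at least half of the ball of
  radius \<open>2 R\<close>, and we may assume that it is \<open>u\<close> for arbitrarily large \<open>R\<close>. Testing the
  equation with a power of \<open>1 + \<theta> - u\<close> bounds the gradient of \<open>ln (1 + \<theta> - u)\<close>, so
  that the set \<open>u > 1 - \<theta>\<close> occupies a small fraction of the ball; De Giorgi's iteration over the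
  levels between \<open>1 - 2 \<theta>\<close> and \<open>1 - \<theta>\<close> then shows \<open>u \<le> 1 - \<theta>\<close> on the ball of radius \<open>R\<close>, with
  \<open>\<theta>\<close> independent of \<open>R\<close>. Letting \<open>R\<close> tend to infinity contradicts the normalisation.
  No Sobolev embedding is used: the gain of integrability in the iteration, like the Poincare
  inequality in the logarithmic estimate, comes from the bound
  \<open>norm (f (\<cdot> + h) - f) \<le> norm h * norm (grad f)\<close> in \<open>L\<^sup>p\<close>, averaged over \<open>h\<close> in a ball.
\<close>

section \<open>Test functions\<close>

text \<open>The obstacle is the chain rule: the equation has to be tested with nonlinear functions
  of \<open>u\<close>, and a weak gradient does not come with one. The nonlinearities are therefore
  applied to C^1 functions \<open>U n\<close> with values in [0,1] whose gradients
  \<open>V n\<close> approximate \<open>g\<close>. The error \<open>V n - g\<close> is carried along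
  as an extra term, and the limit is taken only in finished integral inequalities, by Fatou's lemma
  on the left and dominated convergence on the right. One Caccioppoli inequality with a free weight,
  \<open>F powr p \<le> Q * F' powr (p - 1)\<close>, covers both applications: \<open>Q\<close> is
  constant for the logarithm and a power of the truncation in the iteration. Since the
  nonlinearities must be C^1, truncations are used with the exponents 2 and 1 + 1/p, and p + 1
  appears where p is customary. In the iteration the translation length \<open>\<rho>\<close> is
  tied to the N-th root of the measure of the level set, so that the factor
  \<open>\<rho> powr p\<close> in the translation bound is a positive power of that measure. This
  power is the gain.\<close>

lemma C_k_SucI:
  assumes "\<And>x. (f has_derivative D x) (at x)"
    and "\<And>i. i \<in> Basis \<Longrightarrow> C_k k (\<lambda>x. D x i)"
  shows "C_k (Suc k) f"
proof -
  have "frechet_derivative f (at x) = D x" for x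
    using assms(1) by (simp add: frechet_derivative_at[symmetric])
  then show ?thesis
    using assms by (auto simp: differentiable_on_def intro: differentiableI)
qed

lemma C_k_SucD_derivative:
  assumes "C_k (Suc k) f"
  shows "(f has_derivative frechet_derivative f (at x)) (at x)"
  using assms by (simp add: differentiable_on_def frechet_derivative_works)

lemma C_k_Suc_imp: "C_k (Suc k) f \<Longrightarrow> C_k k f"
proof (induction k arbitrary: f)
  case 0
  then show ?case
    by (simp add: differentiable_imp_continuous_on)
next
  case (Suc k)
  then show ?case
    by (metis C_k.simps(2))
qed

lemma C_k_const: "C_k k (\<lambda>_. c)"
  by (induction k arbitrary: c) (auto intro!: continuous_intros simp del: C_k.simps(2) intro: C_k_SucI[OF has_derivative_const])

lemma C_k_add:
  assumes "C_k k f" "C_k k g"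
  shows "C_k k (\<lambda>x. f x + g x)"
  using assms
proof (induction k arbitrary: f g)
  case 0
  then show ?case by (auto intro: continuous_on_add)
next
  case (Suc k)
  show ?case
    using Suc
    by (intro C_k_SucI[OF has_derivative_add[OF C_k_SucD_derivative C_k_SucD_derivative]]) auto
qed

lemma C_k_mult:
  assumes "C_k k f" "C_k k g"
  shows "C_k k (\<lambda>x. f x * g x)"
  using assms
proof (induction k arbitrary: f g)
  case 0
  then show ?case by (auto intro: continuous_on_mult)
next
  case (Suc k)
  show ?case
    using Suc C_k_Suc_imp[OF Suc.prems(1)] C_k_Suc_imp[OF Suc.prems(2)]
    by (intro C_k_SucI[OF has_derivative_mult[OF C_k_SucD_derivative C_k_SucD_derivative]] C_k_add) auto
qed

lemma C_k_inner_Basis: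
  fixes a v :: "'a::euclidean_space"
  shows "C_k k (\<lambda>x. (x - a) \<bullet> v)"
proof (cases k)
  case 0
  then show ?thesis by (auto intro!: continuous_intros)
next
  case (Suc m)
  have "((\<lambda>x. (x - a) \<bullet> v) has_derivative (\<lambda>h. h \<bullet> v)) (at x)" for x
    by (auto intro!: derivative_eq_intros)
  then show ?thesis
    unfolding Suc by (rule C_k_SucI) (simp add: C_k_const)
qed

section \<open>Smooth bump functions\<close>

definition flat :: "real poly \<Rightarrow> real \<Rightarrow> real" where
  "flat P t = (if t > 0 then poly P (inverse t) * exp (- inverse t) else 0)"

lemma poly_exp_tendsto_0: "((\<lambda>s. poly P s * exp (- s)) \<longlongrightarrow> (0::real)) at_top"
proof -
  have "((\<lambda>s. \<Sum>i\<le>degree P. coeff P i * (s ^ i / exp s)) \<longlongrightarrow> (\<Sum>i\<le>degree P. coeff P i * 0)) at_top"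
    by (intro tendsto_intros tendsto_power_div_exp_0)
  then show ?thesis
    by (simp add: poly_altdef sum_distrib_right exp_minus field_simps sum_divide_distrib)
qed

text \<open>With s = 1/t the chain rule turns P(s) exp(-s) into s^2 (P(s) - P'(s)) exp(-s), which
  has the same form. This closure under differentiation is why \<open>flat\<close> carries a
  polynomial: smoothness of every order follows from one induction with \<open>P\<close> arbitrary,
  and \<open>P = 1\<close> is the classical exp(-1/t).\<close>

lemma flat_has_derivative:
  "(flat P has_real_derivative flat (monom 1 2 * (P - pderiv P)) t) (at t)"
proof -
  let ?Q = "monom 1 2 * (P - pderiv P)"
  consider "t > 0" | "t < 0" | "t = 0" by linarith
  then show ?thesis
  proof cases
    case 1
    have "((\<lambda>t. poly P (inverse t) * exp (- inverse t)) has_real_derivative flat ?Q t) (at t)"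
      using 1 by (auto intro!: derivative_eq_intros
          simp: flat_def poly_monom power2_eq_square algebra_simps)
    then show ?thesis
      by (rule has_field_derivative_transform_within_open[where S="{0<..}"])
         (use 1 in \<open>auto simp: flat_def\<close>)
  next
    case 2
    have "((\<lambda>t. 0) has_real_derivative flat ?Q t) (at t)"
      using 2 by (simp add: flat_def)
    then show ?thesis
      by (rule has_field_derivative_transform_within_open[where S="{..<0}"])
         (use 2 in \<open>auto simp: flat_def\<close>)
  next
    case 3
    have "((\<lambda>h. flat P h / h) \<longlongrightarrow> 0) (at_left 0)"
      by (rule Lim_transform_eventually[of "\<lambda>_. 0"])
         (auto simp: flat_def eventually_at_filter)
    moreover have "((\<lambda>h. flat P h / h) \<longlongrightarrow> 0) (at_right 0)"
    proof (rule Lim_transform_eventually)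
      \<comment> \<open>\<open>pCons 0 P\<close> stands for s * P(s): dividing by h multiplies by s
        = 1/h, and the exponential still wins.\<close>
      show "((\<lambda>h. poly (pCons 0 P) (inverse h) * exp (- inverse h)) \<longlongrightarrow> 0) (at_right 0)"
        using filterlim_compose[OF poly_exp_tendsto_0 filterlim_inverse_at_top_right] .
      show "\<forall>\<^sub>F h in at_right 0.
          poly (pCons 0 P) (inverse h) * exp (- inverse h) = flat P h / h"
        by (auto simp: flat_def eventually_at_filter field_simps)
    qed
    ultimately have "((\<lambda>h. flat P h / h) \<longlongrightarrow> 0) (at 0)"
      by (simp add: filterlim_at_split)
    then show ?thesis
      using 3 by (simp add: DERIV_def flat_def)
  qed
qed

text \<open>The squared distance is a polynomial in x, so that the bump is smooth at its centre as
  well.\<close>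

definition bump :: "real poly \<Rightarrow> real \<Rightarrow> 'a::euclidean_space \<Rightarrow> 'a \<Rightarrow> real" where
  "bump P e a x = flat P (e\<^sup>2 - (x - a) \<bullet> (x - a))"

lemma bump_has_derivative:
  "(bump P e a has_derivative
     (\<lambda>h. bump (monom 1 2 * (P - pderiv P)) e a x * (-2 * ((x - a) \<bullet> h)))) (at x)"
proof -
  have "((\<lambda>x. e\<^sup>2 - (x - a) \<bullet> (x - a)) has_derivative (\<lambda>h. -2 * ((x - a) \<bullet> h))) (at x)"
    by (auto intro!: derivative_eq_intros simp: inner_commute)
  from has_derivative_compose[OF this
      flat_has_derivative[of P, THEN has_field_derivative_imp_has_derivative]]
  show ?thesis
    by (simp add: bump_def[abs_def])
qed

lemma C_k_bump: "C_k k (bump P e a)"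
proof (induction k arbitrary: P)
  case 0
  have "isCont (bump P e a) x" for x
    using bump_has_derivative has_derivative_continuous by blast
  then show ?case
    by (simp add: continuous_at_imp_continuous_on)
next
  case (Suc k)
  show ?case
    by (rule C_k_SucI[OF bump_has_derivative])
       (intro C_k_mult C_k_const C_k_inner_Basis Suc)
qed

lemma bump_eq_0: "norm (x - a) \<ge> \<bar>e\<bar> \<Longrightarrow> bump P e a x = 0"
  using abs_le_square_iff[of e "norm (x - a)"]
  by (simp add: bump_def flat_def power2_norm_eq_inner)

lemma bump_1_pos: "norm (x - a) < \<bar>e\<bar> \<Longrightarrow> bump 1 e a x > 0"
  using power_strict_mono[of "norm (x - a)" "\<bar>e\<bar>" 2]
  by (simp add: bump_def flat_def power2_norm_eq_inner)

lemma bump_1_nonneg: "bump 1 e a x \<ge> 0"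
  by (simp add: bump_def flat_def)

lemma closure_support_subset:
  fixes f :: "'a::euclidean_space \<Rightarrow> 'b::real_normed_vector"
  assumes "\<And>x. x \<notin> K \<Longrightarrow> f x = 0" "compact K"
  shows "closure {x. f x \<noteq> 0} \<subseteq> K" "compact (closure {x. f x \<noteq> 0})"
proof -
  show 1: "closure {x. f x \<noteq> 0} \<subseteq> K"
    using assms by (intro closure_minimal) (auto simp: compact_imp_closed)
  show "compact (closure {x. f x \<noteq> 0})"
    using compact_closure bounded_subset[OF compact_imp_bounded[OF assms(2)]] 1 closure_subset
    by (metis (no_types, lifting) dual_order.trans)
qed

lemma C_c_infinityI:
  assumes "\<And>k. C_k k f" "\<And>x. x \<notin> K \<Longrightarrow> f x = 0" "compact K"
  shows "f \<in> C_c_infinity UNIV"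
  using closure_support_subset[OF assms(2,3)] assms(1) unfolding C_c_infinity_def by auto

lemma C_c_infinity_bump: "bump P e a \<in> C_c_infinity UNIV"
  by (rule C_c_infinityI[of _ "cball a \<bar>e\<bar>"])
     (auto simp: C_k_bump dist_norm norm_minus_commute intro: bump_eq_0)

section \<open>Convolution\<close>

text \<open>The gradient is an explicit argument because approximations are tracked as pairs of a
  function and its gradient, and convergence is asked of each component separately.\<close>

definition C1 :: "('a::euclidean_space \<Rightarrow> real) \<Rightarrow> ('a \<Rightarrow> 'a) \<Rightarrow> bool" where
  "C1 f G \<longleftrightarrow> (\<forall>x. (f has_derivative (\<lambda>h. G x \<bullet> h)) (at x)) \<and> continuous_on UNIV G"

lemma C1_D:
  assumes "C1 f G"
  shows "(f has_derivative (\<lambda>h. G x \<bullet> h)) (at x)" "continuous_on UNIV G" "continuous_on UNIV f"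
proof -
  show "(f has_derivative (\<lambda>h. G x \<bullet> h)) (at x)" for x
    using assms by (simp add: C1_def)
  then show "continuous_on UNIV f"
    by (auto intro!: continuous_at_imp_continuous_on has_derivative_continuous)
qed (use assms in \<open>simp add: C1_def\<close>)

lemma C1_measurable:
  assumes "C1 f G"
  shows "f \<in> borel_measurable borel" "G \<in> borel_measurable borel"
  using C1_D[OF assms] by (auto intro: borel_measurable_continuous_onI)

lemma gradient_eqI:
  assumes "(f has_derivative (\<lambda>h. G \<bullet> h)) (at x)"
  shows "gradient f x = G"
  using frechet_derivative_at[OF assms, symmetric]
  by (simp add: gradient_def euclidean_representation)

lemma C1_C_c_infinity:
  assumes "f \<in> C_c_infinity \<Omega>"
  shows "C1 f (gradient f)"
proof -
  have *: "C_k (Suc 0) f"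
    using assms unfolding C_c_infinity_def by blast
  have "(f has_derivative (\<lambda>h. gradient f x \<bullet> h)) (at x)" for x
  proof -
    let ?D = "frechet_derivative f (at x)"
    have D: "(f has_derivative ?D) (at x)"
      using C_k_SucD_derivative[OF *] .
    have "gradient f x \<bullet> h = ?D (\<Sum>i\<in>Basis. (h \<bullet> i) *\<^sub>R i)" for h
      using has_derivative_linear[OF D]
      by (simp add: gradient_def inner_sum_left inner_sum_right linear_sum linear_cmul inner_commute mult.commute)
    then have "?D h = gradient f x \<bullet> h" for h
      by (simp add: euclidean_representation)
    then have "?D = (\<lambda>h. gradient f x \<bullet> h)"
      by (rule ext)
    with D show ?thesis by (simp only:)
  qed
  moreover have "continuous_on UNIV (gradient f)"
    unfolding gradient_def using * by (auto intro!: continuous_intros)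
  ultimately show ?thesis by (simp add: C1_def)
qed

lemma C1_gradient_eq_0:
  fixes f :: "'a::euclidean_space \<Rightarrow> real"
  assumes "C1 f G" "\<And>x. R < norm x \<Longrightarrow> f x = 0" "R < norm x"
  shows "G x = 0"
proof -
  have "open {y::'a. R < norm y}"
    by (intro open_Collect_less continuous_intros)
  then have "((\<lambda>x. 0) has_derivative (\<lambda>h. G x \<bullet> h)) (at x)"
    using assms by (intro has_derivative_transform_within_open[OF C1_D(1)[OF assms(1)]]) auto
  then have "(\<lambda>h. G x \<bullet> h) = (\<lambda>h. 0)"
    by (rule has_derivative_unique[OF _ has_derivative_const])
  then have "G x \<bullet> G x = 0" by (rule fun_cong)
  then show ?thesis by simp
qed

lemma C_c_infinity_bounded:
  assumes "f \<in> C_c_infinity \<Omega>"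
  obtains R where "R > 0" "\<And>x. R < norm x \<Longrightarrow> f x = 0"
proof -
  have "compact (closure {x. f x \<noteq> 0})"
    using assms by (simp add: C_c_infinity_def)
  then obtain R where "R > 0" "\<forall>x\<in>closure {x. f x \<noteq> 0}. norm x \<le> R"
    using compact_imp_bounded bounded_pos by blast
  then show ?thesis
    using that closure_subset by (metis (mono_tags, lifting) leD mem_Collect_eq subsetD)
qed

text \<open>The bound \<open>d \<le> 1\<close> does the work: if one of two close points lies in the
  ball of radius R, both lie in the compact ball of radius R + 1, and otherwise \<open>f\<close>
  vanishes at both.\<close>

lemma compact_support_uniformly_continuous:
  fixes f :: "'a::euclidean_space \<Rightarrow> 'b::euclidean_space"
  assumes f: "continuous_on UNIV f" and R: "\<And>x. R < norm x \<Longrightarrow> f x = 0" and "e > 0"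
  obtains d where "d > 0" "d \<le> 1" "\<And>x y. dist x y < d \<Longrightarrow> norm (f x - f y) < e"
proof -
  have "uniformly_continuous_on (cball 0 (R+1)) f"
    using f by (intro compact_uniformly_continuous) (auto intro: continuous_on_subset)
  then obtain d where d: "d > 0" and *: "\<And>x y. x \<in> cball 0 (R+1) \<Longrightarrow> y \<in> cball 0 (R+1) \<Longrightarrow>
      dist y x < d \<Longrightarrow> dist (f y) (f x) < e"
    unfolding uniformly_continuous_on_def using \<open>e > 0\<close> by metis
  have "norm (f x - f y) < e" if "dist x y < min d 1" for x y
  proof (cases "norm x \<le> R \<or> norm y \<le> R")
    case True
    have "norm x \<le> norm y + dist x y" "norm y \<le> norm x + dist x y"
      using norm_triangle_sub[of x y] norm_triangle_sub[of y x] by (auto simp: dist_norm norm_minus_commute)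
    then have "x \<in> cball 0 (R+1)" "y \<in> cball 0 (R+1)"
      using True that by auto
    then show ?thesis using *[of y x] that by (simp add: dist_norm)
  next
    case False
    then show ?thesis using R \<open>e > 0\<close> by simp
  qed
  then show ?thesis using that[of "min d 1"] d by auto
qed

text \<open>The mean value inequality with the modulus of continuity of \<open>G\<close>. Uniformity
  in x is what allows differentiation under the convolution integral.\<close>

lemma C1_uniform_linearization:
  fixes f :: "'a::euclidean_space \<Rightarrow> real"
  assumes f: "C1 f G" and R: "\<And>x. R < norm x \<Longrightarrow> G x = 0" and "e > 0"
  obtains d where "d > 0" "d \<le> 1" "\<And>x h. norm h < d \<Longrightarrow> \<bar>f (x + h) - f x - G x \<bullet> h\<bar> \<le> e * norm h"
proof -
  obtain d where d: "d > 0" "d \<le> 1" and *: "\<And>x y. dist x y < d \<Longrightarrow> norm (G x - G y) < e"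
    using compact_support_uniformly_continuous[OF C1_D(2)[OF f] R \<open>e > 0\<close>] by metis
  have "\<bar>f (x + h) - f x - G x \<bullet> h\<bar> \<le> e * norm h" if "norm h < d" for x h
  proof -
    have "norm (f (x + h) - f x - G x \<bullet> ((x + h) - x)) \<le> norm ((x + h) - x) * e"
    proof (rule differentiable_bound_linearization[where S="ball x d" and f'="\<lambda>x h. G x \<bullet> h" and ?x0.0=x])
      fix t :: real assume "t \<in> {0..1}"
      then have "\<bar>t\<bar> * norm h \<le> 1 * norm h" by (intro mult_right_mono) auto
      then show "x + t *\<^sub>R (x + h - x) \<in> ball x d"
        using that by (simp add: dist_norm)
    next
      fix y assume "y \<in> ball x d"
      then have "norm (G y - G x) \<le> e"
        using *[of y x] by (simp add: dist_commute)
      then have "norm ((G y - G x) \<bullet> h) \<le> e * norm h" for h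
        by (metis Cauchy_Schwarz_ineq2 mult_right_mono norm_ge_zero order_trans real_norm_def)
      then show "onorm ((\<lambda>h. G y \<bullet> h) - (\<lambda>h. G x \<bullet> h)) \<le> e"
        by (intro onorm_le) (simp add: inner_diff_left)
    qed (use d in \<open>auto intro: has_derivative_at_withinI C1_D(1)[OF f]\<close>)
    then show ?thesis by (simp add: mult.commute)
  qed
  then show ?thesis using that d by blast
qed

text \<open>Borel measurability is built in because the Fubini and translation arguments run over
  \<open>lborel\<close>; Lebesgue measurable data are replaced by Borel representatives at the very
  end.\<close>

definition locint :: "('a::euclidean_space \<Rightarrow> 'b::euclidean_space) \<Rightarrow> bool" where
  "locint f \<longleftrightarrow> f \<in> borel_measurable borel \<and> (\<forall>R. set_integrable lborel (cball 0 R) f)"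

lemma locint_measurable: "locint f \<Longrightarrow> f \<in> borel_measurable borel"
  by (simp add: locint_def)

lemma locint_continuous:
  assumes "continuous_on UNIV f"
  shows "locint f"
  unfolding locint_def
  using assms by (auto intro!: borel_measurable_continuous_onI borel_integrable_compact
      intro: continuous_on_subset simp: set_integrable_def)

lemma locint_mult_integrable:
  fixes f :: "'a::euclidean_space \<Rightarrow> 'b::euclidean_space" and k :: "'a \<Rightarrow> real"
  assumes f: "locint f" and [measurable]: "k \<in> borel_measurable borel"
    and B: "\<And>x. \<bar>k x\<bar> \<le> B" and R: "\<And>x. R < norm x \<Longrightarrow> k x = 0"
  shows "integrable lborel (\<lambda>x. k x *\<^sub>R f x)"
proof (rule Bochner_Integration.integrable_bound)
  note [measurable] = locint_measurable[OF f]
  show "integrable lborel (\<lambda>x. B *\<^sub>R (indicator (cball 0 R) x *\<^sub>R f x))"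
    using f by (intro integrable_scaleR_right) (auto simp: locint_def set_integrable_def)
  have "norm (k x *\<^sub>R f x) \<le> norm (B *\<^sub>R (indicator (cball 0 R) x *\<^sub>R f x))" for x
    using B[of x] R[of x] by (cases "norm x \<le> R") (auto intro!: mult_right_mono)
  then show "AE x in lborel. norm (k x *\<^sub>R f x) \<le> norm (B *\<^sub>R (indicator (cball 0 R) x *\<^sub>R f x))"
    by simp
qed (use locint_measurable[OF f] in measurable)

lemma locint_norm: "locint f \<Longrightarrow> locint (\<lambda>x. norm (f x))"
  by (auto simp: locint_def set_integrable_norm)

lemma locint_inner_integrable:
  fixes f :: "'a::euclidean_space \<Rightarrow> 'b::euclidean_space" and k :: "'a \<Rightarrow> 'b"
  assumes f: "locint f" and [measurable]: "k \<in> borel_measurable borel"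
    and B: "\<And>x. norm (k x) \<le> B" and R: "\<And>x. R < norm x \<Longrightarrow> k x = 0"
  shows "integrable lborel (\<lambda>x. f x \<bullet> k x)"
proof (rule Bochner_Integration.integrable_bound)
  note [measurable] = locint_measurable[OF f]
  show "integrable lborel (\<lambda>x. norm (k x) *\<^sub>R norm (f x))"
    by (rule locint_mult_integrable[OF locint_norm[OF f], where B=B and R=R])
       (use B R in auto)
  show "AE x in lborel. norm (f x \<bullet> k x) \<le> norm (norm (k x) *\<^sub>R norm (f x))"
    using Cauchy_Schwarz_ineq2[of "f _" "k _"] by (simp add: mult.commute)
qed (use locint_measurable[OF f] in measurable)

lemma compact_support_bounded:
  fixes f :: "'a::euclidean_space \<Rightarrow> 'b::euclidean_space"
  assumes "continuous_on UNIV f" "\<And>x. R < norm x \<Longrightarrow> f x = 0"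
  obtains B where "B > 0" "\<And>x. norm (f x) \<le> B"
proof -
  have "bounded (f ` cball 0 R)"
    using assms by (intro compact_imp_bounded compact_continuous_image) (auto intro: continuous_on_subset)
  then obtain B where B: "B > 0" "\<And>x. norm x \<le> R \<Longrightarrow> norm (f x) \<le> B"
    unfolding bounded_pos by auto
  have "norm (f x) \<le> B" for x
    using B assms(2)[of x] by (cases "norm x \<le> R") auto
  with B that show ?thesis by blast
qed

lemma lborel_integral_reflect:
  fixes f :: "'a::euclidean_space \<Rightarrow> 'b::{banach, second_countable_topology}"
  assumes [measurable]: "f \<in> borel_measurable borel"
  shows "(\<integral>y. f (x - y) \<partial>lborel) = (\<integral>y. f y \<partial>lborel)"
proof -
  have "(lborel :: 'a measure) = distr lborel borel (\<lambda>y. x + (-1) *\<^sub>R y)"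
    using lborel_affine[of "-1" x] by (simp add: density_1)
  then have "(\<integral>y. f y \<partial>lborel) = (\<integral>y. f y \<partial>distr lborel borel (\<lambda>y. x + (-1) *\<^sub>R y))"
    by simp
  then show ?thesis
    by (simp add: integral_distr)
qed

lemma lborel_integrable_reflect:
  fixes f :: "'a::euclidean_space \<Rightarrow> 'b::{banach, second_countable_topology}"
  assumes "integrable lborel f"
  shows "integrable lborel (\<lambda>y. f (x - y))"
proof -
  have "(lborel :: 'a measure) = distr lborel borel (\<lambda>y. x + (-1) *\<^sub>R y)"
    using lborel_affine[of "-1" x] by (simp add: density_1)
  then have "integrable (distr lborel borel (\<lambda>y. x + (-1) *\<^sub>R y)) f"
    using assms by simp
  then show ?thesis
    by (simp add: integrable_distr_eq borel_measurable_integrable[OF assms, simplified])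
qed

lemma nn_integral_lborel_translate:
  fixes f :: "'a::euclidean_space \<Rightarrow> ennreal"
  assumes [measurable]: "f \<in> borel_measurable borel"
  shows "(\<integral>\<^sup>+y. f (y + x) \<partial>lborel) = (\<integral>\<^sup>+y. f y \<partial>lborel)"
proof -
  have "(\<integral>\<^sup>+y. f y \<partial>lborel) = (\<integral>\<^sup>+y. f y \<partial>distr lborel borel ((+) x))"
    by (simp add: lborel_distr_plus)
  then show ?thesis
    by (simp add: nn_integral_distr add.commute)
qed

lemma integral_diff3:
  fixes a b c :: "'a \<Rightarrow> 'b::{banach, second_countable_topology}"
  assumes "integrable M a" "integrable M b" "integrable M c"
  shows "(\<integral>x. a x - b x - c x \<partial>M) = (\<integral>x. a x \<partial>M) - (\<integral>x. b x \<partial>M) - (\<integral>x. c x \<partial>M)"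
  using assms by simp

definition convol :: "('a::euclidean_space \<Rightarrow> real) \<Rightarrow> ('a \<Rightarrow> 'b::euclidean_space) \<Rightarrow> 'a \<Rightarrow> 'b" where
  "convol s v x = (\<integral>y. s (x - y) *\<^sub>R v y \<partial>lborel)"

lemma convol_commute:
  assumes [measurable]: "s \<in> borel_measurable borel" "v \<in> borel_measurable borel"
  shows "convol s v x = (\<integral>y. s y *\<^sub>R v (x - y) \<partial>lborel)"
  unfolding convol_def using lborel_integral_reflect[of "\<lambda>y. s (x - y) *\<^sub>R v y" x] by simp

lemma norm_diff_gt:
  fixes x y :: "'a::euclidean_space"
  shows "norm y > norm x + R \<Longrightarrow> norm (x - y) > R"
  using norm_triangle_ineq2[of y x] by (simp add: norm_minus_commute)

lemma convol_integrable:
  fixes s :: "'a::euclidean_space \<Rightarrow> real" and v :: "'a \<Rightarrow> 'b::euclidean_space"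
  assumes "locint v" "continuous_on UNIV s" "\<And>x. R < norm x \<Longrightarrow> s x = 0"
  shows "integrable lborel (\<lambda>y. s (x - y) *\<^sub>R v y)"
proof -
  obtain B where B: "\<And>x. norm (s x) \<le> B"
    using compact_support_bounded[OF assms(2,3)] by blast
  have [measurable]: "s \<in> borel_measurable borel"
    using assms(2) by (rule borel_measurable_continuous_onI)
  show ?thesis
    by (rule locint_mult_integrable[OF assms(1), where B=B and R="norm x + R"])
       (use B in \<open>auto intro!: assms(3) norm_diff_gt\<close>)
qed

lemma convol_integrable':
  fixes s :: "'a::euclidean_space \<Rightarrow> real" and v :: "'a \<Rightarrow> 'b::euclidean_space"
  assumes s: "locint s" and v: "continuous_on UNIV v" "\<And>x. R < norm x \<Longrightarrow> v x = 0"
  shows "integrable lborel (\<lambda>y. s y *\<^sub>R v (x - y))"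
proof -
  note [measurable] = locint_measurable[OF s] borel_measurable_continuous_onI[OF v(1)]
  have "integrable lborel (\<lambda>y. norm (v (x - y)) *\<^sub>R s y)"
    by (rule convol_integrable[where R=R]) (use v s in \<open>auto intro!: continuous_intros\<close>)
  then show ?thesis
    by (rule Bochner_Integration.integrable_bound) (auto simp: mult.commute)
qed

lemma convol_continuous:
  fixes s :: "'a::euclidean_space \<Rightarrow> real" and v :: "'a \<Rightarrow> 'b::euclidean_space"
  assumes s: "locint s" and v: "continuous_on UNIV v" "\<And>x. R < norm x \<Longrightarrow> v x = 0"
  shows "continuous_on UNIV (convol s v)"
proof -
  note [measurable] = locint_measurable[OF s] borel_measurable_continuous_onI[OF v(1)]
  have eq: "convol s v x = (\<integral>y. s y *\<^sub>R v (x - y) \<partial>lborel)" for x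
    by (rule convol_commute) measurable
  have "\<exists>d>0. \<forall>x'. dist x' x < d \<longrightarrow> dist (convol s v x') (convol s v x) < e" if "e > 0" for x e
  proof -
    \<comment> \<open>For every x' within distance 1 of x, both \<open>v (x - y)\<close> and
      \<open>v (x' - y)\<close> vanish for y outside this ball, so that only the mass of
      \<open>s\<close> inside it counts.\<close>
    let ?C = "\<lambda>y. indicator (cball 0 (norm x + R + 1)) y *\<^sub>R s y"
    define I where "I = (\<integral>y. norm (?C y) \<partial>lborel)"
    have I: "I \<ge> 0" by (simp add: I_def)
    have iC: "integrable lborel (\<lambda>y. norm (?C y))"
      using s by (auto simp: locint_def set_integrable_def intro!: integrable_norm)
    have "e / (I + 1) > 0" using that I by simp
    from compact_support_uniformly_continuous[OF v this]
    obtain d where d: "d > 0" "d \<le> 1" "\<And>x y. dist x y < d \<Longrightarrow> norm (v x - v y) < e / (I + 1)"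
      by blast
    have "dist (convol s v x') (convol s v x) < e" if x': "dist x' x < d" for x'
    proof -
      have "norm (convol s v x' - convol s v x) = norm (\<integral>y. s y *\<^sub>R v (x' - y) - s y *\<^sub>R v (x - y) \<partial>lborel)"
        unfolding eq by (subst Bochner_Integration.integral_diff) (use convol_integrable'[OF s v] in auto)
      also have "\<dots> \<le> (\<integral>y. (e / (I + 1)) * norm (?C y) \<partial>lborel)"
      proof (rule Bochner_Integration.integral_norm_bound_integral)
        show "integrable lborel (\<lambda>y. s y *\<^sub>R v (x' - y) - s y *\<^sub>R v (x - y))"
          using convol_integrable'[OF s v] by auto
        show "integrable lborel (\<lambda>y. e / (I + 1) * norm (?C y))"
          using iC by auto
        fix y
        have nx': "norm x' \<le> norm x + 1"
          using norm_triangle_sub[of x' x] x' d by (simp add: dist_norm)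
        show "norm (s y *\<^sub>R v (x' - y) - s y *\<^sub>R v (x - y)) \<le> e / (I + 1) * norm (?C y)"
        proof (cases "norm y \<le> norm x + R + 1")
          case True
          have "norm (v (x' - y) - v (x - y)) \<le> e / (I + 1)"
            using d(3)[of "x' - y" "x - y"] x' by (simp add: dist_norm)
          from mult_left_mono[OF this, of "norm (s y)"] show ?thesis
            using True by (simp add: scaleR_diff_right[symmetric] mult.commute)
        next
          case False
          then have "norm (x - y) > R" "norm (x' - y) > R"
            using norm_diff_gt[of x R y] norm_diff_gt[of x' R y] nx' by auto
          then show ?thesis using v(2) False by simp
        qed
      qed
      also have "\<dots> = e / (I + 1) * I" by (simp add: I_def)
      also have "\<dots> < e" using that I \<open>e > 0\<close> by (simp add: field_simps)
      finally show ?thesis by (simp add: dist_norm)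
    qed
    then show ?thesis using d by blast
  qed
  then show ?thesis
    by (simp add: continuous_on_iff)
qed

text \<open>Differentiation under the integral sign: the linearization error of \<open>k\<close> is
  at most a small multiple of the increment, uniformly in the base point, and it is integrated
  against \<open>s\<close> over one fixed ball.\<close>

lemma convol_C1:
  fixes s k :: "'a::euclidean_space \<Rightarrow> real"
  assumes s: "locint s" and k: "C1 k G" "\<And>x. R < norm x \<Longrightarrow> k x = 0"
  shows "C1 (convol s k) (convol s G)"
proof -
  have G: "continuous_on UNIV G" "\<And>x. R < norm x \<Longrightarrow> G x = 0"
    using C1_D(2)[OF k(1)] C1_gradient_eq_0[OF k] by blast+
  note k' = C1_D(3)[OF k(1)] k(2)
  note [measurable] = locint_measurable[OF s] C1_measurable[OF k(1)]
  have eq: "convol s k x = (\<integral>y. s y *\<^sub>R k (x - y) \<partial>lborel)" for x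
    by (rule convol_commute) measurable
  have eqG: "convol s G x = (\<integral>y. s y *\<^sub>R G (x - y) \<partial>lborel)" for x
    by (rule convol_commute) measurable
  have "(convol s k has_derivative (\<lambda>h. convol s G x \<bullet> h)) (at x)" for x
    unfolding has_derivative_at_alt
  proof (intro conjI allI impI)
    show "bounded_linear ((\<bullet>) (convol s G x))" by (rule bounded_linear_inner_right)
    fix e :: real assume "e > 0"
    let ?C = "\<lambda>y. indicator (cball 0 (norm x + R + 1)) y *\<^sub>R s y"
    define I where "I = (\<integral>y. norm (?C y) \<partial>lborel)"
    have I: "I \<ge> 0" by (simp add: I_def)
    have iC: "integrable lborel (\<lambda>y. norm (?C y))"
      using s by (auto simp: locint_def set_integrable_def intro!: integrable_norm)
    have "e / (I + 1) > 0" using \<open>e > 0\<close> I by simp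
    from C1_uniform_linearization[where R=R, OF k(1) _ this] G(2)
    obtain d where d: "d > 0" "d \<le> 1"
      "\<And>x h. norm h < d \<Longrightarrow> \<bar>k (x + h) - k x - G x \<bullet> h\<bar> \<le> e / (I + 1) * norm h"
      by blast
    have "norm (convol s k x' - convol s k x - convol s G x \<bullet> (x' - x)) \<le> e * norm (x' - x)"
      if x': "norm (x' - x) < d" for x'
    proof -
      have iG: "integrable lborel (\<lambda>y. (s y *\<^sub>R G (x - y)) \<bullet> (x' - x))"
        using convol_integrable'[OF s G] by (rule integrable_inner_left)
      have "convol s k x' - convol s k x - convol s G x \<bullet> (x' - x) =
        (\<integral>y. s y *\<^sub>R k (x' - y) - s y *\<^sub>R k (x - y) - (s y *\<^sub>R G (x - y)) \<bullet> (x' - x) \<partial>lborel)"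
        using integral_diff3[OF convol_integrable'[OF s k', where x=x'] convol_integrable'[OF s k', where x=x] iG]
        by (simp only: eq eqG integral_inner_left[OF convol_integrable'[OF s G]])
      also have "norm \<dots> \<le> (\<integral>y. (e / (I + 1) * norm (x' - x)) * norm (?C y) \<partial>lborel)"
      proof (rule Bochner_Integration.integral_norm_bound_integral)
        show "integrable lborel (\<lambda>y. s y *\<^sub>R k (x' - y) - s y *\<^sub>R k (x - y) - (s y *\<^sub>R G (x - y)) \<bullet> (x' - x))"
          using convol_integrable'[OF s k'] iG by auto
        show "integrable lborel (\<lambda>y. e / (I + 1) * norm (x' - x) * norm (?C y))"
          using iC by auto
        fix y
        have nx': "norm x' \<le> norm x + 1"
          using norm_triangle_sub[of x' x] x' d by (simp add: dist_norm)
        have eq': "s y *\<^sub>R k (x' - y) - s y *\<^sub>R k (x - y) - (s y *\<^sub>R G (x - y)) \<bullet> (x' - x)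
            = s y * (k ((x - y) + (x' - x)) - k (x - y) - G (x - y) \<bullet> (x' - x))"
          by (simp add: algebra_simps)
        show "norm (s y *\<^sub>R k (x' - y) - s y *\<^sub>R k (x - y) - (s y *\<^sub>R G (x - y)) \<bullet> (x' - x))
             \<le> e / (I + 1) * norm (x' - x) * norm (?C y)"
        proof (cases "norm y \<le> norm x + R + 1")
          case True
          from mult_left_mono[OF d(3)[OF x', of "x - y"], of "norm (s y)"] show ?thesis
            using True unfolding eq' by (simp add: abs_mult mult.commute)
        next
          case False
          then have "norm (x - y) > R" "norm (x' - y) > R"
            using norm_diff_gt[of x R y] norm_diff_gt[of x' R y] nx' by auto
          then show ?thesis using k(2) G(2) False by simp
        qed
      qed
      also have "\<dots> = (e / (I + 1) * I) * norm (x' - x)" by (simp add: I_def)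
      also have "\<dots> \<le> e * norm (x' - x)" using I \<open>e > 0\<close> by (intro mult_right_mono) (simp_all add: field_simps)
      finally show ?thesis .
    qed
    then show "\<exists>d>0. \<forall>y. norm (y - x) < d \<longrightarrow>
          norm (convol s k y - convol s k x - convol s G x \<bullet> (y - x)) \<le> e * norm (y - x)"
      using d by blast
  qed
  moreover have "continuous_on UNIV (convol s G)"
    by (rule convol_continuous[OF s G])
  ultimately show ?thesis by (simp add: C1_def)
qed

lemma C_c_infinity_partial:
  assumes k: "k \<in> C_c_infinity UNIV" and "i \<in> Basis"
  shows "(\<lambda>x. gradient k x \<bullet> i) \<in> C_c_infinity UNIV"
proof -
  obtain R where R: "\<And>x. R < norm x \<Longrightarrow> k x = 0" using C_c_infinity_bounded[OF k] by blast
  have eq: "frechet_derivative k (at x) = (\<lambda>h. gradient k x \<bullet> h)" for x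
    using C1_D(1)[OF C1_C_c_infinity[OF k]] frechet_derivative_at by metis
  have "C_k (Suc n) k" for n using k by (auto simp: C_c_infinity_def)
  then have "C_k n (\<lambda>x. gradient k x \<bullet> i)" for n
    using \<open>i \<in> Basis\<close> by (simp add: eq)
  then show ?thesis
    by (rule C_c_infinityI[where K="cball 0 R"])
       (use C1_gradient_eq_0[OF C1_C_c_infinity[OF k] R] in auto)
qed

text \<open>Every derivative falls on the kernel, so a locally integrable \<open>s\<close> becomes
  smooth. The induction keeps \<open>k\<close> arbitrary since its step passes to the partial
  derivatives of \<open>k\<close>, which are test functions again.\<close>

lemma convol_C_k:
  assumes s: "locint s" and k: "k \<in> C_c_infinity UNIV"
  shows "C_k n (convol s k)"
  using k
proof (induction n arbitrary: k)
  case 0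
  obtain R where R: "\<And>x. R < norm x \<Longrightarrow> k x = 0" using C_c_infinity_bounded[OF 0] by blast
  show ?case using convol_continuous[OF s C1_D(3)[OF C1_C_c_infinity[OF 0]] R] by simp
next
  case (Suc n)
  obtain R where R: "\<And>x. R < norm x \<Longrightarrow> k x = 0" using C_c_infinity_bounded[OF Suc.prems] by blast
  note C = C1_C_c_infinity[OF Suc.prems]
  note C' = convol_C1[OF s C R]
  show ?case
  proof (rule C_k_SucI[OF C1_D(1)[OF C']])
    fix i :: 'a assume i: "i \<in> Basis"
    note [measurable] = locint_measurable[OF s] C1_measurable[OF C]
    have "convol s (gradient k) x \<bullet> i = convol s (\<lambda>x. gradient k x \<bullet> i) x" for x
    proof -
      have "convol s (gradient k) x \<bullet> i = (\<integral>y. s y *\<^sub>R gradient k (x - y) \<partial>lborel) \<bullet> i"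
        by (subst convol_commute) auto
      also have "\<dots> = (\<integral>y. (s y *\<^sub>R gradient k (x - y)) \<bullet> i \<partial>lborel)"
        using convol_integrable'[OF s C1_D(2)[OF C] C1_gradient_eq_0[OF C R]] by (rule integral_inner_left[symmetric])
      also have "\<dots> = convol s (\<lambda>x. gradient k x \<bullet> i) x"
        by (subst convol_commute) auto
      finally show ?thesis .
    qed
    then show "C_k n (\<lambda>x. convol s (gradient k) x \<bullet> i)"
      using Suc.IH[OF C_c_infinity_partial[OF Suc.prems i]] by simp
  qed
qed

section \<open>Approximation in local \<open>L\<^sup>p\<close> spaces\<close>

lemma cball_sets_borel [measurable]: "cball a r \<in> sets borel"
  by simp

lemma emeasure_cball_finite: "emeasure lborel (cball (a::'a::euclidean_space) r) < top"
  using emeasure_bounded_finite[OF bounded_cball[of a r]] by (simp add: infinity_ennreal_def)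

text \<open>The convex function t^p lies above its tangent at b. When both numbers are positive this
  is Young's inequality for a and b^(p-1) with the exponents p and p/(p-1).\<close>

lemma powr_tangent:
  fixes a b p :: real
  assumes "p > 1" "a \<ge> 0" "b \<ge> 0"
  shows "b powr p + p * b powr (p - 1) * (a - b) \<le> a powr p"
proof -
  consider "b = 0" | "a = 0" "b > 0" | "a > 0" "b > 0" using assms by linarith
  then show ?thesis
  proof cases
    case 1
    then show ?thesis using assms by simp
  next
    case 2
    have "b powr (p - 1) * b = b powr p" using 2 by (simp add: powr_mult_base mult.commute)
    moreover have "1 * b powr p \<le> p * b powr p" using assms by (intro mult_right_mono) auto
    ultimately show ?thesis using 2 assms by (simp add: mult.assoc)
  next
    case 3
    have "(a powr p) powr (1/p) * (b powr p) powr ((p-1)/p) \<le> (1/p) * a powr p + ((p-1)/p) * b powr p"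
      using assms 3 by (intro Youngs_inequality_0) (auto simp: field_simps)
    moreover have "(a powr p) powr (1/p) = a" "(b powr p) powr ((p-1)/p) = b powr (p - 1)"
      using assms 3 by (auto simp: powr_powr)
    ultimately have "a * b powr (p - 1) \<le> (1/p) * a powr p + ((p-1)/p) * b powr p" by simp
    then have "p * (a * b powr (p - 1)) \<le> p * ((1/p) * a powr p + ((p-1)/p) * b powr p)"
      using assms by (intro mult_left_mono) auto
    also have "\<dots> = a powr p + (p - 1) * b powr p"
      using assms by (simp add: field_simps)
    finally have "p * (a * b powr (p - 1)) \<le> a powr p + (p - 1) * b powr p" .
    moreover have "b powr p = b * b powr (p - 1)" using 3 by (simp add: powr_mult_base)
    ultimately show ?thesis by (simp add: algebra_simps)
  qed
qed

lemma powr_add_le: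
  fixes a b p :: real
  assumes "p \<ge> 0" "a \<ge> 0" "b \<ge> 0"
  shows "(a + b) powr p \<le> 2 powr p * (a powr p + b powr p)"
proof -
  have "(a + b) powr p \<le> (2 * max a b) powr p"
    using assms by (intro powr_mono2) auto
  also have "\<dots> = 2 powr p * max a b powr p" by (simp add: powr_mult)
  also have "\<dots> \<le> 2 powr p * (a powr p + b powr p)"
    by (intro mult_left_mono) (auto simp: max_def)
  finally show ?thesis .
qed

lemma ennreal_norm_add_powr_le:
  fixes x y :: "'a::real_normed_vector"
  assumes "p \<ge> 0"
  shows "ennreal (norm (x + y) powr p) \<le> ennreal (2 powr p) * (ennreal (norm x powr p) + ennreal (norm y powr p))"
proof -
  have "norm (x + y) powr p \<le> (norm x + norm y) powr p"
    using assms by (intro powr_mono2 norm_triangle_ineq) auto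
  also have "\<dots> \<le> 2 powr p * (norm x powr p + norm y powr p)"
    using assms by (intro powr_add_le) auto
  finally show ?thesis
    by (simp add: ennreal_mult[symmetric] ennreal_plus[symmetric] del: ennreal_plus)
qed

text \<open>Jensen's inequality for the probability density \<open>w\<close>: the tangent inequality
  at the mean b is multiplied by \<open>w\<close> and integrated, and its linear term integrates to
  zero.\<close>

lemma powr_integral_le:
  fixes w f :: "'a \<Rightarrow> real"
  assumes p: "p > 1" and w: "\<And>x. w x \<ge> 0" "integrable M w" "(\<integral>x. w x \<partial>M) = 1"
    and f: "\<And>x. f x \<ge> 0" "f \<in> borel_measurable M" "integrable M (\<lambda>x. w x * f x)"
  shows "ennreal ((\<integral>x. w x * f x \<partial>M) powr p) \<le> (\<integral>\<^sup>+x. ennreal (w x * f x powr p) \<partial>M)"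
proof (cases "(\<integral>\<^sup>+x. ennreal (w x * f x powr p) \<partial>M) = \<infinity>")
  case False
  note [measurable] = f(2) borel_measurable_integrable[OF w(2)]
  define b where "b = (\<integral>x. w x * f x \<partial>M)"
  have b: "b \<ge> 0" unfolding b_def using w f by (intro integral_nonneg_AE) auto
  have i: "integrable M (\<lambda>x. w x * f x powr p)"
    using False w f by (intro integrableI_nonneg) (auto simp: top.not_eq_extremum)
  have "b powr p = (\<integral>x. (b powr p - p * b powr (p - 1) * b) * w x + p * b powr (p - 1) * (w x * f x) \<partial>M)"
    using w f by (simp add: b_def[symmetric])
  also have "\<dots> \<le> (\<integral>x. w x * f x powr p \<partial>M)"
  proof (rule integral_mono)
    show "integrable M (\<lambda>x. (b powr p - p * b powr (p - 1) * b) * w x + p * b powr (p - 1) * (w x * f x))"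
      using w f by auto
    show "(b powr p - p * b powr (p - 1) * b) * w x + p * b powr (p - 1) * (w x * f x) \<le> w x * f x powr p" for x
      using mult_left_mono[OF powr_tangent[OF p f(1)[of x] b] w(1)[of x]] by (simp add: algebra_simps)
  qed (rule i)
  finally have "ennreal (b powr p) \<le> ennreal (\<integral>x. w x * f x powr p \<partial>M)"
    by (rule ennreal_leI)
  also have "\<dots> = (\<integral>\<^sup>+x. ennreal (w x * f x powr p) \<partial>M)"
    using i w f by (intro nn_integral_eq_integral[symmetric]) auto
  finally show ?thesis by (simp add: b_def)
qed simp

text \<open>The p-th power of the L^p norm on \<open>S\<close>, without the root. As an
  \<open>ennreal\<close> it needs no integrability side conditions; the price is a triangle
  inequality with the factor 2^p.\<close>

definition Lpow :: "real \<Rightarrow> 'a::euclidean_space set \<Rightarrow> ('a \<Rightarrow> 'b::euclidean_space) \<Rightarrow> ennreal" where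
  "Lpow p S f = (\<integral>\<^sup>+x. ennreal (norm (f x) powr p) * indicator S x \<partial>lborel)"

definition locLp :: "real \<Rightarrow> ('a::euclidean_space \<Rightarrow> 'b::euclidean_space) \<Rightarrow> bool" where
  "locLp p f \<longleftrightarrow> f \<in> borel_measurable borel \<and> (\<forall>R. Lpow p (cball 0 R) f < \<infinity>)"

lemma Lpow_add_le:
  assumes [measurable]: "f \<in> borel_measurable borel" "g \<in> borel_measurable borel" "S \<in> sets borel" and "p \<ge> 0"
  shows "Lpow p S (\<lambda>x. f x + g x) \<le> ennreal (2 powr p) * (Lpow p S f + Lpow p S g)"
proof -
  have "Lpow p S (\<lambda>x. f x + g x) \<le> (\<integral>\<^sup>+x. ennreal (2 powr p) *
      (ennreal (norm (f x) powr p) * indicator S x + ennreal (norm (g x) powr p) * indicator S x) \<partial>lborel)"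
    unfolding Lpow_def distrib_right[symmetric] mult.assoc[symmetric]
    by (intro nn_integral_mono mult_right_mono ennreal_norm_add_powr_le) (use assms in auto)
  also have "\<dots> = ennreal (2 powr p) * (Lpow p S f + Lpow p S g)"
    unfolding Lpow_def by (subst nn_integral_cmult) (auto simp: nn_integral_add)
  finally show ?thesis .
qed

lemma Lpow_minus_commute: "Lpow p S (\<lambda>x. f x - g x) = Lpow p S (\<lambda>x. g x - f x)"
  unfolding Lpow_def by (simp add: norm_minus_commute)

lemma Lpow_mono_set: "S \<subseteq> T \<Longrightarrow> Lpow p S f \<le> Lpow p T f"
  unfolding Lpow_def by (intro nn_integral_mono mult_left_mono) (auto simp: indicator_def)

lemma locLp_imp_locint:
  assumes f: "locLp p f" and "p \<ge> 1"
  shows "locint f"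
proof -
  have [measurable]: "f \<in> borel_measurable borel" using f by (simp add: locLp_def)
  have "(\<integral>\<^sup>+x. ennreal (norm (indicator (cball 0 R) x *\<^sub>R f x)) \<partial>lborel) < \<infinity>" for R
  proof -
    have "(\<integral>\<^sup>+x. ennreal (norm (indicator (cball 0 R) x *\<^sub>R f x)) \<partial>lborel)
      \<le> (\<integral>\<^sup>+x. indicator (cball 0 R) x + ennreal (norm (f x) powr p) * indicator (cball 0 R) x \<partial>lborel)"
    proof (rule nn_integral_mono)
      fix x
      have "norm (f x) \<le> 1 + norm (f x) powr p"
        using powr_mono[of 1 p "norm (f x)"] \<open>p \<ge> 1\<close> by (cases "norm (f x) \<ge> 1") (auto intro: order_trans add_increasing2)
      then have "ennreal (norm (f x)) \<le> 1 + ennreal (norm (f x) powr p)"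
        by (metis ennreal_1 ennreal_leI ennreal_plus norm_ge_zero powr_ge_zero zero_le_one)
      then show "ennreal (norm (indicator (cball 0 R) x *\<^sub>R f x))
         \<le> indicator (cball 0 R) x + ennreal (norm (f x) powr p) * indicator (cball 0 R) x"
        by (auto simp: indicator_def)
    qed
    also have "\<dots> = emeasure lborel (cball (0::'a) R) + Lpow p (cball 0 R) f"
      unfolding Lpow_def by (subst nn_integral_add) auto
    also have "\<dots> < \<infinity>"
      using f by (auto simp: locLp_def emeasure_cball_finite)
    finally show ?thesis .
  qed
  then show ?thesis
    by (auto simp: locint_def set_integrable_def integrable_iff_bounded)
qed

text \<open>The radial retraction onto the ball of radius T. It is continuous and bounded, so
  truncating with it supplies the dominating constants for dominated convergence.\<close>

definition clip :: "real \<Rightarrow> 'a::euclidean_space \<Rightarrow> 'a" where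
  "clip T z = (T / max T (norm z)) *\<^sub>R z"

lemma clip_props:
  assumes "T > 0"
  shows "norm (clip T z) \<le> T" "norm (clip T z - z) \<le> norm z" "norm z \<le> T \<Longrightarrow> clip T z = z"
    "continuous_on UNIV (clip T)"
proof -
  show "norm (clip T z) \<le> T"
    using assms by (simp add: clip_def field_simps max_def)
  have "clip T z - z = (T / max T (norm z) - 1) *\<^sub>R z" by (simp add: clip_def algebra_simps)
  moreover have "\<bar>T / max T (norm z) - 1\<bar> \<le> 1"
    using assms by (auto simp: max_def abs_le_iff divide_le_eq)
  ultimately show "norm (clip T z - z) \<le> norm z"
    using mult_right_mono[of "\<bar>T / max T (norm z) - 1\<bar>" 1 "norm z"] by simp
  show "norm z \<le> T \<Longrightarrow> clip T z = z" using assms by (simp add: clip_def max_def)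
  show "continuous_on UNIV (clip T)"
    unfolding clip_def[abs_def] using assms by (intro continuous_intros) (auto simp: max_def)
qed

lemma Lpow_tendsto_0:
  fixes f :: "nat \<Rightarrow> 'a::euclidean_space \<Rightarrow> 'b::euclidean_space"
  assumes [measurable]: "\<And>n. f n \<in> borel_measurable borel" "h \<in> borel_measurable borel" "S \<in> sets borel"
    and le: "\<And>n x. norm (f n x) powr p \<le> h x"
    and h: "(\<integral>\<^sup>+x. ennreal (h x) * indicator S x \<partial>lborel) < \<infinity>"
    and lim: "AE x in lborel. (\<lambda>n. f n x) \<longlonglongrightarrow> 0" and "p > 0"
  shows "(\<lambda>n. Lpow p S (f n)) \<longlonglongrightarrow> 0"
proof -
  have "(\<lambda>n. \<integral>\<^sup>+x. ennreal (norm (f n x) powr p) * indicator S x \<partial>lborel) \<longlonglongrightarrow> (\<integral>\<^sup>+(x::'a). 0 \<partial>lborel)"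
  proof (rule nn_integral_dominated_convergence[where w="\<lambda>x. ennreal (h x) * indicator S x"])
    show "AE x in lborel. (\<lambda>n. ennreal (norm (f n x) powr p) * indicator S x) \<longlonglongrightarrow> 0"
      using lim
    proof eventually_elim
      fix x assume "(\<lambda>n. f n x) \<longlonglongrightarrow> 0"
      then have "(\<lambda>n. norm (f n x) powr p) \<longlonglongrightarrow> 0"
        using \<open>p > 0\<close> by (intro tendsto_eq_intros tendsto_zero_powrI) (auto intro: tendsto_norm_zero)
      then have "(\<lambda>n. ennreal (norm (f n x) powr p)) \<longlonglongrightarrow> ennreal 0"
        by (rule tendsto_ennrealI)
      then show "(\<lambda>n. ennreal (norm (f n x) powr p) * indicator S x) \<longlonglongrightarrow> 0"
        by (auto simp: indicator_def)
    qed
  qed (use le h in \<open>auto intro!: mult_right_mono ennreal_leI\<close>)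
  then show ?thesis by (simp add: Lpow_def)
qed

text \<open>Truncation first makes \<open>f\<close> bounded at a small cost. A measurable function
  is an almost everywhere limit of continuous ones, by \<open>measurable_on\<close>; truncating
  these at the same height keeps them continuous and gives a constant bound on the ball.\<close>

lemma locLp_continuous_approx:
  fixes f :: "'a::euclidean_space \<Rightarrow> 'b::euclidean_space"
  assumes f: "locLp p f" and p: "p > 0" and e: "e > (0::ennreal)"
  obtains G where "continuous_on UNIV G" "Lpow p (cball 0 R) (\<lambda>x. G x - f x) < e"
proof -
  have [measurable]: "f \<in> borel_measurable borel" using f by (simp add: locLp_def)
  have [measurable]: "clip T \<in> borel_measurable borel" if "T > 0" for T :: real
    using clip_props(4)[OF that] by (rule borel_measurable_continuous_onI)
  have small: "\<exists>d>0. ennreal (2 powr p) * (d + d) < e"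
  proof -
    obtain r where r: "r > 0" "ennreal r \<le> e"
      using e by (cases e) (auto intro: that[of 1])
    have "ennreal (2 powr p) * (ennreal (r / (4 * 2 powr p)) + ennreal (r / (4 * 2 powr p))) = ennreal (r / 2)"
      using r by (simp add: ennreal_plus[symmetric] ennreal_mult[symmetric] del: ennreal_plus)
    also have "\<dots> < ennreal r" using r by (intro ennreal_lessI) auto
    also note r(2)
    finally show ?thesis
      using r by (intro exI[of _ "ennreal (r / (4 * 2 powr p))"]) auto
  qed
  then obtain d where d: "d > 0" "ennreal (2 powr p) * (d + d) < e" by blast
  have "(\<lambda>n. Lpow p (cball 0 R) (\<lambda>x. clip (real (Suc n)) (f x) - f x)) \<longlonglongrightarrow> 0"
  proof (rule Lpow_tendsto_0[where h="\<lambda>x. norm (f x) powr p"])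
    show "(\<integral>\<^sup>+x. ennreal (norm (f x) powr p) * indicator (cball 0 R) x \<partial>lborel) < \<infinity>"
      using f by (simp add: locLp_def Lpow_def)
    have "(\<lambda>n. clip (real (Suc n)) (f x) - f x) \<longlonglongrightarrow> 0" for x
    proof (rule tendsto_eventually)
      show "\<forall>\<^sub>F n in sequentially. clip (real (Suc n)) (f x) - f x = 0"
        using eventually_ge_at_top[of "nat \<lceil>norm (f x)\<rceil>"]
        by eventually_elim (subst clip_props(3), auto simp: nat_le_iff ceiling_le_iff)
    qed
    then show "AE x in lborel. (\<lambda>n. clip (real (Suc n)) (f x) - f x) \<longlonglongrightarrow> 0" by simp
  qed (use p in \<open>auto intro!: powr_mono2 clip_props(2)\<close>)
  from order_tendstoD(2)[OF this d(1)] obtain n where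
    n: "Lpow p (cball 0 R) (\<lambda>x. clip (real (Suc n)) (f x) - f x) < d"
    by (auto simp: eventually_sequentially)
  define T where "T = real (Suc n)"
  have T: "T > 0" by (simp add: T_def)
  have "f measurable_on UNIV"
    by (intro lebesgue_measurable_imp_measurable_on measurable_completion) auto
  then obtain N g where N: "negligible N" and g: "\<And>n. continuous_on UNIV (g n)"
      "\<And>x. x \<notin> N \<Longrightarrow> (\<lambda>n. g n x) \<longlonglongrightarrow> f x"
    by (auto simp: measurable_on_def)
  have [measurable]: "g n \<in> borel_measurable borel" for n
    using g(1) by (rule borel_measurable_continuous_onI)
  have cont: "continuous_on UNIV (\<lambda>x. clip T (g n x))" for n
    using continuous_on_compose2[OF clip_props(4)[OF T] g(1)] by auto
  have "AE x in lebesgue. x \<notin> N"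
    using N by (intro AE_not_in) (simp add: negligible_iff_null_sets)
  then have AEN: "AE x in lborel. x \<notin> N"
    by (simp add: AE_completion_iff)
  have "(\<lambda>n. Lpow p (cball 0 R) (\<lambda>x. clip T (g n x) - clip T (f x))) \<longlonglongrightarrow> 0"
  proof (rule Lpow_tendsto_0[where h="\<lambda>x. (2 * T) powr p"])
    show "(\<integral>\<^sup>+(x::'a). ennreal ((2 * T) powr p) * indicator (cball 0 R) x \<partial>lborel) < \<infinity>"
      by (simp add: nn_integral_cmult ennreal_mult_less_top emeasure_cball_finite)
    show "AE x in lborel. (\<lambda>n. clip T (g n x) - clip T (f x)) \<longlonglongrightarrow> 0"
      using AEN
    proof eventually_elim
      fix x assume "x \<notin> N"
      have "isCont (clip T) (f x)"
        by (rule continuous_on_interior[OF clip_props(4)[OF T]]) auto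
      from isCont_tendsto_compose[OF this g(2)[OF \<open>x \<notin> N\<close>]]
      show "(\<lambda>n. clip T (g n x) - clip T (f x)) \<longlonglongrightarrow> 0"
        by (rule LIM_zero)
    qed
    show "norm (clip T (g n x) - clip T (f x)) powr p \<le> (2 * T) powr p" for n x
      using clip_props(1)[OF T, of "g n x"] clip_props(1)[OF T, of "f x"] p
        norm_triangle_ineq4[of "clip T (g n x)" "clip T (f x)"]
      by (intro powr_mono2) auto
  qed (use p T in auto)
  from order_tendstoD(2)[OF this d(1)] obtain m where
    m: "Lpow p (cball 0 R) (\<lambda>x. clip T (g m x) - clip T (f x)) < d"
    by (auto simp: eventually_sequentially)
  have "Lpow p (cball 0 R) (\<lambda>x. (clip T (g m x) - clip T (f x)) + (clip T (f x) - f x))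
     \<le> ennreal (2 powr p) * (Lpow p (cball 0 R) (\<lambda>x. clip T (g m x) - clip T (f x)) +
          Lpow p (cball 0 R) (\<lambda>x. clip T (f x) - f x))"
    using p T by (intro Lpow_add_le) auto
  also have "\<dots> \<le> ennreal (2 powr p) * (d + d)"
    using m n by (intro mult_left_mono add_mono) (auto simp: T_def)
  also have "\<dots> < e" by (rule d(2))
  finally have "Lpow p (cball 0 R) (\<lambda>x. clip T (g m x) - f x) < e" by simp
  with cont that show ?thesis by blast
qed

lemma Lpow_translate_le:
  fixes f :: "'a::euclidean_space \<Rightarrow> 'b::euclidean_space"
  assumes [measurable]: "f \<in> borel_measurable borel" and y: "norm y \<le> 1"
  shows "Lpow p (cball 0 R) (\<lambda>x. f (x - y)) \<le> Lpow p (cball 0 (R + 1)) f"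
proof -
  have "Lpow p (cball 0 R) (\<lambda>x. f (x - y)) \<le>
      (\<integral>\<^sup>+x. ennreal (norm (f (x + - y)) powr p) * indicator (cball 0 (R+1)) (x + - y) \<partial>lborel)"
    unfolding Lpow_def
  proof (intro nn_integral_mono)
    fix x
    have "norm (x - y) \<le> norm x + 1" using norm_triangle_ineq4[of x y] y by simp
    then show "ennreal (norm (f (x - y)) powr p) * indicator (cball 0 R) x
      \<le> ennreal (norm (f (x + - y)) powr p) * indicator (cball 0 (R + 1)) (x + - y)"
      by (auto simp: indicator_def)
  qed
  also have "\<dots> = Lpow p (cball 0 (R + 1)) f"
    unfolding Lpow_def
    by (rule nn_integral_lborel_translate[where f="\<lambda>x. ennreal (norm (f x) powr p) * indicator (cball 0 (R+1)) x"]) auto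
  finally show ?thesis .
qed

text \<open>Continuity of translations in local L^p, which is clear for a uniformly continuous
  \<open>G\<close> close to \<open>f\<close>. The approximation is made on the ball of radius R + 1,
  since the translated error \<open>f - G\<close> is also measured.\<close>

lemma locLp_translate:
  fixes f :: "'a::euclidean_space \<Rightarrow> 'b::euclidean_space"
  assumes f: "locLp p f" and p: "p > 0" and e: "e > (0::ennreal)"
  obtains d where "d > 0" "\<And>y. norm y \<le> d \<Longrightarrow> Lpow p (cball 0 R) (\<lambda>x. f (x - y) - f x) < e"
proof -
  have [measurable]: "f \<in> borel_measurable borel" using f by (simp add: locLp_def)
  define C where "C = 2 powr p"
  \<comment> \<open>Three errors of size d are combined by two applications of the triangle
    inequality with factor C; this is the resulting total.\<close>
  have "\<exists>d>0. ennreal C * (ennreal d + ennreal C * (ennreal d + ennreal d)) < e"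
  proof -
    obtain r where r: "r > 0" "ennreal r \<le> e"
      using e by (cases e) (auto intro: that[of 1])
    define d where "d = r / (2 * (C * (1 + 2 * C)))"
    have C: "C > 0" by (simp add: C_def)
    have d: "d > 0" using r C by (simp add: d_def)
    have "ennreal C * (ennreal d + ennreal C * (ennreal d + ennreal d)) = ennreal (C * (d + C * (d + d)))"
      using d C by (simp add: ennreal_plus[symmetric] ennreal_mult[symmetric] del: ennreal_plus)
    also have "C * (d + C * (d + d)) = C * (1 + 2 * C) * d" by (simp add: algebra_simps)
    also have "\<dots> = r / 2" using C less_imp_neq[of 0 "C * (1 + 2 * C)"] unfolding d_def by (simp add: add_pos_pos)
    also have "ennreal (r / 2) < ennreal r" using r by (intro ennreal_lessI) auto
    also note r(2)
    finally show ?thesis using d by blast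
  qed
  then obtain d where d: "d > 0" "ennreal C * (ennreal d + ennreal C * (ennreal d + ennreal d)) < e" by blast
  have "ennreal d > 0" using d by simp
  from locLp_continuous_approx[OF f p this] obtain G where
    G: "continuous_on UNIV G" "Lpow p (cball 0 (R+1)) (\<lambda>x. G x - f x) < ennreal d" by blast
  have [measurable]: "G \<in> borel_measurable borel"
    using G(1) by (rule borel_measurable_continuous_onI)
  define V where "V = measure lborel (cball (0::'a) R)"
  have V: "V \<ge> 0" "emeasure lborel (cball (0::'a) R) = ennreal V"
    unfolding V_def by (auto simp: emeasure_eq_ennreal_measure emeasure_cball_finite less_top)
  \<comment> \<open>Chosen so that a uniform error of this size contributes at most d to the p-th
    power integral over the ball, whose volume is V; the added 1 keeps the quotient meaningful for V
    = 0.\<close>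
  define \<eta> where "\<eta> = (d / (V + 1)) powr (1/p)"
  have eta: "\<eta> > 0" "\<eta> powr p = d / (V + 1)"
    using d V p by (auto simp: \<eta>_def powr_powr)
  have "uniformly_continuous_on (cball 0 (R+1)) G"
    using G(1) by (intro compact_uniformly_continuous) (auto intro: continuous_on_subset)
  then obtain d' where d': "d' > 0" "\<And>x y. x \<in> cball 0 (R+1) \<Longrightarrow> y \<in> cball 0 (R+1) \<Longrightarrow>
      dist y x < d' \<Longrightarrow> dist (G y) (G x) < \<eta>"
    unfolding uniformly_continuous_on_def using eta(1) by metis
  have "Lpow p (cball 0 R) (\<lambda>x. f (x - y) - f x) < e" if y: "norm y \<le> min (d'/2) 1" for y
  proof -
    have y1: "norm y \<le> 1" "norm y < d'" using y d' by auto
    have 1: "Lpow p (cball 0 R) (\<lambda>x. f (x - y) - G (x - y)) \<le> ennreal d"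
      using Lpow_translate_le[OF _ y1(1), of "\<lambda>x. f x - G x" p R] G(2)
      by (subst (asm) (2) Lpow_minus_commute) (simp add: order_trans less_imp_le)
    have 2: "Lpow p (cball 0 R) (\<lambda>x. G (x - y) - G x) \<le> ennreal d"
    proof -
      have "Lpow p (cball 0 R) (\<lambda>x. G (x - y) - G x) \<le> (\<integral>\<^sup>+x. ennreal (\<eta> powr p) * indicator (cball 0 R) (x::'a) \<partial>lborel)"
        unfolding Lpow_def
      proof (intro nn_integral_mono)
        fix x :: 'a
        show "ennreal (norm (G (x - y) - G x) powr p) * indicator (cball 0 R) x \<le> ennreal (\<eta> powr p) * indicator (cball 0 R) x"
        proof (cases "norm x \<le> R")
          case True
          then have "dist (G (x - y)) (G x) < \<eta>"
            using y1 norm_triangle_ineq4[of x y] by (intro d'(2)) (auto simp: dist_norm norm_minus_commute[of y x])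
          then show ?thesis
            using p by (intro mult_right_mono ennreal_leI powr_mono2) (auto simp: dist_norm)
        qed auto
      qed
      also have "\<dots> = ennreal (\<eta> powr p) * ennreal V" by (simp add: nn_integral_cmult V)
      also have "\<dots> = ennreal (d / (V + 1) * V)" unfolding eta(2) by (rule ennreal_mult''[OF V(1), symmetric])
      also have "\<dots> \<le> ennreal d" using V d by (intro ennreal_leI) (simp add: field_simps)
      finally show ?thesis .
    qed
    have 3: "Lpow p (cball 0 R) (\<lambda>x. G x - f x) \<le> ennreal d"
      using order_trans[OF Lpow_mono_set less_imp_le[OF G(2)]] by (simp add: subset_cball)
    have "Lpow p (cball 0 R) (\<lambda>x. (f (x - y) - G (x - y)) + ((G (x - y) - G x) + (G x - f x)))
      \<le> ennreal C * (Lpow p (cball 0 R) (\<lambda>x. f (x - y) - G (x - y)) + Lpow p (cball 0 R) (\<lambda>x. (G (x - y) - G x) + (G x - f x)))"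
      unfolding C_def using p by (intro Lpow_add_le) auto
    also have "\<dots> \<le> ennreal C * (ennreal d + ennreal C * (ennreal d + ennreal d))"
    proof (intro mult_left_mono add_mono 1)
      have "Lpow p (cball 0 R) (\<lambda>x. (G (x - y) - G x) + (G x - f x))
        \<le> ennreal C * (Lpow p (cball 0 R) (\<lambda>x. G (x - y) - G x) + Lpow p (cball 0 R) (\<lambda>x. G x - f x))"
        unfolding C_def using p by (intro Lpow_add_le) auto
      also have "\<dots> \<le> ennreal C * (ennreal d + ennreal d)"
        by (intro mult_left_mono add_mono 2 3) auto
      finally show "Lpow p (cball 0 R) (\<lambda>x. (G (x - y) - G x) + (G x - f x)) \<le> ennreal C * (ennreal d + ennreal d)" .
    qed auto
    also have "\<dots> < e" by (rule d(2))
    finally show ?thesis by simp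
  qed
  then show ?thesis using that[of "min (d'/2) 1"] d' by auto
qed

section \<open>Mollification and its convergence in local L^p\<close>

definition moll :: "nat \<Rightarrow> 'a::euclidean_space \<Rightarrow> real" where
  "moll n x = bump 1 (inverse (real (Suc n))) 0 x / (\<integral>y. bump 1 (inverse (real (Suc n))) (0::'a) y \<partial>lborel)"

lemma bump_integrable: "integrable lborel (bump P e a)"
proof -
  have B: "bump P e a \<in> C_c_infinity UNIV" by (rule C_c_infinity_bump)
  obtain R where R: "\<And>x. R < norm x \<Longrightarrow> bump P e a x = 0" using C_c_infinity_bounded[OF B] by blast
  have "set_integrable lborel (cball 0 R) (bump P e a)"
    using locint_continuous[OF C1_D(3)[OF C1_C_c_infinity[OF B]]] by (simp add: locint_def)
  moreover have "(\<lambda>x. indicator (cball 0 R) x *\<^sub>R bump P e a x) = bump P e a"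
    using R by (auto simp: indicator_def fun_eq_iff)
  ultimately show ?thesis by (simp only: set_integrable_def)
qed

lemma bump_integral_pos:
  assumes "e > 0"
  shows "(\<integral>y. bump 1 e (a::'a::euclidean_space) y \<partial>lborel) > 0"
proof -
  have "(\<integral>y. bump 1 e a y \<partial>lborel) \<noteq> 0"
  proof
    assume "(\<integral>y. bump 1 e a y \<partial>lborel) = 0"
    then have "AE y in lborel. bump 1 e a y = 0"
      using integral_nonneg_eq_0_iff_AE[OF bump_integrable, of 1 e a] by (simp add: bump_1_nonneg)
    then have "AE y in lborel. y \<notin> ball a e"
      by eventually_elim (use assms bump_1_pos[of _ a e] in \<open>force simp: dist_norm norm_minus_commute\<close>)
    then have "emeasure lborel (ball a e) = 0"
      by (subst (asm) AE_iff_measurable[of "ball a e"]) auto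
    then have "unit_ball_vol (real DIM('a)) * e ^ DIM('a) \<le> 0"
      using assms by (simp add: emeasure_ball ennreal_eq_0_iff)
    moreover have "unit_ball_vol (real DIM('a)) * e ^ DIM('a) > 0"
      using assms by (intro mult_pos_pos) auto
    ultimately show False by linarith
  qed
  then show ?thesis
    using integral_nonneg_AE[of "bump 1 e a" lborel] by (auto simp: bump_1_nonneg less_le)
qed

lemma C_c_infinity_cmult:
  fixes f :: "'a::euclidean_space \<Rightarrow> real"
  assumes "f \<in> C_c_infinity UNIV" shows "(\<lambda>x. c * f x) \<in> C_c_infinity UNIV"
proof -
  obtain R where R: "\<And>x. R < norm x \<Longrightarrow> f x = 0" using C_c_infinity_bounded[OF assms] by blast
  show ?thesis
    by (rule C_c_infinityI[where K="cball 0 R"])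
      (use assms R in \<open>auto intro!: C_k_mult C_k_const simp: C_c_infinity_def\<close>)
qed

lemma moll_props:
  fixes x :: "'a::euclidean_space"
  shows "moll n x \<ge> 0" "inverse (real (Suc n)) < norm x \<Longrightarrow> moll n x = 0" "integrable lborel (moll n :: 'a \<Rightarrow> real)"
    "(\<integral>x. moll n (x::'a) \<partial>lborel) = 1" "moll n \<in> C_c_infinity (UNIV::'a set)"
    "(\<lambda>y. moll n (x - y)) \<in> C_c_infinity UNIV"
proof -
  let ?e = "inverse (real (Suc n))" and ?I = "\<integral>y. bump 1 (inverse (real (Suc n))) (0::'a) y \<partial>lborel"
  have I: "?I > 0" by (intro bump_integral_pos) auto
  show "moll n x \<ge> 0" using I unfolding moll_def by (intro divide_nonneg_pos bump_1_nonneg)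
  show "?e < norm x \<Longrightarrow> moll n x = 0" unfolding moll_def by (subst bump_eq_0) auto
  have m: "moll n = (\<lambda>x::'a. (1 / ?I) * bump 1 ?e 0 x)" by (simp add: moll_def fun_eq_iff)
  show "integrable lborel (moll n :: 'a \<Rightarrow> real)"
    unfolding m by (intro integrable_mult_right bump_integrable)
  show "(\<integral>x. moll n (x::'a) \<partial>lborel) = 1"
    unfolding m using I by simp
  show "moll n \<in> C_c_infinity (UNIV::'a set)"
    unfolding m by (intro C_c_infinity_cmult C_c_infinity_bump)
  have "(\<lambda>y. moll n (x - y)) = (\<lambda>y. (1 / ?I) * bump 1 ?e x y)"
    unfolding m bump_def by (simp add: inner_diff_left inner_diff_right algebra_simps inner_commute)
  then show "(\<lambda>y. moll n (x - y)) \<in> C_c_infinity UNIV"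
    by (simp only: C_c_infinity_cmult[OF C_c_infinity_bump])
qed

lemma moll_measurable [measurable]: "moll n \<in> borel_measurable borel"
  using borel_measurable_integrable[OF moll_props(3)] by simp

lemma moll_continuous: "continuous_on UNIV (moll n)"
  using C1_D(3)[OF C1_C_c_infinity[OF moll_props(5)]] .

text \<open>\<open>moll n\<close> is a probability density on a small ball. By Jensen's inequality
  and Fubini the error of mollification is at most an average of translation errors over that
  ball.\<close>

lemma convol_moll_Lpow_le:
  fixes f :: "'a::euclidean_space \<Rightarrow> 'b::euclidean_space"
  assumes f: "locLp p f" and p: "p > 1"
    and e: "\<And>y. norm y \<le> inverse (real (Suc n)) \<Longrightarrow> Lpow p (cball 0 R) (\<lambda>x. f (x - y) - f x) \<le> e"
  shows "Lpow p (cball 0 R) (\<lambda>x. convol (moll n) f x - f x) \<le> e"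
proof -
  have [measurable]: "f \<in> borel_measurable borel" using f by (simp add: locLp_def)
  have li: "locint f" using locLp_imp_locint[OF f] p by simp
  have pw: "ennreal (norm (convol (moll n) f x - f x) powr p)
      \<le> (\<integral>\<^sup>+y. ennreal (moll n y * norm (f (x - y) - f x) powr p) \<partial>lborel)" for x
  proof -
    have "integrable lborel (\<lambda>y. moll n (x - y) *\<^sub>R f y)"
      using convol_integrable[OF li moll_continuous moll_props(2)] .
    from lborel_integrable_reflect[OF this, of x]
    have i1: "integrable lborel (\<lambda>y. moll n y *\<^sub>R f (x - y))" by simp
    have i2: "integrable lborel (\<lambda>y. moll n y *\<^sub>R f x)"
      by (intro integrable_scaleR_left moll_props)
    have i3: "integrable lborel (\<lambda>y. moll n y *\<^sub>R (f (x - y) - f x))"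
      using Bochner_Integration.integrable_diff[OF i1 i2] by (simp add: scaleR_diff_right)
    have "convol (moll n) f x = (\<integral>y. moll n y *\<^sub>R f (x - y) \<partial>lborel)"
      by (rule convol_commute) auto
    moreover have "f x = (\<integral>y. moll n (y::'a) *\<^sub>R f x \<partial>lborel)"
      by (subst integral_scaleR_left[OF moll_props(3)]) (simp only: moll_props(4) scaleR_one)
    ultimately have "convol (moll n) f x - f x = (\<integral>y. moll n y *\<^sub>R f (x - y) \<partial>lborel) - (\<integral>y. moll n (y::'a) *\<^sub>R f x \<partial>lborel)"
      by simp
    also have "\<dots> = (\<integral>y. moll n y *\<^sub>R (f (x - y) - f x) \<partial>lborel)"
      using Bochner_Integration.integral_diff[OF i1 i2] by (simp add: scaleR_diff_right)
    finally have "norm (convol (moll n) f x - f x) \<le> (\<integral>y. norm (moll n y *\<^sub>R (f (x - y) - f x)) \<partial>lborel)"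
      by (metis integral_norm_bound)
    also have "\<dots> = (\<integral>y. moll n y * norm (f (x - y) - f x) \<partial>lborel)"
      by (simp add: moll_props(1))
    finally have "norm (convol (moll n) f x - f x) powr p \<le> (\<integral>y. moll n y * norm (f (x - y) - f x) \<partial>lborel) powr p"
      using p by (intro powr_mono2) auto
    then have "ennreal (norm (convol (moll n) f x - f x) powr p) \<le> ennreal ((\<integral>y. moll n y * norm (f (x - y) - f x) \<partial>lborel) powr p)"
      by (rule ennreal_leI)
    also have "\<dots> \<le> (\<integral>\<^sup>+y. ennreal (moll n y * norm (f (x - y) - f x) powr p) \<partial>lborel)"
      using integrable_norm[OF i3] by (intro powr_integral_le[OF p]) (auto simp: moll_props)
    finally show ?thesis .
  qed
  have [measurable]: "convol (moll n) f \<in> borel_measurable borel"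
    unfolding convol_def[abs_def] by measurable
  have "Lpow p (cball 0 R) (\<lambda>x. convol (moll n) f x - f x) \<le>
    (\<integral>\<^sup>+x. (\<integral>\<^sup>+y. ennreal (moll n y * norm (f (x - y) - f x) powr p) \<partial>lborel) * indicator (cball 0 R) x \<partial>lborel)"
    unfolding Lpow_def by (intro nn_integral_mono mult_right_mono pw) auto
  also have "\<dots> = (\<integral>\<^sup>+x. (\<integral>\<^sup>+y. ennreal (moll n y * norm (f (x - y) - f x) powr p) * indicator (cball 0 R) x \<partial>lborel) \<partial>lborel)"
    by (subst nn_integral_multc) auto
  also have "\<dots> = (\<integral>\<^sup>+y. (\<integral>\<^sup>+x. ennreal (moll n y * norm (f (x - y) - f x) powr p) * indicator (cball 0 R) x \<partial>lborel) \<partial>lborel)"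
    by (rule lborel_pair.Fubini') measurable
  also have "\<dots> = (\<integral>\<^sup>+y. ennreal (moll n y) * Lpow p (cball 0 R) (\<lambda>x. f (x - y) - f x) \<partial>lborel)"
    unfolding Lpow_def by (subst nn_integral_cmult[symmetric]) (auto simp: ennreal_mult moll_props mult.assoc)
  also have "\<dots> \<le> (\<integral>\<^sup>+y. ennreal (moll n y) * e \<partial>(lborel::'a measure))"
  proof (intro nn_integral_mono)
    fix y :: 'a
    show "ennreal (moll n y) * Lpow p (cball 0 R) (\<lambda>x. f (x - y) - f x) \<le> ennreal (moll n y) * e"
      by (cases "norm y \<le> inverse (real (Suc n))") (auto intro!: mult_left_mono e simp: moll_props(2))
  qed
  also have "\<dots> = (\<integral>\<^sup>+y. ennreal (moll n y) \<partial>(lborel::'a measure)) * e"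
    by (rule nn_integral_multc) auto
  also have "(\<integral>\<^sup>+y. ennreal (moll n y) \<partial>(lborel::'a measure)) = 1"
    using nn_integral_eq_integral[OF moll_props(3)] by (simp add: moll_props)
  finally show ?thesis by simp
qed

lemma convol_moll_tendsto:
  fixes f :: "'a::euclidean_space \<Rightarrow> 'b::euclidean_space"
  assumes f: "locLp p f" and p: "p > 1"
  shows "(\<lambda>n. Lpow p (cball 0 R) (\<lambda>x. convol (moll n) f x - f x)) \<longlonglongrightarrow> 0"
proof (rule order_tendstoI)
  fix e :: ennreal assume "e > 0"
  then obtain e' where e': "e' > 0" "e' < e" using dense by blast
  obtain d where d: "d > 0" "\<And>y. norm y \<le> d \<Longrightarrow> Lpow p (cball 0 R) (\<lambda>x. f (x - y) - f x) < e'"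
    using locLp_translate[OF f _ e'(1)] p by (metis less_trans zero_less_one)
  have "eventually (\<lambda>n. inverse (real (Suc n)) < d) sequentially"
    using LIMSEQ_inverse_real_of_nat d(1) order_tendstoD(2) by blast
  then show "\<forall>\<^sub>F n in sequentially. Lpow p (cball 0 R) (\<lambda>x. convol (moll n) f x - f x) < e"
  proof eventually_elim
    fix n assume n: "inverse (real (Suc n)) < d"
    have "Lpow p (cball 0 R) (\<lambda>x. f (x - y) - f x) \<le> e'" if "norm y \<le> inverse (real (Suc n))" for y
      using d(2)[of y] that n by (simp add: less_imp_le)
    then have "Lpow p (cball 0 R) (\<lambda>x. convol (moll n) f x - f x) \<le> e'"
      by (intro convol_moll_Lpow_le[OF f p])
    with e'(2) show "Lpow p (cball 0 R) (\<lambda>x. convol (moll n) f x - f x) < e" by simp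
  qed
qed simp

section \<open>The Caccioppoli inequality\<close>

text \<open>The set \<open>S\<close> restricts the conditions on F to the range of f: the powers and
  logarithms of 1 + \<theta> - t used later are regular on [0,1] but not on the whole line.\<close>

lemma C1_compose:
  assumes f: "C1 f G" "\<And>x. f x \<in> S"
    and F: "\<And>t. t \<in> S \<Longrightarrow> (F has_real_derivative F' t) (at t)" "continuous_on S F'"
  shows "C1 (\<lambda>x. F (f x)) (\<lambda>x. F' (f x) *\<^sub>R G x)"
  unfolding C1_def
proof (intro conjI allI)
  fix x
  show "((\<lambda>x. F (f x)) has_derivative (\<lambda>h. (F' (f x) *\<^sub>R G x) \<bullet> h)) (at x)"
    using has_derivative_compose[OF C1_D(1)[OF f(1)] F(1)[OF f(2), THEN has_field_derivative_imp_has_derivative]]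
    by simp
  show "continuous_on UNIV (\<lambda>x. F' (f x) *\<^sub>R G x)"
    using f(2) by (intro continuous_intros C1_D[OF f(1)] continuous_on_compose2[OF F(2) C1_D(3)[OF f(1)]]) auto
qed

lemma C1_mult:
  assumes f: "C1 f G" and h: "C1 h H"
  shows "C1 (\<lambda>x. f x * h x) (\<lambda>x. f x *\<^sub>R H x + h x *\<^sub>R G x)"
  unfolding C1_def
proof (intro conjI allI)
  fix x
  show "((\<lambda>x. f x * h x) has_derivative (\<lambda>v. (f x *\<^sub>R H x + h x *\<^sub>R G x) \<bullet> v)) (at x)"
    using has_derivative_mult[OF C1_D(1)[OF f, of x] C1_D(1)[OF h, of x]]
    by (simp add: inner_add_left algebra_simps)
  show "continuous_on UNIV (\<lambda>x. f x *\<^sub>R H x + h x *\<^sub>R G x)"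
    by (intro continuous_intros C1_D[OF f] C1_D[OF h])
qed

text \<open>Only t = 0 is critical: there the difference quotient is at most |h|^(q-1), which tends
  to 0 because q exceeds 1. This is the source of the exponents 2 and 1 + 1/p below.\<close>

lemma pos_part_powr_has_derivative:
  fixes q :: real
  assumes "q > 1"
  shows "((\<lambda>t. max 0 t powr q) has_real_derivative q * max 0 t powr (q - 1)) (at t)"
proof -
  consider "t > 0" | "t < 0" | "t = 0" by linarith
  then show ?thesis
  proof cases
    case 1
    have "((\<lambda>t. t powr q) has_real_derivative q * max 0 t powr (q - 1)) (at t)"
      using 1 has_real_derivative_powr[OF 1, of q] by (simp add: max_def)
    then show ?thesis
      by (rule has_field_derivative_transform_within_open[where S="{0<..}"])
         (use 1 in \<open>auto simp: max_def\<close>)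
  next
    case 2
    have "((\<lambda>t. 0) has_real_derivative q * max 0 t powr (q - 1)) (at t)"
      using 2 by (simp add: max_def)
    then show ?thesis
      by (rule has_field_derivative_transform_within_open[where S="{..<0}"])
         (use 2 in \<open>auto simp: max_def\<close>)
  next
    case 3
    have "((\<lambda>h. \<bar>h\<bar> powr (q - 1)) \<longlongrightarrow> 0) (at 0)"
      using assms by (intro tendsto_eq_intros tendsto_zero_powrI) (auto intro!: tendsto_rabs_zero)
    moreover have "norm (max 0 h powr q / h) \<le> \<bar>h\<bar> powr (q - 1)" for h :: real
    proof (cases "h > 0")
      case True
      then have "h powr q = h * h powr (q - 1)" by (simp add: powr_mult_base)
      then show ?thesis using True by (simp add: max_def)
    qed (simp add: max_def)
    ultimately have "((\<lambda>h. max 0 h powr q / h) \<longlongrightarrow> 0) (at 0)"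
      by (metis (mono_tags, lifting) Lim_null_comparison always_eventually)
    then show ?thesis
      using 3 by (simp add: DERIV_def)
  qed
qed

lemma pos_part_powr_continuous:
  fixes q :: real
  assumes "q > 0"
  shows "continuous_on S (\<lambda>t. max 0 t powr q)"
  using assms by (intro continuous_on_powr' continuous_intros) auto

lemma C1_powr:
  assumes f: "C1 f G" "\<And>x. f x \<ge> 0" and q: "q > 1"
  shows "C1 (\<lambda>x. f x powr q) (\<lambda>x. (q * f x powr (q - 1)) *\<^sub>R G x)"
proof -
  have "C1 (\<lambda>x. max 0 (f x) powr q) (\<lambda>x. (q * max 0 (f x) powr (q - 1)) *\<^sub>R G x)"
    by (rule C1_compose[OF f(1), of UNIV])
       (use q in \<open>auto intro!: pos_part_powr_has_derivative pos_part_powr_continuous continuous_intros\<close>)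
  then show ?thesis using f(2) by simp
qed

text \<open>Both forms of Young's inequality below come from asking which of the two factors dominates.\<close>

lemma young_absorb:
  fixes s t p :: real
  assumes "p > 1" "s \<ge> 0" "t \<ge> 0"
  shows "s powr (p - 1) * t \<le> s powr p / 4 + 4 powr p * t powr p"
proof (cases "t \<le> s / 4")
  case True
  have "s powr (p - 1) * t \<le> s powr (p - 1) * (s / 4)"
    using True by (intro mult_left_mono) auto
  also have "\<dots> = s powr p / 4"
    using assms powr_mult_base[of s "p - 1"] by (simp add: mult.commute)
  finally show ?thesis by (simp add: add_increasing2)
next
  case False
  have "s powr (p - 1) * t \<le> (4 * t) powr (p - 1) * (4 * t)"
    using False assms by (intro mult_mono powr_mono2) auto
  also have "\<dots> = 4 powr p * t powr p"
    using assms powr_mult_base[of "4 * t" "p - 1"] by (simp add: mult.commute powr_mult)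
  finally show ?thesis by (simp add: add_increasing)
qed

lemma young_weighted_absorb:
  fixes s t p F F' Q :: real
  assumes "p > 1" "s \<ge> 0" "t \<ge> 0" "F \<ge> 0" "F' \<ge> 0" "Q \<ge> 0" and FQ: "F powr p \<le> Q * F' powr (p - 1)"
  shows "p * F * s powr (p - 1) * t \<le> F' * s powr p / 4 + (4 powr p * p powr p) * (Q * t powr p)"
proof (cases "4 * (p * F * t) \<le> F' * s")
  case True
  have "p * F * s powr (p - 1) * t = s powr (p - 1) * (p * F * t)" by simp
  also have "\<dots> \<le> s powr (p - 1) * (F' * s / 4)"
    using True by (intro mult_left_mono) auto
  also have "\<dots> = F' * (s * s powr (p - 1)) / 4" by simp
  also have "\<dots> = F' * s powr p / 4"
    using assms powr_mult_base[of s "p - 1"] by simp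
  finally show ?thesis using assms by (simp add: add_increasing2)
next
  case False
  then have pos: "F > 0" "t > 0" using assms by (auto simp: less_le)
  \<comment> \<open>The hypothesis relating F, Q and F' is stated without a quotient, so F' may
    vanish; it then forces F = 0, which the present case excludes.\<close>
  have F': "F' > 0"
  proof (rule ccontr)
    assume "\<not> F' > 0"
    then have "F powr p \<le> 0" using FQ assms by simp
    then show False using pos by simp
  qed
  have "s \<le> 4 * p * F * t / F'" using False F' by (simp add: field_simps)
  then have s_le: "s powr (p - 1) \<le> (4 * p * F * t / F') powr (p - 1)"
    using assms by (intro powr_mono2) auto
  have "p * F * t \<ge> 0" using assms by simp
  then have "p * F * t \<le> 4 * (p * F * t)" "4 * (p * F * t) \<ge> 0" by linarith+
  then have "(p * F * t) * s powr (p - 1) \<le> (4 * (p * F * t)) * (4 * p * F * t / F') powr (p - 1)"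
    by (rule mult_mono[OF _ s_le]) simp
  then have "p * F * s powr (p - 1) * t \<le> (4 * p * F * t) * (4 * p * F * t / F') powr (p - 1)"
    by (simp add: mult_ac)
  also have "\<dots> = (4 * p * F * t) * (4 * p * F * t) powr (p - 1) / F' powr (p - 1)"
    using F' pos assms by (simp add: powr_divide)
  also have "(4 * p * F * t) * (4 * p * F * t) powr (p - 1) = (4 * p * F * t) powr p"
    using pos assms by (subst powr_mult_base) auto
  also have "\<dots> = 4 powr p * p powr p * (F powr p * t powr p)"
    by (simp add: powr_mult mult.assoc)
  also have "\<dots> / F' powr (p - 1) = 4 powr p * p powr p * (F powr p / F' powr (p - 1) * t powr p)"
    by simp
  also have "\<dots> \<le> 4 powr p * p powr p * (Q * t powr p)"
  proof -
    have "F powr p / F' powr (p - 1) \<le> Q" using FQ F' by (simp add: divide_le_eq)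
    then show ?thesis by (intro mult_left_mono mult_right_mono) auto
  qed
  finally show ?thesis using assms by (simp add: add_increasing)
qed

lemma compose_bounded:
  fixes F :: "real \<Rightarrow> real"
  assumes "continuous_on {0..1} F"
  obtains B where "B > 0" "\<And>t. t \<in> {0..1} \<Longrightarrow> \<bar>F t\<bar> \<le> B"
proof -
  have "bounded (F ` {0..1})"
    using assms by (intro compact_imp_bounded compact_continuous_image) auto
  then show ?thesis using that unfolding bounded_pos by auto
qed

lemma locLp_powr_locint:
  assumes "locLp p f"
  shows "locint (\<lambda>x. norm (f x) powr p)"
proof -
  have [measurable]: "f \<in> borel_measurable borel" using assms by (simp add: locLp_def)
  have "integrable lborel (\<lambda>x. indicator (cball 0 R) x *\<^sub>R (norm (f x) powr p))" for R
  proof (rule integrableI_bounded)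
    have "(\<integral>\<^sup>+ x. ennreal (norm (indicator (cball 0 R) x *\<^sub>R (norm (f x) powr p))) \<partial>lborel) = Lpow p (cball 0 R) f"
      unfolding Lpow_def by (intro nn_integral_cong) (auto simp: indicator_def)
    then show "(\<integral>\<^sup>+ x. ennreal (norm (indicator (cball 0 R) x *\<^sub>R (norm (f x) powr p))) \<partial>lborel) < \<infinity>"
      using assms by (simp add: locLp_def)
  qed auto
  then show ?thesis by (auto simp: locint_def set_integrable_def)
qed

lemma locLp_continuous:
  assumes "continuous_on UNIV f" "p > 0"
  shows "locLp p f"
proof -
  have f: "f \<in> borel_measurable borel" using assms(1) by (rule borel_measurable_continuous_onI)
  have "locint (\<lambda>x. norm (f x) powr p)"
    using assms by (intro locint_continuous continuous_on_powr' continuous_intros) auto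
  then have i: "integrable lborel (\<lambda>x. indicator (cball 0 R) x *\<^sub>R (norm (f x) powr p))" for R
    by (simp add: locint_def set_integrable_def)
  have "Lpow p (cball 0 R) f < \<infinity>" for R
  proof -
    have "Lpow p (cball 0 R) f = (\<integral>\<^sup>+ x. ennreal (norm (indicator (cball 0 R) x *\<^sub>R (norm (f x) powr p))) \<partial>lborel)"
      unfolding Lpow_def by (intro nn_integral_cong) (auto simp: indicator_def)
    also have "\<dots> < \<infinity>" using i[of R] unfolding integrable_iff_bounded by simp
    finally show ?thesis .
  qed
  then show ?thesis using f by (simp add: locLp_def)
qed

lemma locLp_diff:
  assumes f: "locLp p f" and g: "locLp p g" and p: "p \<ge> 0"
  shows "locLp p (\<lambda>x. f x - g x)"
proof -
  have [measurable]: "f \<in> borel_measurable borel" "g \<in> borel_measurable borel" using f g by (auto simp: locLp_def)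
  have "Lpow p (cball 0 R) (\<lambda>x. f x - g x) < \<infinity>" for R
  proof -
    have "Lpow p (cball 0 R) (\<lambda>x. f x + - g x) \<le> ennreal (2 powr p) * (Lpow p (cball 0 R) f + Lpow p (cball 0 R) (\<lambda>x. - g x))"
      using p by (intro Lpow_add_le) auto
    also have "Lpow p (cball 0 R) (\<lambda>x. - g x) = Lpow p (cball 0 R) g" by (simp add: Lpow_def)
    also have "ennreal (2 powr p) * (Lpow p (cball 0 R) f + Lpow p (cball 0 R) g) < \<infinity>"
      using f g by (auto simp: locLp_def ennreal_mult_less_top)
    finally show ?thesis by simp
  qed
  then show ?thesis by (auto simp: locLp_def)
qed

text \<open>The flux has length |g|^(p-1), and this is at most 1 + |g|^p.\<close>

lemma locint_flux:
  assumes g: "locLp p g" and p: "p > 1"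
  shows "locint (\<lambda>x. norm (g x) powr (p - 2) *\<^sub>R g x)"
proof -
  have [measurable]: "g \<in> borel_measurable borel" using g by (auto simp: locLp_def)
  have "integrable lborel (\<lambda>x. indicator (cball 0 R) x *\<^sub>R (norm (g x) powr (p - 2) *\<^sub>R g x))" for R
  proof (rule Bochner_Integration.integrable_bound)
    show "integrable lborel (\<lambda>x. indicator (cball 0 R) x *\<^sub>R (1::real) + indicator (cball 0 R) x *\<^sub>R (norm (g x) powr p))"
      using locLp_powr_locint[OF g] locint_continuous[of "\<lambda>_. 1::real"]
      unfolding locint_def set_integrable_def
      by (intro Bochner_Integration.integrable_add) auto
    have "norm (g x) powr (p - 2) * norm (g x) \<le> 1 + norm (g x) powr p" for x
    proof -
      have "norm (g x) powr (p - 2) * norm (g x) = norm (g x) powr (p - 1)"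
        using powr_mult_base[of "norm (g x)" "p - 2"] by (simp add: mult.commute)
      also have "\<dots> \<le> 1 + norm (g x) powr p"
      proof (cases "norm (g x) \<le> 1")
        case True
        then show ?thesis using p powr_le1[of "p - 1" "norm (g x)"] by (simp add: add_increasing2)
      next
        case False
        then show ?thesis by (intro add_increasing powr_mono) auto
      qed
      finally show ?thesis .
    qed
    then show "AE x in lborel. norm (indicator (cball 0 R) x *\<^sub>R (norm (g x) powr (p - 2) *\<^sub>R g x))
      \<le> norm (indicator (cball 0 R) x *\<^sub>R 1 + indicator (cball 0 R) x *\<^sub>R (norm (g x) powr p))"
      by (auto simp: indicator_def)
  qed auto
  then show ?thesis by (auto simp: locint_def set_integrable_def)
qed

text \<open>The weak gradient enters only through the last assumption, which gives \<open>C\<^sup>1\<close>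
  approximations of the solution together with their gradients.\<close>

locale p_solution =
  fixes p :: real and u :: "'a::euclidean_space \<Rightarrow> real" and g :: "'a \<Rightarrow> 'a"
  assumes p: "p > 1"
    and u_meas [measurable]: "u \<in> borel_measurable borel"
    and u01: "\<And>x. u x \<in> {0..1}"
    and g: "locLp p g"
    and weak_eq: "\<And>\<phi> G R. C1 \<phi> G \<Longrightarrow> (\<And>x. R < norm x \<Longrightarrow> \<phi> x = 0) \<Longrightarrow>
        (\<integral>x. (norm (g x) powr (p - 2) *\<^sub>R g x) \<bullet> G x \<partial>lborel) = 0"
    and approx: "\<And>R. \<exists>U V. (\<forall>n. C1 (U n) (V n)) \<and> (\<forall>n x. U n x \<in> {0..1}) \<and>
        (AE x in lborel. x \<in> cball 0 R \<longrightarrow> (\<lambda>n. U n x) \<longlonglongrightarrow> u x) \<and>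
        (\<lambda>n. Lpow p (cball 0 R) (\<lambda>x. V n x - g x)) \<longlonglongrightarrow> 0"
begin

lemma g_meas [measurable]: "g \<in> borel_measurable borel"
  using g by (simp add: locLp_def)

lemma compose_measurable:
  fixes F :: "real \<Rightarrow> real"
  assumes "continuous_on {0..1} F"
  shows "(\<lambda>x. F (u x)) \<in> borel_measurable borel"
proof -
  have "(\<lambda>t. indicator {0..1} t *\<^sub>R F t) \<in> borel_measurable borel"
    using assms by (intro borel_measurable_continuous_on_indicator) auto
  from measurable_compose[OF u_meas this]
  have "(\<lambda>x. indicator {0..1} (u x) *\<^sub>R F (u x)) \<in> borel_measurable borel" .
  moreover have "indicator {0..1} (u x) *\<^sub>R F (u x) = F (u x)" for x
    using u01[of x] by (auto simp: indicator_def)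
  ultimately show ?thesis by (simp only:)
qed

text \<open>The test function is \<open>F (U x) * \<eta> x powr p\<close>. Its gradient contains V,
  not g; writing V = g + (V - g), the flux paired with g gives the energy, and the rest is an error
  that vanishes in the limit. The condition on \<open>Q\<close> is exactly what lets Young's
  inequality absorb the term with the gradient of the cutoff.\<close>

lemma caccioppoli_step:
  assumes U: "C1 U V" "\<And>x. U x \<in> {0..1}"
    and F: "\<And>t. t \<in> {0..1} \<Longrightarrow> (F has_real_derivative F' t) (at t)" "continuous_on {0..1} F'"
      "\<And>t. t \<in> {0..1} \<Longrightarrow> F t \<ge> 0" "\<And>t. t \<in> {0..1} \<Longrightarrow> F' t \<ge> 0"
    and Q: "continuous_on {0..1} Q" "\<And>t. t \<in> {0..1} \<Longrightarrow> Q t \<ge> 0"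
      "\<And>t. t \<in> {0..1} \<Longrightarrow> F t powr p \<le> Q t * F' t powr (p - 1)"
    and \<eta>: "C1 \<eta> G" "\<And>x. \<eta> x \<ge> 0" "\<And>x. R < norm x \<Longrightarrow> \<eta> x = 0"
  shows "(\<integral>\<^sup>+x. ennreal (F' (U x) * \<eta> x powr p * norm (g x) powr p) \<partial>lborel) \<le>
     ennreal (2 * (4 powr p * p powr p)) * (\<integral>\<^sup>+x. ennreal (Q (U x) * norm (G x) powr p) \<partial>lborel) +
     ennreal (2 * 4 powr p) * (\<integral>\<^sup>+x. ennreal (F' (U x) * \<eta> x powr p * norm (V x - g x) powr p) \<partial>lborel)"
proof -
  define C where "C = 4 powr p * p powr p"
  have C: "C \<ge> 0" by (simp add: C_def)
  have G0: "\<And>x. R < norm x \<Longrightarrow> G x = 0"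
    using C1_gradient_eq_0[OF \<eta>(1)] \<eta>(3) by blast
  have cU: "continuous_on UNIV U" using C1_D(3)[OF U(1)] .
  have cFU: "continuous_on UNIV (\<lambda>x. F' (U x))"
    using U(2) by (intro continuous_on_compose2[OF F(2) cU]) auto
  have cQU: "continuous_on UNIV (\<lambda>x. Q (U x))"
    using U(2) by (intro continuous_on_compose2[OF Q(1) cU]) auto
  have c\<eta>: "continuous_on UNIV (\<lambda>x. \<eta> x powr p)"
    using \<eta>(2) p by (intro continuous_on_powr' C1_D(3)[OF \<eta>(1)] continuous_intros) auto
  let ?k = "\<lambda>x. F' (U x) * \<eta> x powr p"
  have ck: "continuous_on UNIV ?k" by (intro continuous_intros cFU c\<eta>)
  have k0: "\<And>x. R < norm x \<Longrightarrow> ?k x = 0" using \<eta>(3) by simp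
  obtain B where B: "\<And>x. norm (?k x) \<le> B" using compact_support_bounded[OF ck k0] by blast
  let ?z = "\<lambda>x. Q (U x) * norm (G x) powr p"
  have cz: "continuous_on UNIV ?z"
    using p by (intro continuous_intros cQU continuous_on_powr' C1_D(2)[OF \<eta>(1)]) auto
  have z0: "\<And>x. R < norm x \<Longrightarrow> ?z x = 0" using G0 p by simp
  obtain B' where B': "\<And>x. norm (?z x) \<le> B'" using compact_support_bounded[OF cz z0] by blast
  have [measurable]: "?k \<in> borel_measurable borel" "?z \<in> borel_measurable borel"
    "V \<in> borel_measurable borel" "G \<in> borel_measurable borel"
    using ck cz C1_D(2)[OF U(1)] C1_D(2)[OF \<eta>(1)] by (auto intro: borel_measurable_continuous_onI)
  let ?X = "\<lambda>x. ?k x * norm (g x) powr p"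
  let ?W = "\<lambda>x. ?k x * norm (V x - g x) powr p"
  have iX: "integrable lborel ?X"
    using locint_mult_integrable[OF locLp_powr_locint[OF g], of ?k B R] B k0 by auto
  have Vg: "locLp p (\<lambda>x. V x - g x)"
    using p by (intro locLp_diff locLp_continuous C1_D(2)[OF U(1)] g) auto
  have iW: "integrable lborel ?W"
    using locint_mult_integrable[OF locLp_powr_locint[OF Vg], of ?k B R] B k0 by auto
  have iZ: "integrable lborel ?z"
    using locint_mult_integrable[OF locint_continuous[of "\<lambda>_. 1::real"], of ?z B' R] B' z0 by auto
  let ?A = "\<lambda>x. norm (g x) powr (p - 2) *\<^sub>R g x"
  let ?\<phi> = "\<lambda>x. F (U x) * \<eta> x powr p"
  let ?D = "\<lambda>x. F (U x) *\<^sub>R ((p * \<eta> x powr (p - 1)) *\<^sub>R G x) + \<eta> x powr p *\<^sub>R (F' (U x) *\<^sub>R V x)"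
  have \<phi>: "C1 ?\<phi> ?D"
    by (rule C1_mult[OF C1_compose[OF U F(1,2)] C1_powr[OF \<eta>(1,2) p]])
  have \<phi>0: "\<And>x. R < norm x \<Longrightarrow> ?\<phi> x = 0" using \<eta>(3) by simp
  have eq0: "(\<integral>x. ?A x \<bullet> ?D x \<partial>lborel) = 0"
    by (rule weak_eq[OF \<phi> \<phi>0])
  have D0: "\<And>x. R < norm x \<Longrightarrow> ?D x = 0"
    by (rule C1_gradient_eq_0[OF \<phi> \<phi>0])
  obtain B'' where B'': "\<And>x. norm (?D x) \<le> B''"
    using compact_support_bounded[OF C1_D(2)[OF \<phi>] D0] by blast
  have iD: "integrable lborel (\<lambda>x. ?A x \<bullet> ?D x)"
    by (rule locint_inner_integrable[OF locint_flux[OF g p] C1_measurable(2)[OF \<phi>] B'' D0])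
  \<comment> \<open>The cutoff term and the approximation error each use up a quarter of the energy,
    so half of it remains; hence the factors 2 in the conclusion.\<close>
  have pw: "?X x / 2 \<le> ?A x \<bullet> ?D x + C * ?z x + 4 powr p * ?W x" for x
  proof -
    have nA: "norm (?A x) = norm (g x) powr (p - 1)"
      using powr_mult_base[of "norm (g x)" "p - 2"] by (simp add: mult.commute)
    have Ag: "?A x \<bullet> g x = norm (g x) powr p"
    proof -
      have "?A x \<bullet> g x = norm (g x) * (norm (g x) * norm (g x) powr (p - 2))"
        by (simp add: power2_norm_eq_inner[symmetric] power2_eq_square)
      also have "\<dots> = norm (g x) powr p" by (simp add: powr_mult_base)
      finally show ?thesis .
    qed
    have split: "?A x \<bullet> ?D x = F (U x) * p * \<eta> x powr (p - 1) * (?A x \<bullet> G x) + ?X x + ?k x * (?A x \<bullet> (V x - g x))"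
      unfolding Ag[symmetric] by (simp add: inner_add_right inner_diff_right algebra_simps)
    have F0: "F (U x) \<ge> 0" "F' (U x) \<ge> 0" "Q (U x) \<ge> 0" using U(2) F Q by auto
    have "- (?A x \<bullet> G x) \<le> norm (g x) powr (p - 1) * norm (G x)"
      using Cauchy_Schwarz_ineq2[of "?A x" "G x"] unfolding nA by linarith
    then have "F (U x) * p * \<eta> x powr (p - 1) * - (?A x \<bullet> G x)
        \<le> F (U x) * p * \<eta> x powr (p - 1) * (norm (g x) powr (p - 1) * norm (G x))"
      using F0 p by (intro mult_left_mono) auto
    also have "\<dots> = p * F (U x) * (\<eta> x * norm (g x)) powr (p - 1) * norm (G x)"
      by (simp add: powr_mult)
    also have "\<dots> \<le> F' (U x) * (\<eta> x * norm (g x)) powr p / 4 + C * (Q (U x) * norm (G x) powr p)"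
      unfolding C_def using F0 p \<eta>(2)[of x] Q(3)[OF U(2)] by (intro young_weighted_absorb) auto
    also have "\<dots> = ?X x / 4 + C * ?z x"
      by (simp add: powr_mult)
    finally have 1: "F (U x) * p * \<eta> x powr (p - 1) * - (?A x \<bullet> G x) \<le> ?X x / 4 + C * ?z x" .
    have "- (?A x \<bullet> (V x - g x)) \<le> norm (g x) powr (p - 1) * norm (V x - g x)"
      using Cauchy_Schwarz_ineq2[of "?A x" "V x - g x"] unfolding nA by linarith
    also have "\<dots> \<le> norm (g x) powr p / 4 + 4 powr p * norm (V x - g x) powr p"
      using p by (intro young_absorb) auto
    finally have "?k x * - (?A x \<bullet> (V x - g x)) \<le> ?k x * (norm (g x) powr p / 4 + 4 powr p * norm (V x - g x) powr p)"
      using F0 by (intro mult_left_mono) auto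
    then have 2: "?k x * - (?A x \<bullet> (V x - g x)) \<le> ?X x / 4 + 4 powr p * ?W x"
      by (simp add: algebra_simps)
    show ?thesis unfolding split using 1 2 by simp
  qed
  have "(\<integral>x. ?X x / 2 \<partial>lborel) \<le> (\<integral>x. ?A x \<bullet> ?D x + C * ?z x + 4 powr p * ?W x \<partial>lborel)"
    by (rule integral_mono[OF _ _ pw])
      (intro integrable_divide integrable_mult_right Bochner_Integration.integrable_add iX iD iZ iW)+
  also have "\<dots> = C * (\<integral>x. ?z x \<partial>lborel) + 4 powr p * (\<integral>x. ?W x \<partial>lborel)"
    using iD iZ iW eq0 by (simp add: Bochner_Integration.integral_add integrable_mult_right)
  finally have *: "(\<integral>x. ?X x \<partial>lborel) \<le> 2 * C * (\<integral>x. ?z x \<partial>lborel) + 2 * 4 powr p * (\<integral>x. ?W x \<partial>lborel)"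
    using iX by (simp add: algebra_simps)
  have n: "?X x \<ge> 0" "?z x \<ge> 0" "?W x \<ge> 0" for x
    using U(2)[of x] F(4) Q(2) by auto
  have In: "(\<integral>x. ?z x \<partial>lborel) \<ge> 0" "(\<integral>x. ?W x \<partial>lborel) \<ge> 0"
    using n by (auto intro!: integral_nonneg_AE)
  have "(\<integral>\<^sup>+x. ennreal (?X x) \<partial>lborel) = ennreal (\<integral>x. ?X x \<partial>lborel)"
    using n iX by (intro nn_integral_eq_integral) auto
  also have "\<dots> \<le> ennreal (2 * C * (\<integral>x. ?z x \<partial>lborel) + 2 * 4 powr p * (\<integral>x. ?W x \<partial>lborel))"
    using * by (rule ennreal_leI)
  also have "\<dots> = ennreal (2 * C) * ennreal (\<integral>x. ?z x \<partial>lborel) + ennreal (2 * 4 powr p) * ennreal (\<integral>x. ?W x \<partial>lborel)"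
    using In C by (subst ennreal_plus) (auto simp: ennreal_mult)
  also have "ennreal (\<integral>x. ?z x \<partial>lborel) = (\<integral>\<^sup>+x. ennreal (?z x) \<partial>lborel)"
    using n iZ by (intro nn_integral_eq_integral[symmetric]) auto
  also have "ennreal (\<integral>x. ?W x \<partial>lborel) = (\<integral>\<^sup>+x. ennreal (?W x) \<partial>lborel)"
    using n iW by (intro nn_integral_eq_integral[symmetric]) auto
  finally show ?thesis by (simp add: C_def)
qed

text \<open>The limit of \<open>caccioppoli_step\<close>. The energy passes by Fatou's lemma, the
  term with \<open>Q\<close> by dominated convergence, as \<open>Q\<close> and \<open>G\<close> are
  bounded and \<open>G\<close> vanishes outside a ball; the error is at most a constant times the
  p-th power distance of \<open>V n\<close> and \<open>g\<close> on that ball.\<close>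

lemma caccioppoli:
  assumes F: "\<And>t. t \<in> {0..1} \<Longrightarrow> (F has_real_derivative F' t) (at t)" "continuous_on {0..1} F'"
      "\<And>t. t \<in> {0..1} \<Longrightarrow> F t \<ge> 0" "\<And>t. t \<in> {0..1} \<Longrightarrow> F' t \<ge> 0"
    and Q: "continuous_on {0..1} Q" "\<And>t. t \<in> {0..1} \<Longrightarrow> Q t \<ge> 0"
      "\<And>t. t \<in> {0..1} \<Longrightarrow> F t powr p \<le> Q t * F' t powr (p - 1)"
    and \<eta>: "C1 \<eta> G" "\<And>x. \<eta> x \<ge> 0" "\<And>x. R < norm x \<Longrightarrow> \<eta> x = 0"
  shows "(\<integral>\<^sup>+x. ennreal (F' (u x) * \<eta> x powr p * norm (g x) powr p) \<partial>lborel) \<le>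
     ennreal (2 * (4 powr p * p powr p)) * (\<integral>\<^sup>+x. ennreal (Q (u x) * norm (G x) powr p) \<partial>lborel)"
proof -
  let ?x = "\<lambda>t x. F' t * \<eta> x powr p * norm (g x) powr p"
  let ?z = "\<lambda>t x. Q t * norm (G x) powr p"
  let ?L = "\<lambda>V. Lpow p (cball 0 R) (\<lambda>x. V x - g x)"
  define C where "C = 2 * (4 powr p * p powr p)"
  obtain U V where U: "\<And>n. C1 (U n) (V n)" "\<And>n x. U n x \<in> {0..1}"
    "AE x in lborel. x \<in> cball 0 R \<longrightarrow> (\<lambda>n. U n x) \<longlonglongrightarrow> u x"
    "(\<lambda>n. ?L (V n)) \<longlonglongrightarrow> 0"
    using approx[of R] by blast
  have G0: "\<And>x. R < norm x \<Longrightarrow> G x = 0"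
    using C1_gradient_eq_0[OF \<eta>(1)] \<eta>(3) by blast
  obtain M where M: "M > 0" "\<And>x. norm (\<eta> x) \<le> M" using compact_support_bounded[OF C1_D(3)[OF \<eta>(1)] \<eta>(3)] by blast
  obtain N where N: "N > 0" "\<And>x. norm (G x) \<le> N" using compact_support_bounded[OF C1_D(2)[OF \<eta>(1)] G0] by blast
  obtain BF where BF: "BF > 0" "\<And>t. t \<in> {0..1} \<Longrightarrow> \<bar>F' t\<bar> \<le> BF" using compose_bounded[OF F(2)] by blast
  obtain BQ where BQ: "BQ > 0" "\<And>t. t \<in> {0..1} \<Longrightarrow> \<bar>Q t\<bar> \<le> BQ" using compose_bounded[OF Q(1)] by blast
  have [measurable]: "(\<lambda>x. F' (U n x)) \<in> borel_measurable borel" for n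
    using U(2) by (intro borel_measurable_continuous_onI continuous_on_compose2[OF F(2) C1_D(3)[OF U(1)]]) auto
  have [measurable]: "(\<lambda>x. Q (U n x)) \<in> borel_measurable borel" for n
    using U(2) by (intro borel_measurable_continuous_onI continuous_on_compose2[OF Q(1) C1_D(3)[OF U(1)]]) auto
  note [measurable] = compose_measurable[OF F(2)] compose_measurable[OF Q(1)] C1_measurable[OF U(1)] C1_measurable[OF \<eta>(1)]
  let ?X = "\<lambda>n. \<integral>\<^sup>+x. ennreal (?x (U n x) x) \<partial>lborel"
  let ?Z = "\<lambda>n. \<integral>\<^sup>+x. ennreal (?z (U n x) x) \<partial>lborel"
  let ?W = "\<lambda>n. \<integral>\<^sup>+x. ennreal (F' (U n x) * \<eta> x powr p * norm (V n x - g x) powr p) \<partial>lborel"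
  have step: "?X n \<le> ennreal C * ?Z n + ennreal (2 * 4 powr p) * ?W n" for n
    unfolding C_def by (rule caccioppoli_step[OF U(1,2) F Q \<eta>])
  have W: "?W n \<le> ennreal (BF * M powr p) * ?L (V n)" for n
    unfolding Lpow_def
  proof (subst nn_integral_cmult[symmetric], measurable, intro nn_integral_mono)
    fix x
    show "ennreal (F' (U n x) * \<eta> x powr p * norm (V n x - g x) powr p)
      \<le> ennreal (BF * M powr p) * (ennreal (norm (V n x - g x) powr p) * indicator (cball 0 R) x)"
    proof (cases "norm x \<le> R")
      case True
      have "F' (U n x) * \<eta> x powr p \<le> BF * M powr p"
        using BF(2)[OF U(2)[of n x]] M(2)[of x] \<eta>(2)[of x] p BF(1) by (intro mult_mono powr_mono2) auto
      then have "F' (U n x) * \<eta> x powr p * norm (V n x - g x) powr p \<le> BF * M powr p * norm (V n x - g x) powr p"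
        by (rule mult_right_mono) auto
      then show ?thesis using True BF(1) by (simp add: ennreal_mult[symmetric] ennreal_leI)
    qed (use \<eta>(3) in auto)
  qed
  have W0: "?W \<longlonglongrightarrow> 0"
  proof (rule tendsto_sandwich[OF _ _ tendsto_const])
    have "(\<lambda>n. ennreal (BF * M powr p) * ?L (V n)) \<longlonglongrightarrow> ennreal (BF * M powr p) * 0"
      by (intro ennreal_tendsto_cmult U(4)) auto
    then show "(\<lambda>n. ennreal (BF * M powr p) * ?L (V n)) \<longlonglongrightarrow> 0" by simp
  qed (use W in auto)
  have conv: "AE x in lborel. (\<lambda>n. ?x (U n x) x) \<longlonglongrightarrow> ?x (u x) x
      \<and> (\<lambda>n. ?z (U n x) x) \<longlonglongrightarrow> ?z (u x) x"
    using U(3)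
  proof eventually_elim
    fix x assume lim: "x \<in> cball 0 R \<longrightarrow> (\<lambda>n. U n x) \<longlonglongrightarrow> u x"
    show "(\<lambda>n. ?x (U n x) x) \<longlonglongrightarrow> ?x (u x) x
      \<and> (\<lambda>n. ?z (U n x) x) \<longlonglongrightarrow> ?z (u x) x"
    proof (cases "norm x \<le> R")
      case True
      with lim have l: "(\<lambda>n. U n x) \<longlonglongrightarrow> u x" by simp
      have "(\<lambda>n. F' (U n x)) \<longlonglongrightarrow> F' (u x)" "(\<lambda>n. Q (U n x)) \<longlonglongrightarrow> Q (u x)"
        using continuous_on_tendsto_compose[OF F(2) l] continuous_on_tendsto_compose[OF Q(1) l] u01 U(2) by auto
      then show ?thesis by (intro conjI tendsto_intros)
    next
      case False
      then show ?thesis using \<eta>(3)[of x] G0[of x] by simp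
    qed
  qed
  have Z: "?Z \<longlonglongrightarrow> (\<integral>\<^sup>+x. ennreal (?z (u x) x) \<partial>lborel)"
  proof (rule nn_integral_dominated_convergence[where w="\<lambda>x. ennreal (BQ * N powr p) * indicator (cball 0 R) x"])
    show "(\<integral>\<^sup>+(x::'a). ennreal (BQ * N powr p) * indicator (cball 0 R) x \<partial>lborel) < \<infinity>"
      by (simp add: nn_integral_cmult ennreal_mult_less_top emeasure_cball_finite)
    show "AE x in lborel. (\<lambda>n. ennreal (?z (U n x) x)) \<longlonglongrightarrow> ennreal (?z (u x) x)"
      using conv by eventually_elim (auto intro: tendsto_ennrealI)
    have "ennreal (?z (U n x) x) \<le> ennreal (BQ * N powr p) * indicator (cball 0 R) x" for n x
    proof (cases "norm x \<le> R")
      case True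
      have "?z (U n x) x \<le> BQ * N powr p"
        using BQ(2)[OF U(2)[of n x]] N(2)[of x] p BQ(1) by (intro mult_mono powr_mono2) auto
      then show ?thesis using True by (simp add: ennreal_leI)
    next
      case False
      then show ?thesis using G0[of x] p by simp
    qed
    then show "AE x in lborel. ennreal (?z (U n x) x) \<le> ennreal (BQ * N powr p) * indicator (cball 0 R) x" for n
      by simp
  qed measurable
  have "(\<lambda>n. ennreal C * ?Z n + ennreal (2 * 4 powr p) * ?W n) \<longlonglongrightarrow>
      ennreal C * (\<integral>\<^sup>+x. ennreal (?z (u x) x) \<partial>lborel) + ennreal (2 * 4 powr p) * 0"
    by (intro tendsto_add ennreal_tendsto_cmult Z W0) auto
  then have lim: "liminf (\<lambda>n. ennreal C * ?Z n + ennreal (2 * 4 powr p) * ?W n) =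
      ennreal C * (\<integral>\<^sup>+x. ennreal (?z (u x) x) \<partial>lborel)"
    by (simp add: lim_imp_Liminf)
  have "(\<integral>\<^sup>+x. ennreal (?x (u x) x) \<partial>lborel) =
     (\<integral>\<^sup>+x. liminf (\<lambda>n. ennreal (?x (U n x) x)) \<partial>lborel)"
  proof (rule nn_integral_cong_AE)
    show "AE x in lborel. ennreal (?x (u x) x) =
       liminf (\<lambda>n. ennreal (?x (U n x) x))"
      using conv by eventually_elim (auto intro!: lim_imp_Liminf[symmetric] tendsto_ennrealI)
  qed
  also have "\<dots> \<le> liminf ?X"
    by (rule nn_integral_liminf) measurable
  also have "\<dots> \<le> liminf (\<lambda>n. ennreal C * ?Z n + ennreal (2 * 4 powr p) * ?W n)"
    by (rule Liminf_mono) (use step in auto)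
  finally show ?thesis
    unfolding lim unfolding C_def .
qed

end

section \<open>Translation estimates\<close>

text \<open>The fundamental theorem of calculus on the segment from x to x + h, followed by Jensen's
  inequality for the uniform density on [0,1].\<close>

lemma line_difference_powr_le:
  fixes f :: "'a::euclidean_space \<Rightarrow> real"
  assumes f: "C1 f G" and p: "p > 1"
  shows "ennreal (\<bar>f (x + h) - f x\<bar> powr p) \<le>
    (\<integral>\<^sup>+t. ennreal (indicator {0..1} t * (norm (G (x + t *\<^sub>R h)) * norm h) powr p) \<partial>lborel)"
proof -
  let ?w = "\<lambda>t::real. indicator {0..1} t :: real"
  let ?k = "\<lambda>t. norm (G (x + t *\<^sub>R h)) * norm h"
  have cG: "continuous_on UNIV (\<lambda>t::real. G (x + t *\<^sub>R h))"
    by (intro continuous_on_compose2[OF C1_D(2)[OF f]] continuous_intros) auto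
  have hb: "has_bochner_integral lborel (\<lambda>t. indicator {0..1} t *\<^sub>R (G (x + t *\<^sub>R h) \<bullet> h)) (f (x + 1 *\<^sub>R h) - f (x + 0 *\<^sub>R h))"
  proof (rule has_bochner_integral_FTC_Icc)
    fix t :: real
    have "((\<lambda>t. x + t *\<^sub>R h) has_derivative (\<lambda>s. s *\<^sub>R h)) (at t)"
      by (auto intro!: derivative_eq_intros)
    from has_derivative_compose[OF this C1_D(1)[OF f]]
    show "((\<lambda>t. f (x + t *\<^sub>R h)) has_vector_derivative G (x + t *\<^sub>R h) \<bullet> h) (at t within {0..1})"
      unfolding has_vector_derivative_def by (auto intro: has_derivative_at_withinI)
  next
    show "continuous_on {0..1} (\<lambda>t. G (x + t *\<^sub>R h) \<bullet> h)"
      by (intro continuous_intros continuous_on_subset[OF cG]) auto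
  qed auto
  have i: "integrable lborel (\<lambda>t. ?w t * ?k t)"
  proof -
    have "set_integrable lborel {0..1} ?k"
      unfolding set_integrable_def
      by (intro borel_integrable_compact continuous_intros continuous_on_subset[OF cG]) auto
    then show ?thesis by (simp add: set_integrable_def)
  qed
  have "\<bar>f (x + h) - f x\<bar> = norm (\<integral>t. indicator {0..1} t *\<^sub>R (G (x + t *\<^sub>R h) \<bullet> h) \<partial>lborel)"
    using has_bochner_integral_integral_eq[OF hb] by simp
  also have "\<dots> \<le> (\<integral>t. ?w t * ?k t \<partial>lborel)"
  proof (rule Bochner_Integration.integral_norm_bound_integral[OF _ i])
    show "integrable lborel (\<lambda>t. indicator {0..1} t *\<^sub>R (G (x + t *\<^sub>R h) \<bullet> h))"
      using hb by (rule integrable.intros)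
    show "norm (indicator {0..1} t *\<^sub>R (G (x + t *\<^sub>R h) \<bullet> h)) \<le> ?w t * ?k t" for t
      using Cauchy_Schwarz_ineq2[of "G (x + t *\<^sub>R h)" h] by (auto simp: indicator_def)
  qed
  finally have "\<bar>f (x + h) - f x\<bar> powr p \<le> (\<integral>t. ?w t * ?k t \<partial>lborel) powr p"
    using p by (intro powr_mono2) auto
  then have "ennreal (\<bar>f (x + h) - f x\<bar> powr p) \<le> ennreal ((\<integral>t. ?w t * ?k t \<partial>lborel) powr p)"
    by (rule ennreal_leI)
  also have "\<dots> \<le> (\<integral>\<^sup>+t. ennreal (?w t * ?k t powr p) \<partial>lborel)"
  proof (rule powr_integral_le[OF p])
    show "?k \<in> borel_measurable lborel"
      using borel_measurable_continuous_onI[OF cG] by measurable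
    show "integrable lborel ?w" by simp
    show "(\<integral>t. ?w t \<partial>lborel) = 1" by simp
  qed (use i in auto)
  finally show ?thesis .
qed

text \<open>The pointwise bound on segments is integrated in x and Fubini exchanges the order; for
  each t the translation by t h is undone by invariance of the measure. All segments starting in the
  ball stay in the one enlarged by the length of h.\<close>

lemma C1_translation_estimate:
  fixes f :: "'a::euclidean_space \<Rightarrow> real"
  assumes f: "C1 f G" and p: "p > 1"
  shows "(\<integral>\<^sup>+x. ennreal (\<bar>f (x + h) - f x\<bar> powr p) * indicator (cball 0 R) x \<partial>lborel)
    \<le> ennreal (norm h powr p) * Lpow p (cball 0 (R + norm h)) G"
proof -
  let ?d = "\<lambda>x. ennreal (\<bar>f (x + h) - f x\<bar> powr p) * indicator (cball 0 R) x"
  let ?E = "\<lambda>t x. ennreal (norm h powr p) * (indicator {0..1} t * (ennreal (norm (G (x + t *\<^sub>R h)) powr p) * indicator (cball 0 (R + norm h)) (x + t *\<^sub>R h)))"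
  note [measurable] = C1_measurable[OF f]
  let ?c = "ennreal (norm h powr p)"
  let ?H = "\<lambda>x. ennreal (norm (G x) powr p) * indicator (cball 0 (R + norm h)) x"
  have "(\<integral>\<^sup>+x. ?d x \<partial>lborel)
    \<le> (\<integral>\<^sup>+x. (\<integral>\<^sup>+t. ?E t x \<partial>lborel) \<partial>lborel)"
  proof (rule nn_integral_mono)
    fix x :: 'a
    have *: "?d x \<le>
      (\<integral>\<^sup>+t. ennreal (indicator {0..1} t * (norm (G (x + t *\<^sub>R h)) * norm h) powr p) * indicator (cball 0 R) x \<partial>lborel)"
      by (subst nn_integral_multc) (auto intro!: mult_right_mono line_difference_powr_le[OF f p])
    also have "\<dots> \<le> (\<integral>\<^sup>+t. ?E t x \<partial>lborel)"
    proof (rule nn_integral_mono)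
      fix t :: real
      show "ennreal (indicator {0..1} t * (norm (G (x + t *\<^sub>R h)) * norm h) powr p) * indicator (cball 0 R) x
        \<le> ?E t x"
      proof (cases "t \<in> {0..1} \<and> norm x \<le> R")
        case True
        then have "\<bar>t\<bar> * norm h \<le> norm h" by (intro mult_left_le_one_le) auto
        then have "norm (x + t *\<^sub>R h) \<le> R + norm h"
          using True norm_triangle_ineq[of x "t *\<^sub>R h"] by simp
        then show ?thesis using True
          by (simp add: powr_mult ennreal_mult mult.commute)
      qed (auto simp: indicator_def)
    qed
    finally show "?d x
      \<le> (\<integral>\<^sup>+t. ?E t x \<partial>lborel)" .
  qed
  also have "\<dots> = (\<integral>\<^sup>+t. (\<integral>\<^sup>+x. ?E t x \<partial>lborel) \<partial>lborel)"
    by (rule lborel_pair.Fubini') measurable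
  also have "\<dots> = (\<integral>\<^sup>+t. ?c * Lpow p (cball 0 (R + norm h)) G * indicator {0..1} t \<partial>(lborel::real measure))"
  proof (rule nn_integral_cong)
    fix t :: real
    have "(\<integral>\<^sup>+x. ?E t x \<partial>lborel) = ?c * (indicator {0..1} t * (\<integral>\<^sup>+x. ?H (x + t *\<^sub>R h) \<partial>lborel))"
      by (subst nn_integral_cmult, measurable, subst nn_integral_cmult) auto
    also have "(\<integral>\<^sup>+x. ?H (x + t *\<^sub>R h) \<partial>lborel) = Lpow p (cball 0 (R + norm h)) G"
      unfolding Lpow_def by (rule nn_integral_lborel_translate) measurable
    finally show "(\<integral>\<^sup>+x. ?E t x \<partial>lborel) = ?c * Lpow p (cball 0 (R + norm h)) G * indicator {0..1} t"
      by (simp add: mult_ac)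
  qed
  also have "\<dots> = ?c * Lpow p (cball 0 (R + norm h)) G"
    by (subst nn_integral_cmult_indicator) auto
  finally show ?thesis .
qed

lemma AE_lborel_translate:
  fixes h :: "'a::euclidean_space"
  assumes "AE x in lborel. P x"
  shows "AE x in lborel. P (x + h)"
proof -
  from assms obtain N where N: "{x. \<not> P x} \<subseteq> N" "N \<in> sets borel" "emeasure lborel N = 0"
    by (auto elim!: AE_E)
  have "AE x in (lborel :: 'a measure). x \<notin> N" using N by (intro AE_not_in) (auto simp: null_sets_def)
  then have "AE x in distr lborel borel ((+) h). x \<notin> N" by (simp only: lborel_distr_plus)
  then have "AE x in (lborel :: 'a measure). h + x \<notin> N"
    by (subst (asm) AE_distr_iff) (use N in auto)
  then show ?thesis by eventually_elim (use N(1) in \<open>auto simp: add.commute\<close>)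
qed

context p_solution
begin

text \<open>The right side contains the expected product and chain rule gradient of
  \<open>\<Phi> (u x) * \<eta> x\<close>, yet no such rule is proved for weak gradients: the C^1
  estimate is applied to \<open>\<Phi> (U n x) * \<eta> x\<close> and the limit is taken on both
  sides of the inequality.\<close>

lemma translation_estimate:
  assumes \<Phi>: "\<And>t. t \<in> {0..1} \<Longrightarrow> (\<Phi> has_real_derivative \<Phi>' t) (at t)" "continuous_on {0..1} \<Phi>'"
    and \<eta>: "C1 \<eta> G"
  defines "f \<equiv> \<lambda>x. \<Phi> (u x) * \<eta> x"
  shows "(\<integral>\<^sup>+x. ennreal (\<bar>f (x + h) - f x\<bar> powr p) * indicator (cball 0 R) x \<partial>lborel)
    \<le> ennreal (norm h powr p) * (ennreal (4 powr p) *
       (Lpow p (cball 0 (R + norm h)) (\<lambda>x. (\<Phi>' (u x) * \<eta> x) *\<^sub>R g x) + Lpow p (cball 0 (R + norm h)) (\<lambda>x. \<Phi> (u x) *\<^sub>R G x)))"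
proof -
  let ?d = "\<lambda>f x. ennreal (\<bar>f (x + h) - f x\<bar> powr p) * indicator (cball 0 R) x"
  define S where "S = cball (0::'a) (R + norm h)"
  let ?A = "\<lambda>t x. ennreal (norm (\<Phi> t *\<^sub>R G x) powr p) * indicator S x"
  let ?B = "\<lambda>t x. ennreal (norm ((\<Phi>' t * \<eta> x) *\<^sub>R g x) powr p) * indicator S x"
  obtain U V where U: "\<And>n. C1 (U n) (V n)" "\<And>n x. U n x \<in> {0..1}"
    "AE x in lborel. x \<in> S \<longrightarrow> (\<lambda>n. U n x) \<longlonglongrightarrow> u x"
    "(\<lambda>n. Lpow p S (\<lambda>x. V n x - g x)) \<longlonglongrightarrow> 0"
    using approx[of "R + norm h"] unfolding S_def by blast
  have c\<Phi>: "continuous_on {0..1} \<Phi>"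
    using \<Phi>(1) by (intro continuous_at_imp_continuous_on ballI) (rule DERIV_isCont)
  obtain B where B: "B > 0" "\<And>t. t \<in> {0..1} \<Longrightarrow> \<bar>\<Phi> t\<bar> \<le> B" using compose_bounded[OF c\<Phi>] by blast
  obtain B' where B': "B' > 0" "\<And>t. t \<in> {0..1} \<Longrightarrow> \<bar>\<Phi>' t\<bar> \<le> B'" using compose_bounded[OF \<Phi>(2)] by blast
  have "bounded (\<eta> ` S)" "bounded (G ` S)"
    unfolding S_def using continuous_on_subset[OF C1_D(2)[OF \<eta>]] continuous_on_subset[OF C1_D(3)[OF \<eta>]]
    by (simp_all add: compact_imp_bounded compact_continuous_image)
  then obtain M N where M: "M > 0" "\<And>x. x \<in> S \<Longrightarrow> \<bar>\<eta> x\<bar> \<le> M" and N: "N > 0" "\<And>x. x \<in> S \<Longrightarrow> norm (G x) \<le> N"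
    unfolding bounded_pos by auto
  have [measurable]: "(\<lambda>x. \<Phi>' (U n x)) \<in> borel_measurable borel" for n
    using U(2) by (intro borel_measurable_continuous_onI continuous_on_compose2[OF \<Phi>(2) C1_D(3)[OF U(1)]]) auto
  have [measurable]: "(\<lambda>x. \<Phi> (U n x)) \<in> borel_measurable borel" for n
    using U(2) by (intro borel_measurable_continuous_onI continuous_on_compose2[OF c\<Phi> C1_D(3)[OF U(1)]]) auto
  note [measurable] = compose_measurable[OF c\<Phi>] compose_measurable[OF \<Phi>(2)] C1_measurable[OF U(1)] C1_measurable[OF \<eta>]
  have [measurable]: "S \<in> sets borel" by (simp add: S_def)
  have finS: "emeasure lborel S < top" by (simp add: S_def emeasure_cball_finite)
  have lim\<Phi>: "(\<lambda>n. \<Phi> (U n x)) \<longlonglongrightarrow> \<Phi> (u x)" "(\<lambda>n. \<Phi>' (U n x)) \<longlonglongrightarrow> \<Phi>' (u x)"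
    if "(\<lambda>n. U n x) \<longlonglongrightarrow> u x" for x
    using continuous_on_tendsto_compose[OF c\<Phi> that] continuous_on_tendsto_compose[OF \<Phi>(2) that] u01 U(2) by auto
  let ?K = "ennreal ((B' * M) powr p)"
  define f' where "f' n x = \<Phi> (U n x) * \<eta> x" for n x
  define G' where "G' n x = \<Phi> (U n x) *\<^sub>R G x + \<eta> x *\<^sub>R (\<Phi>' (U n x) *\<^sub>R V n x)" for n x
  have f': "C1 (f' n) (G' n)" for n
    unfolding f'_def G'_def by (rule C1_mult[OF C1_compose[OF U(1,2) \<Phi>] \<eta>])
  note [measurable] = C1_measurable[OF f']
  have [measurable]: "f \<in> borel_measurable borel" unfolding f_def by measurable
  let ?a = "\<lambda>n. Lpow p S (\<lambda>x. \<Phi> (U n x) *\<^sub>R G x)"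
  let ?b = "\<lambda>n. Lpow p S (\<lambda>x. (\<Phi>' (U n x) * \<eta> x) *\<^sub>R g x)"
  let ?c = "\<lambda>n. Lpow p S (\<lambda>x. (\<Phi>' (U n x) * \<eta> x) *\<^sub>R (V n x - g x))"
  let ?RHS = "\<lambda>n. ennreal (norm h powr p) * (ennreal (2 powr p) * (?a n + ennreal (2 powr p) * (?b n + ?c n)))"
  have step: "(\<integral>\<^sup>+x. ?d (f' n) x \<partial>lborel) \<le> ?RHS n" for n
  proof -
    have "(\<integral>\<^sup>+x. ?d (f' n) x \<partial>lborel)
      \<le> ennreal (norm h powr p) * Lpow p S (G' n)"
      unfolding S_def by (rule C1_translation_estimate[OF f' p])
    \<comment> \<open>Replacing V n by g + (V n - g) leaves three terms. Separating them takes two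
      triangle inequalities, each with factor 2^p, and this is the origin of 4^p.\<close>
    also have "Lpow p S (G' n) = Lpow p S (\<lambda>x. \<Phi> (U n x) *\<^sub>R G x + ((\<Phi>' (U n x) * \<eta> x) *\<^sub>R g x + (\<Phi>' (U n x) * \<eta> x) *\<^sub>R (V n x - g x)))"
      by (rule arg_cong[where f="Lpow p S"]) (simp add: fun_eq_iff G'_def algebra_simps)
    also have "\<dots> \<le> ennreal (2 powr p) * (?a n + Lpow p S (\<lambda>x. (\<Phi>' (U n x) * \<eta> x) *\<^sub>R g x + (\<Phi>' (U n x) * \<eta> x) *\<^sub>R (V n x - g x)))"
      using p by (intro Lpow_add_le) auto
    also have "\<dots> \<le> ennreal (2 powr p) * (?a n + ennreal (2 powr p) * (?b n + ?c n))"
      using p by (intro mult_left_mono add_left_mono Lpow_add_le) auto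
    finally show ?thesis by (simp add: mult_left_mono)
  qed
  have ta: "?a \<longlonglongrightarrow> Lpow p S (\<lambda>x. \<Phi> (u x) *\<^sub>R G x)"
    unfolding Lpow_def
  proof (rule nn_integral_dominated_convergence[where w="\<lambda>x. ennreal ((B * N) powr p) * indicator S x"])
    show "(\<integral>\<^sup>+(x::'a). ennreal ((B * N) powr p) * indicator S x \<partial>lborel) < \<infinity>"
      using finS by (simp add: nn_integral_cmult ennreal_mult_less_top)
    have "norm (\<Phi> (U n x) *\<^sub>R G x) powr p \<le> (B * N) powr p" if "x \<in> S" for n x
      using B(1) B(2)[OF U(2)[of n x]] N(2)[OF that] p by (auto intro!: powr_mono2 mult_mono)
    then show "AE x in lborel. ?A (U n x) x \<le> ennreal ((B * N) powr p) * indicator S x" for n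
      by (auto simp: indicator_def intro!: ennreal_leI)
    show "AE x in lborel. (\<lambda>n. ?A (U n x) x) \<longlonglongrightarrow> ?A (u x) x"
      using U(3)
    proof eventually_elim
      fix x assume "x \<in> S \<longrightarrow> (\<lambda>n. U n x) \<longlonglongrightarrow> u x"
      then show "(\<lambda>n. ?A (U n x) x) \<longlonglongrightarrow> ?A (u x) x"
        using p by (cases "x \<in> S") (auto intro!: tendsto_ennrealI tendsto_powr' tendsto_norm tendsto_scaleR tendsto_mult tendsto_rabs lim\<Phi>)
    qed
  qed measurable
  have tb: "?b \<longlonglongrightarrow> Lpow p S (\<lambda>x. (\<Phi>' (u x) * \<eta> x) *\<^sub>R g x)"
    unfolding Lpow_def
  proof (rule nn_integral_dominated_convergence[where w="\<lambda>x. ?K * (ennreal (norm (g x) powr p) * indicator S x)"])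
    show "(\<integral>\<^sup>+(x::'a). ?K * (ennreal (norm (g x) powr p) * indicator S x) \<partial>lborel) < \<infinity>"
      using g by (subst nn_integral_cmult) (auto simp: locLp_def Lpow_def S_def ennreal_mult_less_top)
    have "norm ((\<Phi>' (U n x) * \<eta> x) *\<^sub>R g x) powr p \<le> (B' * M) powr p * norm (g x) powr p" if "x \<in> S" for n x
    proof -
      have "norm ((\<Phi>' (U n x) * \<eta> x) *\<^sub>R g x) \<le> (B' * M) * norm (g x)"
        using B'(1) B'(2)[OF U(2)[of n x]] M(2)[OF that] by (auto simp: abs_mult intro!: mult_right_mono mult_mono)
      then show ?thesis using p by (subst powr_mult[symmetric]) (intro powr_mono2, auto)
    qed
    then show "AE x in lborel. ?B (U n x) x
       \<le> ?K * (ennreal (norm (g x) powr p) * indicator S x)" for n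
      by (auto simp: indicator_def ennreal_mult[symmetric] intro!: ennreal_leI)
    show "AE x in lborel. (\<lambda>n. ?B (U n x) x) \<longlonglongrightarrow> ?B (u x) x"
      using U(3)
    proof eventually_elim
      fix x assume "x \<in> S \<longrightarrow> (\<lambda>n. U n x) \<longlonglongrightarrow> u x"
      then show "(\<lambda>n. ?B (U n x) x) \<longlonglongrightarrow> ?B (u x) x"
        using p by (cases "x \<in> S") (auto intro!: tendsto_ennrealI tendsto_powr' tendsto_norm tendsto_scaleR tendsto_rabs tendsto_mult lim\<Phi>)
    qed
  qed measurable
  have tc: "?c \<longlonglongrightarrow> 0"
  proof (rule tendsto_sandwich[OF _ _ tendsto_const])
    have "(\<lambda>n. ?K * Lpow p S (\<lambda>x. V n x - g x)) \<longlonglongrightarrow> ?K * 0"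
      by (intro ennreal_tendsto_cmult U(4)) auto
    then show "(\<lambda>n. ?K * Lpow p S (\<lambda>x. V n x - g x)) \<longlonglongrightarrow> 0" by simp
    have "?c n \<le> ?K * Lpow p S (\<lambda>x. V n x - g x)" for n
      unfolding Lpow_def
    proof (subst nn_integral_cmult[symmetric], measurable, intro nn_integral_mono)
      fix x
      show "ennreal (norm ((\<Phi>' (U n x) * \<eta> x) *\<^sub>R (V n x - g x)) powr p) * indicator S x
         \<le> ?K * (ennreal (norm (V n x - g x) powr p) * indicator S x)"
      proof (cases "x \<in> S")
        case True
        have "norm ((\<Phi>' (U n x) * \<eta> x) *\<^sub>R (V n x - g x)) \<le> (B' * M) * norm (V n x - g x)"
          using B'(1) B'(2)[OF U(2)[of n x]] M(2)[OF True] by (auto simp: abs_mult intro!: mult_right_mono mult_mono)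
        then have "norm ((\<Phi>' (U n x) * \<eta> x) *\<^sub>R (V n x - g x)) powr p \<le> (B' * M) powr p * norm (V n x - g x) powr p"
          using p by (subst powr_mult[symmetric]) (intro powr_mono2, auto)
        then show ?thesis using True by (auto simp: ennreal_mult[symmetric] intro!: ennreal_leI)
      qed auto
    qed
    then show "\<forall>\<^sub>F n in sequentially. ?c n \<le> ?K * Lpow p S (\<lambda>x. V n x - g x)" by simp
  qed auto
  let ?a0 = "Lpow p S (\<lambda>x. \<Phi> (u x) *\<^sub>R G x)" and ?b0 = "Lpow p S (\<lambda>x. (\<Phi>' (u x) * \<eta> x) *\<^sub>R g x)"
  have "?RHS \<longlonglongrightarrow> ennreal (norm h powr p) * (ennreal (2 powr p) * (?a0 + ennreal (2 powr p) * (?b0 + 0)))"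
    by (intro ennreal_tendsto_cmult tendsto_add ta tb tc) auto
  then have lim: "liminf ?RHS = ennreal (norm h powr p) * (ennreal (2 powr p) * (?a0 + ennreal (2 powr p) * ?b0))"
    by (simp add: lim_imp_Liminf)
  have "(\<integral>\<^sup>+x. ?d f x \<partial>lborel) =
    (\<integral>\<^sup>+x. liminf (\<lambda>n. ?d (f' n) x) \<partial>lborel)"
  proof (rule nn_integral_cong_AE)
    \<comment> \<open>Convergence is needed both at x and at x + h, hence outside a null set and its
      translate.\<close>
    show "AE x in lborel. ?d f x =
      liminf (\<lambda>n. ?d (f' n) x)"
      using U(3) AE_lborel_translate[OF U(3), of h]
    proof eventually_elim
      fix x assume 1: "x \<in> S \<longrightarrow> (\<lambda>n. U n x) \<longlonglongrightarrow> u x" and 2: "x + h \<in> S \<longrightarrow> (\<lambda>n. U n (x + h)) \<longlonglongrightarrow> u (x + h)"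
      have "(\<lambda>n. ?d (f' n) x) \<longlonglongrightarrow>
         ?d f x"
      proof (cases "norm x \<le> R")
        case True
        then have "x \<in> S" "x + h \<in> S"
          using norm_triangle_ineq[of x h] by (auto simp: S_def intro: add_increasing2)
        then have "(\<lambda>n. f' n (x + h) - f' n x) \<longlonglongrightarrow> f (x + h) - f x"
          unfolding f'_def f_def using 1 2 by (intro tendsto_intros lim\<Phi>) auto
        then show ?thesis using True p
          by (auto intro!: tendsto_ennrealI tendsto_powr' tendsto_rabs)
      qed auto
      then show "?d f x =
        liminf (\<lambda>n. ?d (f' n) x)"
        by (intro lim_imp_Liminf[symmetric]) auto
    qed
  qed
  also have "\<dots> \<le> liminf (\<lambda>n. \<integral>\<^sup>+x. ?d (f' n) x \<partial>lborel)"
    by (rule nn_integral_liminf) measurable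
  also have "\<dots> \<le> liminf ?RHS"
    by (rule Liminf_mono) (use step in auto)
  also have "\<dots> \<le> ennreal (norm h powr p) * (ennreal (4 powr p) * (?b0 + ?a0))"
    unfolding lim
  proof (rule mult_left_mono)
    have 1: "1 \<le> ennreal (2 powr p)"
      using p ge_one_powr_ge_zero[of 2 p] by (simp add: ennreal_1[symmetric] del: ennreal_1)
    have "ennreal (2 powr p) * (?a0 + ennreal (2 powr p) * ?b0) \<le> ennreal (2 powr p) * (ennreal (2 powr p) * ?a0 + ennreal (2 powr p) * ?b0)"
      using mult_right_mono[OF 1, of ?a0] by (intro mult_left_mono add_right_mono) auto
    also have "\<dots> = ennreal (2 powr p) * ennreal (2 powr p) * (?b0 + ?a0)"
      by (simp add: distrib_left mult.assoc add.commute)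
    also have "ennreal (2 powr p) * ennreal (2 powr p) = ennreal (4 powr p)"
      by (simp add: ennreal_mult[symmetric] powr_mult[symmetric])
    finally show "ennreal (2 powr p) * (?a0 + ennreal (2 powr p) * ?b0) \<le> ennreal (4 powr p) * (?b0 + ?a0)" .
  qed auto
  finally show ?thesis unfolding S_def .
qed

end

section \<open>Faber--Krahn inequality and logarithmic estimate\<close>

text \<open>The square of the positive part of (r'^2 - |x|^2) / (r'^2 - r^2). It is at least 1 on
  the inner ball and grows beyond 1 towards the origin; capping it there would break
  differentiability, and the estimates ask for a lower bound on the inner ball. The gradient bound
  follows from r'^2 - r^2 \<ge> r' (r' - r).\<close>

lemma cutoff_exists:
  fixes r r' :: real
  assumes r: "0 < r" "r < r'"
  obtains \<eta> :: "'a::euclidean_space \<Rightarrow> real" and G where "C1 \<eta> G" "\<And>x. \<eta> x \<ge> 0" "\<And>x. r' < norm x \<Longrightarrow> \<eta> x = 0"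
    "\<And>x. norm x \<le> r \<Longrightarrow> \<eta> x \<ge> 1" "\<And>x. norm (G x) \<le> 4 * r' / (r' - r)\<^sup>2" "\<And>x. r' < norm x \<Longrightarrow> G x = 0"
proof -
  define d where "d = r'\<^sup>2 - r\<^sup>2"
  have dd: "d = (r' - r) * (r' + r)" by (simp add: d_def power2_eq_square algebra_simps)
  have d: "d > 0" unfolding dd using r by simp
  define w :: "'a \<Rightarrow> real" where "w x = (r'\<^sup>2 - x \<bullet> x) / d" for x
  define H :: "'a \<Rightarrow> 'a" where "H x = (- 2 / d) *\<^sub>R x" for x
  have "C1 w H"
    unfolding C1_def
  proof (intro conjI allI)
    show "(w has_derivative (\<lambda>h. H x \<bullet> h)) (at x)" for x
      unfolding w_def[abs_def] H_def using d
      by (auto intro!: derivative_eq_intros simp: inner_commute)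
    show "continuous_on UNIV H"
      unfolding H_def[abs_def] by (intro continuous_intros)
  qed
  then have C: "C1 (\<lambda>x. max 0 (w x) powr 2) (\<lambda>x. (2 * max 0 (w x) powr (2 - 1)) *\<^sub>R H x)" (is "C1 ?\<eta> ?G")
  proof (rule C1_compose[of _ _ UNIV])
    show "((\<lambda>t. max 0 t powr 2) has_real_derivative 2 * max 0 t powr (2 - 1)) (at t)" for t :: real
      by (rule pos_part_powr_has_derivative) simp
    show "continuous_on UNIV (\<lambda>t::real. 2 * max 0 t powr (2 - 1))"
      by (intro continuous_intros pos_part_powr_continuous) simp
  qed simp
  have out: "w x \<le> 0" if "r' < norm x" for x
  proof -
    have "r'\<^sup>2 \<le> (norm x)\<^sup>2" using that r by (intro power_mono) auto
    then show ?thesis using d by (simp add: w_def power2_norm_eq_inner divide_le_0_iff)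
  qed
  show ?thesis
  proof (rule that[OF C])
    show "max 0 (w x) powr 2 \<ge> 0" for x by simp
    show "max 0 (w x) powr 2 = 0" "?G x = 0" if "r' < norm x" for x
      using out[OF that] by (simp_all add: max_def)
    show "1 \<le> max 0 (w x) powr 2" if "norm x \<le> r" for x
    proof -
      have "(norm x)\<^sup>2 \<le> r\<^sup>2" using that by (intro power_mono) auto
      then have "1 \<le> w x" using d by (simp add: w_def power2_norm_eq_inner d_def)
      then show ?thesis using powr_mono2[of 2 1 "max 0 (w x)"] by simp
    qed
    show "norm (?G x) \<le> 4 * r' / (r' - r)\<^sup>2" for x
    proof (cases "norm x \<le> r'")
      case True
      have w: "max 0 (w x) \<le> r'\<^sup>2 / d" using d r by (auto simp: w_def divide_right_mono)
      have "norm (?G x) = 2 * max 0 (w x) * (2 / d * norm x)"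
        using d by (simp add: H_def max_def)
      also have "\<dots> \<le> 2 * (r'\<^sup>2 / d) * (2 / d * r')"
        using w True d by (intro mult_mono) auto
      also have "\<dots> = 4 * r' * (r' / d)\<^sup>2"
        by (simp add: power2_eq_square)
      also have "\<dots> \<le> 4 * r' * (1 / (r' - r))\<^sup>2"
      proof (intro mult_left_mono power_mono)
        have "r' * (r' - r) \<le> d" unfolding dd using r by (simp add: algebra_simps)
        then show "r' / d \<le> 1 / (r' - r)" using d r by (simp add: field_simps)
      qed (use r d in auto)
      finally show ?thesis by (simp add: power_divide)
    next
      case False
      then show ?thesis using out[of x] r by (simp add: max_def)
    qed
  qed
qed

text \<open>The measure of the support of \<open>f\<close> being at most a fixed fraction of the ball of radius \<open>\<rho>\<close>,
  a translation by a typical \<open>h\<close> in that ball moves most of the support off itself, so that \<open>f\<close> is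
  comparable to the difference of \<open>f\<close> and its translate.\<close>

lemma faber_krahn:
  fixes f :: "'a::euclidean_space \<Rightarrow> real"
  assumes [measurable]: "f \<in> borel_measurable borel" "A \<in> sets borel" and p: "p > 0"
    and A: "\<And>x. f x \<noteq> 0 \<Longrightarrow> x \<in> A" "A \<subseteq> cball 0 R" "emeasure lborel A \<le> ennreal a" and a: "a \<ge> 0"
    and fin: "(\<integral>\<^sup>+x. ennreal (\<bar>f x\<bar> powr p) \<partial>lborel) < \<infinity>"
    and \<rho>: "\<rho> > 0" "2 powr (p + 1) * a \<le> unit_ball_vol (real DIM('a)) * \<rho> ^ DIM('a)"
    and D: "\<And>h. norm h \<le> \<rho> \<Longrightarrow> (\<integral>\<^sup>+x. ennreal (\<bar>f (x + h) - f x\<bar> powr p) * indicator (cball 0 R) x \<partial>lborel) \<le> ennreal d"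
    and d: "d \<ge> 0"
  shows "(\<integral>\<^sup>+x. ennreal (\<bar>f x\<bar> powr p) \<partial>lborel) \<le> ennreal (2 powr (p + 1) * d)"
proof -
  let ?d = "\<lambda>h x. ennreal (\<bar>f (x + h) - f x\<bar> powr p) * indicator (cball 0 R) x"
  let ?e = "\<lambda>h x. ennreal (\<bar>f (x + h)\<bar> powr p) * indicator A x"
  let ?c = "ennreal (2 powr p)"
  let ?I = "\<integral>\<^sup>+x. ennreal (\<bar>f x\<bar> powr p) \<partial>lborel"
  obtain i where i: "i \<ge> 0" "?I = ennreal i" using fin by (cases ?I) auto
  define v where "v = unit_ball_vol (real DIM('a)) * \<rho> ^ DIM('a)"
  have v: "v > 0" "emeasure lborel (cball (0::'a) \<rho>) = ennreal v"
    using \<rho> by (auto simp: v_def emeasure_cball)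
  let ?B = "indicator (cball (0::'a) \<rho>) :: 'a \<Rightarrow> ennreal"
  have [measurable]: "A \<in> sets lborel" by simp
  have fA: "ennreal (\<bar>f x\<bar> powr p) = ennreal (\<bar>f x\<bar> powr p) * indicator A x" for x
    using A(1)[of x] by (auto simp: indicator_def)
  have "ennreal v * ?I = (\<integral>\<^sup>+h. (\<integral>\<^sup>+x. ennreal (\<bar>f x\<bar> powr p) \<partial>lborel) * ?B h \<partial>lborel)"
    by (subst nn_integral_cmult) (auto simp: v mult.commute)
  also have "\<dots> \<le> (\<integral>\<^sup>+h. (\<integral>\<^sup>+x. ?c * (?d h x
      + ?e h x) \<partial>lborel) * ?B h \<partial>lborel)"
  proof (intro nn_integral_mono mult_right_mono)
    fix h x :: 'a
    show "ennreal (\<bar>f x\<bar> powr p) \<le> ?c * (?d h x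
      + ?e h x)"
    proof (cases "x \<in> A")
      case True
      then have "x \<in> cball 0 R" using A(2) by blast
      then show ?thesis
        using ennreal_norm_add_powr_le[of p "f x - f (x + h)" "f (x + h)"] p True
        by (simp add: abs_minus_commute)
    next
      case False
      then have "f x = 0" using A(1) by blast
      then show ?thesis using p by simp
    qed
  qed auto
  also have "\<dots> = (\<integral>\<^sup>+h. (\<integral>\<^sup>+x. ?c * (?d h x) \<partial>lborel) * ?B h
      + (\<integral>\<^sup>+x. ?c * (?e h x) \<partial>lborel) * ?B h \<partial>lborel)"
    by (simp add: distrib_left nn_integral_add distrib_right)
  also have "\<dots> = (\<integral>\<^sup>+h. (\<integral>\<^sup>+x. ?c * (?d h x) \<partial>lborel) * ?B h \<partial>lborel)
      + (\<integral>\<^sup>+h. (\<integral>\<^sup>+x. ?c * (?e h x) \<partial>lborel) * ?B h \<partial>lborel)"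
    by (rule nn_integral_add) measurable
  also have "\<dots> \<le> ennreal (2 powr p * d) * ennreal v + ?c * (ennreal a * ?I)"
  proof (rule add_mono)
    have "(\<integral>\<^sup>+h. (\<integral>\<^sup>+x. ?c * (?d h x) \<partial>lborel) * ?B h \<partial>lborel)
      \<le> (\<integral>\<^sup>+h. ennreal (2 powr p * d) * ?B h \<partial>lborel)"
    proof (rule nn_integral_mono)
      fix h :: 'a
      show "(\<integral>\<^sup>+x. ?c * (?d h x) \<partial>lborel) * ?B h
        \<le> ennreal (2 powr p * d) * ?B h"
      proof (cases "norm h \<le> \<rho>")
        case True
        have "?c * (\<integral>\<^sup>+x. ?d h x \<partial>lborel) \<le> ?c * ennreal d"
          using D[OF True] by (rule mult_left_mono) auto
        then show ?thesis using True d
          by (subst nn_integral_cmult) (auto simp: ennreal_mult)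
      qed auto
    qed
    also have "\<dots> = ennreal (2 powr p * d) * ennreal v"
      by (subst nn_integral_cmult) (auto simp: v)
    finally show "(\<integral>\<^sup>+h. (\<integral>\<^sup>+x. ?c * (?d h x) \<partial>lborel) * ?B h \<partial>lborel)
      \<le> ennreal (2 powr p * d) * ennreal v" .
  next
    \<comment> \<open>Letting h range over the whole space turns the inner integral, for each fixed
      x in A, into the full integral of |f|^p. The measure of A then supplies the factor a.\<close>
    have "(\<integral>\<^sup>+h. (\<integral>\<^sup>+x. ?c * (?e h x) \<partial>lborel) * ?B h \<partial>lborel)
      \<le> (\<integral>\<^sup>+h. (\<integral>\<^sup>+x. ?c * (ennreal (\<bar>f (h + x)\<bar> powr p) * indicator A x) \<partial>lborel) \<partial>lborel)"
      by (intro nn_integral_mono) (auto simp: indicator_def add.commute)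
    also have "\<dots> = (\<integral>\<^sup>+x. (\<integral>\<^sup>+h. ?c * (ennreal (\<bar>f (h + x)\<bar> powr p) * indicator A x) \<partial>lborel) \<partial>lborel)"
      by (rule lborel_pair.Fubini') measurable
    also have "\<dots> = (\<integral>\<^sup>+x. (?c * ?I) * indicator A x \<partial>lborel)"
    proof (rule nn_integral_cong)
      fix x :: 'a
      have "(\<integral>\<^sup>+h. ?c * (ennreal (\<bar>f (h + x)\<bar> powr p) * indicator A x) \<partial>lborel)
        = ?c * ((\<integral>\<^sup>+h. ennreal (\<bar>f (h + x)\<bar> powr p) \<partial>lborel) * indicator A x)"
        by (subst nn_integral_cmult, measurable, subst nn_integral_multc) auto
      also have "(\<integral>\<^sup>+h. ennreal (\<bar>f (h + x)\<bar> powr p) \<partial>lborel) = ?I"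
        by (rule nn_integral_lborel_translate) measurable
      finally show "(\<integral>\<^sup>+h. ?c * (ennreal (\<bar>f (h + x)\<bar> powr p) * indicator A x) \<partial>lborel)
        = (?c * ?I) * indicator A x" by (simp add: mult.assoc)
    qed
    also have "\<dots> = (?c * ?I) * emeasure lborel A"
      by (rule nn_integral_cmult_indicator) auto
    also have "\<dots> \<le> (?c * ?I) * ennreal a"
      using A(3) by (rule mult_left_mono) auto
    finally show "(\<integral>\<^sup>+h. (\<integral>\<^sup>+x. ?c * (?e h x) \<partial>lborel) * ?B h \<partial>lborel)
      \<le> ?c * (ennreal a * ?I)" by (simp add: mult_ac)
  qed
  also have "\<dots> = ennreal (2 powr p * d * v + 2 powr p * (a * i))"
    using a d i v by (simp add: ennreal_mult[symmetric] ennreal_plus[symmetric] mult.assoc del: ennreal_plus)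
  finally have "ennreal (v * i) \<le> ennreal (2 powr p * d * v + 2 powr p * (a * i))"
    using i v by (simp add: ennreal_mult)
  then have "v * i \<le> 2 powr p * d * v + 2 powr p * (a * i)"
    using a d i v by (subst (asm) ennreal_le_iff) auto
  \<comment> \<open>The volume condition on \<open>\<rho>\<close> makes this term at most half of
    the left side, from which it can be subtracted because i is finite.\<close>
  moreover have "2 powr p * (a * i) \<le> v / 2 * i"
  proof -
    have "2 powr p * a \<le> v / 2" using \<rho>(2) by (simp add: v_def powr_add)
    from mult_right_mono[OF this i(1)] show ?thesis by (simp add: mult.assoc)
  qed
  ultimately have "v * i \<le> v * (2 * (2 powr p * d))" by (simp add: algebra_simps)
  then have "i \<le> 2 * (2 powr p * d)" using v by simp
  then show ?thesis using i by (simp add: powr_add ennreal_leI mult_ac)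
qed

context p_solution
begin

text \<open>For F(t) = (1 + \<theta> - t)^(1-p) / (p - 1) the derivative is (1 + \<theta> - t)^(-p),
  so the energy is that of the logarithm, and F^p / F'^(p-1) is the constant (p - 1)^(-p). Hence the
  bound is independent of \<theta>. The radius 3 R is what translations of length up to 2 R require
  on the ball of radius R; the cutoff falls to 0 between 3 R and 4 R.\<close>

lemma log_gradient_estimate:
  assumes R: "R > 0" and \<theta>: "\<theta> > 0"
  shows "Lpow p (cball 0 (3 * R)) (\<lambda>x. (1 / (1 + \<theta> - u x)) *\<^sub>R g x)
    \<le> ennreal (2 * (4 powr p * p powr p) * ((1 / (p - 1)) powr p * (16 / R) powr p) * (unit_ball_vol (real DIM('a)) * (4 * R) ^ DIM('a)))"
proof -
  have "0 < 3 * R" "3 * R < 4 * R" using R by auto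
  then obtain \<eta> :: "'a \<Rightarrow> real" and G where \<eta>: "C1 \<eta> G" "\<And>x. \<eta> x \<ge> 0" "\<And>x. 4 * R < norm x \<Longrightarrow> \<eta> x = 0"
    "\<And>x. norm x \<le> 3 * R \<Longrightarrow> \<eta> x \<ge> 1" "\<And>x. norm (G x) \<le> 4 * (4 * R) / (4 * R - 3 * R)\<^sup>2" "\<And>x. 4 * R < norm x \<Longrightarrow> G x = 0"
    using cutoff_exists by blast
  have G: "norm (G x) \<le> 16 / R" for x
    using \<eta>(5)[of x] R by (simp add: power2_eq_square)
  note [measurable] = C1_measurable[OF \<eta>(1)]
  let ?F = "\<lambda>t. (1 + \<theta> - t) powr (1 - p) / (p - 1)" and ?F' = "\<lambda>t. (1 + \<theta> - t) powr (- p)"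
  let ?Q = "\<lambda>t::real. (1 / (p - 1)) powr p"
  have F: "(?F has_real_derivative ?F' t) (at t)" if "t \<in> {0..1}" for t
  proof -
    have "((\<lambda>t. (1 + \<theta> - t) powr (1 - p)) has_real_derivative (p - 1) * (1 + \<theta> - t) powr (- p)) (at t)"
      using that \<theta> by (auto intro!: derivative_eq_intros simp: field_simps)
    from DERIV_cdivide[OF this, of "p - 1"] show ?thesis using p by simp
  qed
  have cF': "continuous_on {0..1} ?F'"
    using \<theta> by (intro continuous_intros) auto
  have FQ: "?F t powr p \<le> ?Q t * ?F' t powr (p - 1)" if "t \<in> {0..1}" for t
  proof -
    have "?F t powr p = ((1 + \<theta> - t) powr (1 - p) * (1 / (p - 1))) powr p" by simp
    also have "\<dots> = (1 + \<theta> - t) powr ((1 - p) * p) * (1 / (p - 1)) powr p"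
      by (subst powr_mult) (simp add: powr_powr)
    also have "(1 - p) * p = - p * (p - 1)" by (simp add: algebra_simps)
    finally show ?thesis by (simp add: powr_powr mult.commute)
  qed
  have "Lpow p (cball 0 (3 * R)) (\<lambda>x. (1 / (1 + \<theta> - u x)) *\<^sub>R g x)
    \<le> (\<integral>\<^sup>+x. ennreal (?F' (u x) * \<eta> x powr p * norm (g x) powr p) \<partial>lborel)"
    unfolding Lpow_def
  proof (rule nn_integral_mono)
    fix x
    have w: "1 + \<theta> - u x > 0" using u01[of x] \<theta> by simp
    then have eq: "norm ((1 / (1 + \<theta> - u x)) *\<^sub>R g x) powr p = ?F' (u x) * norm (g x) powr p"
      by (simp add: powr_mult powr_divide powr_minus_divide)
    show "ennreal (norm ((1 / (1 + \<theta> - u x)) *\<^sub>R g x) powr p) * indicator (cball 0 (3 * R)) x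
       \<le> ennreal (?F' (u x) * \<eta> x powr p * norm (g x) powr p)"
    proof (cases "norm x \<le> 3 * R")
      case True
      have "1 \<le> \<eta> x powr p" using \<eta>(4)[OF True] p by (intro ge_one_powr_ge_zero) auto
      then have "?F' (u x) * norm (g x) powr p * 1 \<le> ?F' (u x) * norm (g x) powr p * \<eta> x powr p"
        by (rule mult_left_mono) auto
      then show ?thesis unfolding eq using True by (simp add: ennreal_leI mult_ac)
    qed auto
  qed
  also have "\<dots> \<le> ennreal (2 * (4 powr p * p powr p)) * (\<integral>\<^sup>+x. ennreal (?Q (u x) * norm (G x) powr p) \<partial>lborel)"
    by (rule caccioppoli[OF F cF' _ _ _ _ FQ \<eta>(1,2,3)]) (use p in auto)
  also have "\<dots> \<le> ennreal (2 * (4 powr p * p powr p)) * (\<integral>\<^sup>+x. ennreal ((1 / (p - 1)) powr p * (16 / R) powr p) * indicator (cball 0 (4 * R)) (x::'a) \<partial>lborel)"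
  proof (intro mult_left_mono nn_integral_mono)
    fix x
    show "ennreal (?Q (u x) * norm (G x) powr p) \<le> ennreal ((1 / (p - 1)) powr p * (16 / R) powr p) * indicator (cball 0 (4 * R)) x"
    proof (cases "norm x \<le> 4 * R")
      case True
      then show ?thesis using G[of x] p by (auto intro!: ennreal_leI mult_left_mono powr_mono2)
    qed (use \<eta>(6) p in auto)
  qed auto
  also have "\<dots> = ennreal (2 * (4 powr p * p powr p) * ((1 / (p - 1)) powr p * (16 / R) powr p) * (unit_ball_vol (real DIM('a)) * (4 * R) ^ DIM('a)))"
    using R by (subst nn_integral_cmult_indicator) (auto simp: emeasure_cball ennreal_mult[symmetric] mult.assoc)
  finally show ?thesis .
qed

text \<open>Every pair of a point of E and a point of Z' sees a jump of the logarithm by at least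
  \<open>lam\<close>. Integrating over all pairs, with their difference as translation vector,
  bounds the product of the two measures; Z' fills half of the ball, so the measure of E is
  controlled. In the constant, 2 comes from that half, 2^N from the translations of length up to 2
  R, 4^N from the cutoff on the ball of radius 4 R, and the powers of R combine to the volume of the
  ball.\<close>

lemma log_estimate:
  assumes R: "R > 0" and \<theta>: "0 < \<theta>" "\<theta> < 1 / 2"
    and Z: "emeasure lborel ({x. u x \<le> 1/2} \<inter> cball 0 R) \<ge> ennreal (unit_ball_vol (real DIM('a)) * R ^ DIM('a) / 2)"
  shows "emeasure lborel ({x. u x > 1 - \<theta>} \<inter> cball 0 R) \<le>
    ennreal (2 * 2 ^ DIM('a) * 4 ^ DIM('a) * 2 * 2 powr p * 4 powr p * (4 powr p * p powr p) * (1 / (p - 1)) powr p * 16 powr p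
      * (unit_ball_vol (real DIM('a)) * R ^ DIM('a)) / ln ((1/2 + \<theta>) / (2 * \<theta>)) powr p)"
proof -
  let ?d = "\<lambda>v h x. ennreal (\<bar>v (x + h) - v x\<bar> powr p) * indicator (cball 0 R) x"
  let ?B = "indicator (cball 0 (2 * R)) :: 'a \<Rightarrow> ennreal"
  define N where "N = DIM('a)"
  define V where "V = unit_ball_vol (real DIM('a)) * R ^ DIM('a)"
  have V: "V > 0" using R by (simp add: V_def)
  \<comment> \<open>The argument 1 + \<theta> - u is below 2 \<theta> on E and at least 1/2 +
    \<theta> on Z'; \<open>lam\<close> is the logarithm of the ratio, and it grows without bound as
    \<theta> tends to 0.\<close>
  define lam where "lam = ln ((1/2 + \<theta>) / (2 * \<theta>))"
  have lam: "lam > 0" unfolding lam_def using \<theta> by (intro ln_gt_zero) (simp add: field_simps)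
  define E where "E = {x. u x > 1 - \<theta>} \<inter> cball 0 R"
  define Z' where "Z' = {x. u x \<le> 1/2} \<inter> cball 0 R"
  have [measurable]: "E \<in> sets borel" "Z' \<in> sets borel"
    unfolding E_def Z'_def by measurable
  let ?\<Phi> = "\<lambda>t. - ln (1 + \<theta> - t)" and ?\<Phi>' = "\<lambda>t. 1 / (1 + \<theta> - t)"
  have \<Phi>: "(?\<Phi> has_real_derivative ?\<Phi>' t) (at t)" if "t \<in> {0..1}" for t
    using that \<theta> by (auto intro!: derivative_eq_intros simp: field_simps)
  have c\<Phi>': "continuous_on {0..1} ?\<Phi>'"
    using \<theta> by (intro continuous_intros) auto
  \<comment> \<open>The translation estimate is already localised by balls, so the cutoff is
    constant here and its gradient term drops out.\<close>
  have one: "C1 (\<lambda>_::'a. 1) (\<lambda>_. 0)" by (simp add: C1_def)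
  define v where "v x = ?\<Phi> (u x)" for x
  have v_meas [measurable]: "v \<in> borel_measurable borel" unfolding v_def by measurable
  define K where "K = 2 * (4 powr p * p powr p) * ((1 / (p - 1)) powr p * (16 / R) powr p) * (unit_ball_vol (real DIM('a)) * (4 * R) ^ DIM('a))"
  have K: "K \<ge> 0" using R unfolding K_def by auto
  have trans: "(\<integral>\<^sup>+x. ?d v h x \<partial>lborel) \<le> ennreal ((2 * R) powr p * (4 powr p * K))"
    if h: "norm h \<le> 2 * R" for h
  proof -
    have "(\<integral>\<^sup>+x. ?d v h x \<partial>lborel)
      \<le> ennreal (norm h powr p) * (ennreal (4 powr p) *
       (Lpow p (cball 0 (R + norm h)) (\<lambda>x. (?\<Phi>' (u x) * 1) *\<^sub>R g x) + Lpow p (cball 0 (R + norm h)) (\<lambda>x. ?\<Phi> (u x) *\<^sub>R (0::'a))))"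
      using translation_estimate[OF \<Phi> c\<Phi>' one, of h R] by (simp add: v_def)
    also have "Lpow p (cball 0 (R + norm h)) (\<lambda>x. ?\<Phi> (u x) *\<^sub>R (0::'a)) = 0"
      using p by (simp add: Lpow_def)
    also have "Lpow p (cball 0 (R + norm h)) (\<lambda>x. (?\<Phi>' (u x) * 1) *\<^sub>R g x) + 0 \<le> Lpow p (cball 0 (3 * R)) (\<lambda>x. (?\<Phi>' (u x)) *\<^sub>R g x)"
      using h by (auto intro!: Lpow_mono_set simp: subset_cball)
    also have "\<dots> \<le> ennreal K" unfolding K_def by (rule log_gradient_estimate[OF R \<theta>(1)])
    finally have "(\<integral>\<^sup>+x. ?d v h x \<partial>lborel)
      \<le> ennreal (norm h powr p) * (ennreal (4 powr p) * ennreal K)" by (simp add: mult_left_mono)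
    also have "\<dots> \<le> ennreal ((2 * R) powr p) * (ennreal (4 powr p) * ennreal K)"
      using h p by (intro mult_right_mono ennreal_leI powr_mono2) auto
    finally show ?thesis using K by (simp add: ennreal_mult)
  qed
  have "ennreal (lam powr p) * (emeasure lborel Z' * emeasure lborel E) =
      (\<integral>\<^sup>+x. (\<integral>\<^sup>+y. ennreal (lam powr p) * indicator Z' y * indicator E x \<partial>lborel) \<partial>lborel)"
    by (simp add: nn_integral_cmult nn_integral_multc mult.assoc)
  also have "\<dots> \<le> (\<integral>\<^sup>+x. (\<integral>\<^sup>+h. ?d v h x * ?B h \<partial>lborel) \<partial>lborel)"
  proof (rule nn_integral_mono)
    fix x :: 'a
    have "(\<integral>\<^sup>+y. ennreal (lam powr p) * indicator Z' y * indicator E x \<partial>lborel)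
      = (\<integral>\<^sup>+h. ennreal (lam powr p) * indicator Z' (h + x) * indicator E x \<partial>lborel)"
      by (rule nn_integral_lborel_translate[symmetric]) measurable
    also have "\<dots> \<le> (\<integral>\<^sup>+h. ?d v h x * ?B h \<partial>lborel)"
    proof (rule nn_integral_mono)
      fix h :: 'a
      show "ennreal (lam powr p) * indicator Z' (h + x) * indicator E x
        \<le> ?d v h x * ?B h"
      proof (cases "h + x \<in> Z' \<and> x \<in> E")
        case True
        then have nx: "norm x \<le> R" "norm (h + x) \<le> R" and u: "u x > 1 - \<theta>" "u (x + h) \<le> 1/2"
          by (auto simp: E_def Z'_def add.commute)
        have "norm h \<le> 2 * R" using norm_triangle_ineq4[of "h + x" x] nx by simp
        moreover have "lam \<le> \<bar>v (x + h) - v x\<bar>"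
        proof -
          have "ln (1 + \<theta> - u x) \<le> ln (2 * \<theta>)" using u \<theta> u01[of x] by (subst ln_le_cancel_iff) auto
          moreover have "ln (1/2 + \<theta>) \<le> ln (1 + \<theta> - u (x + h))" using u \<theta> u01[of "x + h"] by (subst ln_le_cancel_iff) auto
          moreover have "lam = ln (1/2 + \<theta>) - ln (2 * \<theta>)" unfolding lam_def using \<theta> by (simp add: ln_div)
          ultimately show ?thesis unfolding v_def by linarith
        qed
        then have "lam powr p \<le> \<bar>v (x + h) - v x\<bar> powr p" using lam p by (intro powr_mono2) auto
        ultimately show ?thesis using True nx by (simp add: ennreal_leI)
      qed auto
    qed
    finally show "(\<integral>\<^sup>+y. ennreal (lam powr p) * indicator Z' y * indicator E x \<partial>lborel)
      \<le> (\<integral>\<^sup>+h. ?d v h x * ?B h \<partial>lborel)" .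
  qed
  also have "\<dots> = (\<integral>\<^sup>+h. (\<integral>\<^sup>+x. ?d v h x * ?B h \<partial>lborel) \<partial>lborel)"
    by (rule lborel_pair.Fubini') measurable
  also have "\<dots> \<le> (\<integral>\<^sup>+(h::'a). ennreal ((2 * R) powr p * (4 powr p * K)) * ?B h \<partial>lborel)"
  proof (rule nn_integral_mono)
    fix h :: 'a
    show "(\<integral>\<^sup>+x. ?d v h x * ?B h \<partial>lborel)
      \<le> ennreal ((2 * R) powr p * (4 powr p * K)) * ?B h"
      using trans[of h] by (subst nn_integral_multc) (auto simp: indicator_def)
  qed
  also have "\<dots> = ennreal ((2 * R) powr p * (4 powr p * K) * (2 ^ N * V))"
    using R K by (subst nn_integral_cmult_indicator)
      (auto simp: emeasure_cball ennreal_mult[symmetric] power_mult_distrib V_def N_def mult_ac)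
  finally have main: "ennreal (lam powr p) * (emeasure lborel Z' * emeasure lborel E)
     \<le> ennreal ((2 * R) powr p * (4 powr p * K) * (2 ^ N * V))" .
  have "emeasure lborel E \<le> emeasure lborel (cball (0::'a) R)"
    by (rule emeasure_mono) (auto simp: E_def)
  also have "\<dots> < top" by (rule emeasure_cball_finite)
  finally obtain e where e: "e \<ge> 0" "emeasure lborel E = ennreal e" by (cases "emeasure lborel E") auto
  have "ennreal (V / 2) \<le> emeasure lborel Z'" using Z unfolding Z'_def V_def .
  then have "ennreal (lam powr p) * (ennreal (V / 2) * ennreal e) \<le> ennreal (lam powr p) * (emeasure lborel Z' * emeasure lborel E)"
    unfolding e(2) by (intro mult_left_mono mult_right_mono) auto
  also have "ennreal (lam powr p) * (ennreal (V / 2) * ennreal e) = ennreal (lam powr p * (V / 2 * e))"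
    using e V by (simp add: ennreal_mult[symmetric])
  finally have "ennreal (lam powr p * (V / 2 * e)) \<le> ennreal ((2 * R) powr p * (4 powr p * K) * (2 ^ N * V))"
    using main by (rule order_trans)
  then have "lam powr p * (V / 2 * e) \<le> (2 * R) powr p * (4 powr p * K) * (2 ^ N * V)"
    using K V by (subst (asm) ennreal_le_iff) auto
  then have "V * (lam powr p * e) \<le> V * (2 * ((2 * R) powr p * (4 powr p * K) * 2 ^ N))"
    by (simp add: algebra_simps)
  then have "lam powr p * e \<le> 2 * ((2 * R) powr p * (4 powr p * K) * 2 ^ N)" using V by simp
  then have "e \<le> 2 * ((2 * R) powr p * (4 powr p * K) * 2 ^ N) / lam powr p"
    using lam by (simp add: field_simps)
  also have "2 * ((2 * R) powr p * (4 powr p * K) * 2 ^ N) =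
      2 * 2 ^ N * 4 ^ N * 2 * 2 powr p * 4 powr p * (4 powr p * p powr p) * (1 / (p - 1)) powr p * 16 powr p * V"
    using R by (simp add: K_def V_def N_def powr_mult powr_divide power_mult_distrib)
  finally show ?thesis
    unfolding E_def[symmetric] e(2) lam_def V_def N_def by (rule ennreal_leI)
qed

end

section \<open>De Giorgi iteration\<close>

lemma truncation_has_derivative:
  fixes q k :: real
  assumes "q > 1"
  shows "((\<lambda>t. max 0 (t - k) powr q) has_real_derivative q * max 0 (t - k) powr (q - 1)) (at t)"
proof -
  have "((\<lambda>t. t - k) has_real_derivative 1) (at t)" by (auto intro!: derivative_eq_intros)
  from DERIV_chain2[OF pos_part_powr_has_derivative[OF assms] this] show ?thesis by simp
qed

lemma truncation_continuous:
  fixes q k :: real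
  assumes "q > 0"
  shows "continuous_on S (\<lambda>t. max 0 (t - k) powr q)"
  using assms by (intro continuous_on_powr' continuous_intros) auto

context p_solution
begin

text \<open>The factors met in \<open>level_step\<close>: 2^(p+1) from \<open>faber_krahn\<close>,
  4^p from \<open>translation_estimate\<close>, the Caccioppoli constant 2 * 4^p * p^p together with
  2^p for the derivative of the truncation, and 1 for the gradient of the cutoff.\<close>

definition level_const :: real where
  "level_const = 2 powr (p + 1) * (4 powr p * (2 powr p * (2 * (4 powr p * p powr p)) + 1))"

lemma level_const_pos: "level_const > 0"
  unfolding level_const_def by (intro mult_pos_pos add_nonneg_pos) (auto intro!: mult_nonneg_nonneg)

text \<open>The truncation above k, cut off between r and r', is supported in a set of measure at
  most a. \<open>faber_krahn\<close> bounds its p-th power integral through translations of length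
  at most \<open>\<rho>\<close>, and Chebyshev's inequality at the level k' gives the claim. The
  smaller a is, the smaller \<open>\<rho>\<close> may be taken, and with it the factor in front of
  a.\<close>

lemma level_step:
  assumes k: "k < k'" "k < 1" and r: "0 < r" "r < r'" and a: "a \<ge> 0"
    and A: "emeasure lborel ({x. u x > k} \<inter> cball 0 r') \<le> ennreal a"
    and \<rho>: "\<rho> > 0" "2 powr (p + 1) * a \<le> unit_ball_vol (real DIM('a)) * \<rho> ^ DIM('a)"
  shows "emeasure lborel ({x. u x > k'} \<inter> cball 0 r) \<le>
    ennreal (level_const * ((1 - k) / (k' - k)) powr (p + 1) * (\<rho> * (4 * r' / (r' - r)\<^sup>2)) powr p * a)"
proof -
  let ?d = "\<lambda>f h x. ennreal (\<bar>f (x + h) - f x\<bar> powr p) * indicator (cball 0 r') x"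
  let ?I = "\<lambda>f::'a \<Rightarrow> real. \<integral>\<^sup>+x. ennreal (\<bar>f x\<bar> powr p) \<partial>lborel"
  define m where "m = 4 * r' / (r' - r)\<^sup>2"
  have m: "m \<ge> 0" using r by (simp add: m_def)
  obtain \<eta> :: "'a \<Rightarrow> real" and G where \<eta>: "C1 \<eta> G" "\<And>x. \<eta> x \<ge> 0" "\<And>x. r' < norm x \<Longrightarrow> \<eta> x = 0"
    "\<And>x. norm x \<le> r \<Longrightarrow> \<eta> x \<ge> 1" "\<And>x. norm (G x) \<le> m" "\<And>x. r' < norm x \<Longrightarrow> G x = 0"
    using cutoff_exists[OF r] unfolding m_def by blast
  define A where "A = {x. u x > k} \<inter> cball 0 r'"
  define E where "E = {x. u x > k'} \<inter> cball 0 r"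
  have [measurable]: "A \<in> sets borel" "E \<in> sets borel" unfolding A_def E_def by measurable
  note [measurable] = C1_measurable[OF \<eta>(1)]
  define s where "s x = max 0 (u x - k)" for x
  have s: "s x \<ge> 0" "s x \<le> 1 - k" for x using u01[of x] k by (auto simp: s_def)
  have s0: "s x = 0" if "\<not> u x > k" for x using that by (simp add: s_def)
  \<comment> \<open>The exponents are made to match, with s the truncation: \<Phi>^p is s^(p+1), and
    \<Phi>' to the power p is at most a multiple of s. The latter is the weight F' = 2 s that the
    Caccioppoli inequality controls for F = s^2, with Q = s^(p+1). Both gradient terms are thus
    bounded by the same integral \<open>?Y\<close>.\<close>
  define \<Phi> where "\<Phi> = (\<lambda>t. max 0 (t - k) powr (1 + 1 / p))"
  define \<Phi>' where "\<Phi>' = (\<lambda>t. (1 + 1 / p) * max 0 (t - k) powr (1 / p))"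
  have \<Phi>: "(\<Phi> has_real_derivative \<Phi>' t) (at t)" "continuous_on {0..1} \<Phi>'" "continuous_on {0..1} \<Phi>" for t
    unfolding \<Phi>_def \<Phi>'_def using truncation_has_derivative[of "1 + 1 / p" k t] p
    by (auto intro!: continuous_intros truncation_continuous add_pos_pos)
  note [measurable] = compose_measurable[OF \<Phi>(3)] compose_measurable[OF \<Phi>(2)]
  have \<Phi>p: "\<bar>\<Phi> (u x)\<bar> powr p = s x powr (p + 1)" for x
  proof -
    have "(1 + 1 / p) * p = p + 1" using p by (simp add: field_simps)
    then show ?thesis by (simp add: \<Phi>_def s_def powr_powr del: distrib_right_numeral)
  qed
  have \<Phi>'p: "\<bar>\<Phi>' (u x)\<bar> powr p \<le> 2 powr p * (2 * s x)" for x
  proof -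
    have "\<bar>\<Phi>' (u x)\<bar> powr p = (1 + 1 / p) powr p * s x"
      using p s(1)[of x] by (simp add: \<Phi>'_def s_def abs_mult powr_mult powr_powr)
    also have "\<dots> \<le> 2 powr p * (2 * s x)"
      using p s(1)[of x] by (intro mult_mono powr_mono2) auto
    finally show ?thesis .
  qed
  let ?F = "\<lambda>t. max 0 (t - k) powr 2" and ?F' = "\<lambda>t. 2 * max 0 (t - k) powr (2 - 1)" and ?Q = "\<lambda>t. max 0 (t - k) powr (p + 1)"
  have FQ: "?F t powr p \<le> ?Q t * ?F' t powr (p - 1)" for t
  proof -
    define z where "z = max 0 (t - k)"
    have z: "z \<ge> 0" by (simp add: z_def)
    have "(z powr 2) powr p = z powr (2 * p)" by (simp only: powr_powr)
    also have "\<dots> \<le> 2 powr (p - 1) * z powr (2 * p)"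
      using p ge_one_powr_ge_zero[of 2 "p - 1"] mult_right_mono[of 1 "2 powr (p - 1)" "z powr (2 * p)"] by simp
    also have "\<dots> = 2 powr (p - 1) * (z powr (p + 1) * z powr (p - 1))"
      by (simp add: powr_add[symmetric])
    also have "\<dots> = z powr (p + 1) * (2 * z powr (2 - 1)) powr (p - 1)"
      using z by (simp add: powr_mult)
    finally show ?thesis by (simp only: z_def)
  qed
  define y where "y = (1 - k) powr (p + 1) * m powr p * a"
  have y: "y \<ge> 0" using a by (simp add: y_def)
  let ?Y = "\<integral>\<^sup>+x. ennreal (s x powr (p + 1) * norm (G x) powr p) \<partial>lborel"
  have Y: "?Y \<le> ennreal y"
  proof -
    have "?Y \<le> (\<integral>\<^sup>+x. ennreal ((1 - k) powr (p + 1) * m powr p) * indicator A x \<partial>lborel)"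
    proof (rule nn_integral_mono)
      fix x
      show "ennreal (s x powr (p + 1) * norm (G x) powr p) \<le> ennreal ((1 - k) powr (p + 1) * m powr p) * indicator A x"
      proof (cases "x \<in> A")
        case True
        have "s x powr (p + 1) * norm (G x) powr p \<le> (1 - k) powr (p + 1) * m powr p"
          using s[of x] \<eta>(5)[of x] p by (intro mult_mono powr_mono2) auto
        then show ?thesis using True by (simp add: ennreal_leI)
      next
        case False
        then have "s x = 0 \<or> G x = 0" using s0[of x] \<eta>(6)[of x] by (auto simp: A_def)
        then show ?thesis using p by auto
      qed
    qed
    also have "\<dots> = ennreal ((1 - k) powr (p + 1) * m powr p) * emeasure lborel A"
      by (rule nn_integral_cmult_indicator) auto
    also have "\<dots> \<le> ennreal ((1 - k) powr (p + 1) * m powr p) * ennreal a"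
      using A unfolding A_def by (rule mult_left_mono) auto
    also have "\<dots> = ennreal y" using a by (simp add: y_def ennreal_mult)
    finally show ?thesis .
  qed
  define Cc where "Cc = 2 * (4 powr p * p powr p)"
  have Cc: "Cc \<ge> 0" by (simp add: Cc_def)
  let ?X = "\<lambda>x. ?F' (u x) * \<eta> x powr p * norm (g x) powr p"
  have cac: "(\<integral>\<^sup>+x. ennreal (?X x) \<partial>lborel) \<le> ennreal (Cc * y)"
  proof -
    have "(\<integral>\<^sup>+x. ennreal (?X x) \<partial>lborel)
      \<le> ennreal Cc * (\<integral>\<^sup>+x. ennreal (?Q (u x) * norm (G x) powr p) \<partial>lborel)"
      unfolding Cc_def
    proof (rule caccioppoli[OF _ _ _ _ _ _ FQ \<eta>(1,2,3)])
      show "(?F has_real_derivative ?F' t) (at t)" for t by (rule truncation_has_derivative) simp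
      show "continuous_on {0..1} ?F'" "continuous_on {0..1} ?Q"
        using p by (intro continuous_intros truncation_continuous; simp)+
    qed auto
    also have "\<dots> \<le> ennreal Cc * ennreal y"
      using Y by (intro mult_left_mono) (simp_all add: s_def)
    finally show ?thesis using Cc y by (simp add: ennreal_mult)
  qed
  define f where "f x = \<Phi> (u x) * \<eta> x" for x
  have [measurable]: "f \<in> borel_measurable borel" unfolding f_def by measurable
  have fp: "\<bar>f x\<bar> powr p = s x powr (p + 1) * \<eta> x powr p" for x
    using \<eta>(2)[of x] by (simp add: f_def abs_mult powr_mult \<Phi>p)
  define d where "d = \<rho> powr p * (4 powr p * (2 powr p * (Cc * y) + y))"
  have d: "d \<ge> 0" using Cc y by (simp add: d_def)
  obtain M where M: "M > 0" "\<And>x. norm (\<eta> x) \<le> M" using compact_support_bounded[OF C1_D(3)[OF \<eta>(1)] \<eta>(3)] by blast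
  have "?I f \<le> ennreal (2 powr (p + 1) * d)"
  proof (rule faber_krahn[where A=A and R=r' and a=a and \<rho>=\<rho>])
    show "x \<in> A" if "f x \<noteq> 0" for x
    proof -
      have "\<Phi> (u x) \<noteq> 0" "\<eta> x \<noteq> 0" using that by (auto simp: f_def)
      moreover from this have "norm x \<le> r'" using \<eta>(3)[of x] by (meson not_le)
      ultimately show ?thesis by (auto simp: A_def \<Phi>_def max_def split: if_splits)
    qed
    show "emeasure lborel A \<le> ennreal a" unfolding A_def by (rule A)
    show "?I f < \<infinity>"
    proof -
      have "?I f \<le> (\<integral>\<^sup>+x. ennreal ((1 - k) powr (p + 1) * M powr p) * indicator (cball 0 r') (x::'a) \<partial>lborel)"
      proof (rule nn_integral_mono)
        fix x
        show "ennreal (\<bar>f x\<bar> powr p) \<le> ennreal ((1 - k) powr (p + 1) * M powr p) * indicator (cball 0 r') x"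
        proof (cases "norm x \<le> r'")
          case True
          have "s x powr (p + 1) * \<eta> x powr p \<le> (1 - k) powr (p + 1) * M powr p"
            using s[of x] M(2)[of x] \<eta>(2)[of x] p by (intro mult_mono powr_mono2) auto
          then show ?thesis using True by (simp add: fp ennreal_leI)
        qed (use \<eta>(3) in \<open>simp add: f_def\<close>)
      qed
      also have "\<dots> < \<infinity>"
        by (subst nn_integral_cmult_indicator) (auto simp: ennreal_mult_less_top emeasure_cball_finite)
      finally show ?thesis .
    qed
    fix h :: 'a assume h: "norm h \<le> \<rho>"
    let ?L1 = "Lpow p (cball 0 (r' + norm h)) (\<lambda>x. (\<Phi>' (u x) * \<eta> x) *\<^sub>R g x)"
    let ?L2 = "Lpow p (cball 0 (r' + norm h)) (\<lambda>x. \<Phi> (u x) *\<^sub>R G x)"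
    have L1: "?L1 \<le> ennreal (2 powr p * (Cc * y))"
    proof -
      have "?L1 \<le> (\<integral>\<^sup>+x. ennreal (2 powr p) * ennreal (?X x) \<partial>lborel)"
        unfolding Lpow_def
      proof (rule nn_integral_mono)
        fix x
        have "norm ((\<Phi>' (u x) * \<eta> x) *\<^sub>R g x) powr p = \<bar>\<Phi>' (u x)\<bar> powr p * (\<eta> x powr p * norm (g x) powr p)"
          using \<eta>(2)[of x] by (simp add: abs_mult powr_mult mult.assoc)
        also have "\<dots> \<le> (2 powr p * (2 * s x)) * (\<eta> x powr p * norm (g x) powr p)"
          by (rule mult_right_mono[OF \<Phi>'p]) auto
        also have "\<dots> = 2 powr p * (?X x)"
          by (simp add: s_def mult_ac)
        finally have "ennreal (norm ((\<Phi>' (u x) * \<eta> x) *\<^sub>R g x) powr p) \<le> ennreal (2 powr p) * ennreal (?X x)"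
          by (subst ennreal_mult'[symmetric]) (auto intro: ennreal_leI)
        then show "ennreal (norm ((\<Phi>' (u x) * \<eta> x) *\<^sub>R g x) powr p) * indicator (cball 0 (r' + norm h)) x
            \<le> ennreal (2 powr p) * ennreal (?X x)"
          by (auto simp: indicator_def)
      qed
      also have "\<dots> = ennreal (2 powr p) * (\<integral>\<^sup>+x. ennreal (?X x) \<partial>lborel)"
        by (rule nn_integral_cmult) measurable
      also have "\<dots> \<le> ennreal (2 powr p) * ennreal (Cc * y)"
        by (rule mult_left_mono[OF cac]) simp
      finally show ?thesis by (simp add: ennreal_mult')
    qed
    have L2: "?L2 \<le> ennreal y"
    proof -
      have "?L2 \<le> ?Y"
        unfolding Lpow_def by (intro nn_integral_mono) (auto simp: powr_mult \<Phi>p indicator_def)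
      then show ?thesis using Y by (rule order_trans)
    qed
    have "(\<integral>\<^sup>+x. ?d f h x \<partial>lborel)
      \<le> ennreal (norm h powr p) * (ennreal (4 powr p) * (?L1 + ?L2))"
      unfolding f_def by (rule translation_estimate[OF \<Phi>(1,2) \<eta>(1)])
    also have "\<dots> \<le> ennreal (\<rho> powr p) * (ennreal (4 powr p) * (ennreal (2 powr p * (Cc * y)) + ennreal y))"
      using h p by (intro mult_mono add_mono L1 L2 ennreal_leI powr_mono2) auto
    also have "\<dots> = ennreal d"
      using Cc y by (simp add: d_def ennreal_mult[symmetric] ennreal_plus[symmetric] del: ennreal_plus)
    finally show "(\<integral>\<^sup>+x. ?d f h x \<partial>lborel) \<le> ennreal d" .
  qed (use p a \<rho> d in \<open>auto simp: A_def\<close>)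
  moreover have "ennreal ((k' - k) powr (p + 1)) * emeasure lborel E \<le> ?I f"
  proof -
    have "ennreal ((k' - k) powr (p + 1)) * emeasure lborel E = (\<integral>\<^sup>+x. ennreal ((k' - k) powr (p + 1)) * indicator E x \<partial>lborel)"
      by (rule nn_integral_cmult_indicator[symmetric]) auto
    also have "\<dots> \<le> ?I f"
    proof (rule nn_integral_mono)
      fix x
      show "ennreal ((k' - k) powr (p + 1)) * indicator E x \<le> ennreal (\<bar>f x\<bar> powr p)"
      proof (cases "x \<in> E")
        case True
        then have "k' - k \<le> s x" "1 \<le> \<eta> x" using \<eta>(4) by (auto simp: E_def s_def)
        then have "(k' - k) powr (p + 1) * 1 \<le> s x powr (p + 1) * \<eta> x powr p"
          using k p by (intro mult_mono powr_mono2 ge_one_powr_ge_zero) auto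
        then show ?thesis using True by (simp add: fp ennreal_leI)
      qed auto
    qed
    finally show ?thesis .
  qed
  ultimately have *: "ennreal ((k' - k) powr (p + 1)) * emeasure lborel E \<le> ennreal (2 powr (p + 1) * d)"
    by (rule order_trans[rotated])
  have "emeasure lborel E \<le> emeasure lborel (cball (0::'a) r)"
    by (rule emeasure_mono) (auto simp: E_def)
  also have "\<dots> < top" by (rule emeasure_cball_finite)
  finally obtain e where e: "e \<ge> 0" "emeasure lborel E = ennreal e" by (cases "emeasure lborel E") auto
  have kk: "(k' - k) powr (p + 1) > 0" using k by simp
  have "(k' - k) powr (p + 1) * e \<le> 2 powr (p + 1) * d"
    using * e d by (simp add: ennreal_mult[symmetric])
  then have "e \<le> 2 powr (p + 1) * d / (k' - k) powr (p + 1)"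
    using kk by (simp add: field_simps)
  also have "\<dots> = level_const * ((1 - k) / (k' - k)) powr (p + 1) * (\<rho> * m) powr p * a"
    using k \<rho>(1) m by (simp add: level_const_def d_def y_def Cc_def powr_divide powr_mult algebra_simps add_divide_distrib)
  finally show ?thesis
    unfolding E_def[symmetric] e(2) m_def by (rule ennreal_leI)
qed

text \<open>In place of the customary superlinear recursion, the induction proves an explicit
  geometric bound \<open>a j\<close>. The step is linear in \<open>a j\<close>, but its factor
  contains \<open>\<rho> j powr p\<close>, and \<open>\<rho> j\<close> is proportional to the N-th
  root of \<open>a j\<close>; its geometric decay outweighs the growth caused by the shrinking gaps
  between levels and radii.\<close>

lemma de_giorgi:
  obtains \<tau> where "\<tau> > 0" "\<And>R \<theta>. R > 0 \<Longrightarrow> 0 < \<theta> \<Longrightarrow>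
     emeasure lborel ({x. u x > 1 - 2 * \<theta>} \<inter> cball 0 (2 * R)) \<le> ennreal (unit_ball_vol (real DIM('a)) * (\<tau> * R) ^ DIM('a) / 2 powr (p + 1)) \<Longrightarrow>
     emeasure lborel ({x. u x > 1 - \<theta>} \<inter> cball 0 R) = 0"
proof -
  let ?E = "\<lambda>k R. emeasure lborel ({x. u x > k} \<inter> cball 0 R)"
  define N where "N = DIM('a)"
  define \<omega> where "\<omega> = unit_ball_vol (real DIM('a))"
  have \<omega>: "\<omega> > 0" by (simp add: \<omega>_def)
  (* \<mu> cancels the factors growing with j in level_step, \<tau> absorbs the remaining constant. *)
  define \<mu> :: real where "\<mu> = 2 powr (- (3 * p + 1) / p)"
  have \<mu>: "\<mu> > 0" "\<mu> < 1"
    using p powr_less_mono[of "- (3 * p + 1) / p" 0 2] by (auto simp: \<mu>_def divide_neg_pos)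
  define C' where "C' = level_const * 4 powr (p + 1) * 32 powr p"
  have C': "C' > 0" using level_const_pos by (simp add: C'_def)
  define \<tau> where "\<tau> = (\<mu> ^ N / C') powr (1 / p)"
  have \<tau>: "\<tau> > 0" "C' * \<tau> powr p = \<mu> ^ N"
    using \<mu> C' p by (auto simp: \<tau>_def powr_powr)
  have "?E (1 - \<theta>) R = 0"
    if R: "R > 0" and \<theta>: "0 < \<theta>"
      and base: "?E (1 - 2 * \<theta>) (2 * R) \<le> ennreal (\<omega> * (\<tau> * R) ^ N / 2 powr (p + 1))"
    for R \<theta>
  proof -
    define \<rho> where "\<rho> j = \<tau> * R * \<mu> ^ j" for j
    \<comment> \<open>This makes the volume condition of \<open>level_step\<close> an equality. The
      levels rise from 1 - 2 \<theta> towards 1 - \<theta> while the radii fall from 2 R towards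
      R.\<close>
    define a where "a j = \<omega> * \<rho> j ^ N / 2 powr (p + 1)" for j
    define k where "k j = 1 - \<theta> - \<theta> / 2 ^ j" for j :: nat
    define r where "r j = R * (1 + 1 / 2 ^ j)" for j :: nat
    have \<rho>: "\<rho> j > 0" for j using \<tau> R \<mu> by (simp add: \<rho>_def)
    have a0: "a j \<ge> 0" for j using \<omega> \<rho>[of j] by (simp add: a_def)
    have claim: "?E (k j) (r j) \<le> ennreal (a j)" for j
    proof (induction j)
      case 0
      then show ?case using base by (simp add: k_def r_def a_def \<rho>_def mult.commute)
    next
      case (Suc j)
      let ?q = "(1 - k j) / (k (Suc j) - k j)" and ?w = "\<rho> j * (4 * r j / (r j - r (Suc j))\<^sup>2)"
      have kk: "k (Suc j) - k j = \<theta> / (2 * 2 ^ j)" by (simp add: k_def field_simps)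
      have rr: "r j - r (Suc j) = R / (2 * 2 ^ j)" by (simp add: r_def field_simps)
      have "?E (k (Suc j)) (r (Suc j)) \<le>
        ennreal (level_const * (?q) powr (p + 1) * (?w) powr p * a j)"
      proof (rule level_step[OF _ _ _ _ a0 Suc.IH \<rho>])
        have "\<theta> / (2 * 2 ^ j) > 0" "R / (2 * 2 ^ j) > 0" using \<theta> R by auto
        then show "k j < k (Suc j)" "r (Suc j) < r j" using kk rr by linarith+
        have "\<theta> / 2 ^ j > 0" using \<theta> by simp
        then show "k j < 1" using \<theta> unfolding k_def by linarith
        show "0 < r (Suc j)" using R by (simp add: r_def add_pos_pos)
        show "2 powr (p + 1) * a j \<le> unit_ball_vol (real DIM('a)) * \<rho> j ^ DIM('a)"
          by (simp add: a_def \<omega>_def N_def)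
      qed
      also have "\<dots> \<le> ennreal (a (Suc j))"
      proof (rule ennreal_leI)
        have p2: "(1::real) / 2 ^ j \<le> 1" by simp
        \<comment> \<open>\<theta> cancels in this ratio and R in the next one, which is why
          \<open>\<tau>\<close> can be chosen before either of them.\<close>
        have 1: "?q \<le> 4 * 2 ^ j"
        proof -
          have "\<theta> / 2 ^ j \<le> \<theta>" using p2 mult_left_mono[OF p2, of \<theta>] \<theta> by simp
          then have "1 - k j \<le> 2 * \<theta>" by (simp add: k_def)
          then have "?q \<le> 2 * \<theta> / (\<theta> / (2 * 2 ^ j))"
            unfolding kk using \<theta> by (intro divide_right_mono) auto
          then show ?thesis using \<theta> by simp
        qed
        have 2: "?w \<le> \<tau> * \<mu> ^ j * (32 * 4 ^ j)"
        proof -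
          have four: "(2 ^ j)\<^sup>2 = (4::real) ^ j" by (simp add: power2_eq_square power_mult_distrib[symmetric])
          have "R / 2 ^ j \<le> R" using p2 mult_left_mono[OF p2, of R] R by simp
          then have "r j \<le> 2 * R" by (simp add: r_def algebra_simps)
          then have "4 * r j / (r j - r (Suc j))\<^sup>2 \<le> 4 * (2 * R) / (R / (2 * 2 ^ j))\<^sup>2"
            unfolding rr by (intro divide_right_mono) auto
          also have "\<dots> = 32 * 4 ^ j / R"
            using R by (simp add: power_divide power_mult_distrib four) (simp add: power2_eq_square field_simps)
          finally have "?w \<le> \<rho> j * (32 * 4 ^ j / R)"
            using \<rho>[of j] by (intro mult_left_mono) auto
          also have "\<dots> = \<tau> * \<mu> ^ j * (32 * 4 ^ j)" using R by (simp add: \<rho>_def)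
          finally show ?thesis .
        qed
        have cancel: "(2 ^ j) powr (p + 1) * ((\<mu> ^ j) powr p * (4 ^ j) powr p) = 1"
        proof -
          have "(2::real) ^ j = 2 powr real j" "(4::real) ^ j = 2 powr (2 * real j)" "\<mu> ^ j = 2 powr (- (3 * p + 1) / p * real j)"
            using powr_realpow[of 2 j] powr_realpow[of 4 j] powr_realpow[OF \<mu>(1), of j] powr_powr[of 2 2 "real j"]
            by (simp_all add: \<mu>_def powr_powr)
          then have "(2 ^ j) powr (p + 1) * ((\<mu> ^ j) powr p * (4 ^ j) powr p) =
            2 powr (real j * (p + 1) + (- (3 * p + 1) / p * real j * p + 2 * real j * p))"
            by (simp only: powr_powr powr_add[symmetric])
          also have "real j * (p + 1) + (- (3 * p + 1) / p * real j * p + 2 * real j * p) = 0"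
            using p by (simp add: field_simps)
          finally show ?thesis by simp
        qed
        have "level_const * (?q) powr (p + 1) * (?w) powr p * a j
          \<le> level_const * (4 * 2 ^ j) powr (p + 1) * (\<tau> * \<mu> ^ j * (32 * 4 ^ j)) powr p * a j"
        proof -
          have "0 \<le> ?q" unfolding kk using \<theta> by (simp add: k_def)
          then have 3: "(?q) powr (p + 1) \<le> (4 * 2 ^ j) powr (p + 1)"
            using p by (intro powr_mono2 1) auto
          have "0 \<le> ?w"
            using \<rho>[of j] R by (simp add: r_def)
          then have 4: "(?w) powr p \<le> (\<tau> * \<mu> ^ j * (32 * 4 ^ j)) powr p"
            using p by (intro powr_mono2 2) auto
          show ?thesis
            by (rule mult_right_mono[OF mult_mono[OF mult_left_mono[OF 3] 4] a0])
              (use level_const_pos in auto)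
        qed
        also have "\<dots> = C' * \<tau> powr p * ((2 ^ j) powr (p + 1) * ((\<mu> ^ j) powr p * (4 ^ j) powr p)) * a j"
          using \<tau> \<mu> by (simp add: C'_def powr_mult mult_ac)
        also have "\<dots> = \<mu> ^ N * a j" unfolding cancel \<tau>(2) by simp
        also have "\<dots> = a (Suc j)" by (simp add: a_def \<rho>_def power_mult_distrib mult_ac)
        finally show "level_const * (?q) powr (p + 1) * (?w) powr p * a j \<le> a (Suc j)" .
      qed
      finally show ?case .
    qed
    have le: "?E (1 - \<theta>) R \<le> ennreal (a j)" for j
    proof -
      have "?E (1 - \<theta>) R \<le> ?E (k j) (r j)"
      proof (rule emeasure_mono)
        have "k j \<le> 1 - \<theta>" "R \<le> r j" using \<theta> R by (auto simp: k_def r_def)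
        then show "{x. u x > 1 - \<theta>} \<inter> cball 0 R \<subseteq> {x. u x > k j} \<inter> cball 0 (r j)" by auto
      qed measurable
      then show ?thesis using claim order_trans by blast
    qed
    have "(\<lambda>j. \<mu> ^ j) \<longlonglongrightarrow> 0" using \<mu> by (intro LIMSEQ_power_zero) auto
    then have "(\<lambda>j. \<omega> * (\<tau> * R * \<mu> ^ j) ^ N / 2 powr (p + 1)) \<longlonglongrightarrow> \<omega> * (\<tau> * R * 0) ^ N / 2 powr (p + 1)"
      by (intro tendsto_intros) (use \<mu> in auto)
    moreover have "a = (\<lambda>j. \<omega> * (\<tau> * R * \<mu> ^ j) ^ N / 2 powr (p + 1))"
      by (simp add: fun_eq_iff a_def \<rho>_def)
    moreover have "\<omega> * (\<tau> * R * 0) ^ N / 2 powr (p + 1) = 0"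
      by (simp add: N_def zero_power)
    ultimately have "a \<longlonglongrightarrow> 0" by (simp only:)
    then have "(\<lambda>j. ennreal (a j)) \<longlonglongrightarrow> ennreal 0" by (rule tendsto_ennrealI)
    then have "?E (1 - \<theta>) R \<le> ennreal 0"
      by (rule LIMSEQ_le_const) (use le in auto)
    then show ?thesis by simp
  qed
  then show ?thesis using that[OF \<tau>(1)] unfolding \<omega>_def N_def by blast
qed

text \<open>The logarithmic estimate at the level 1 - 2 \<theta> on the ball of radius 2 R must fall
  below the threshold of \<open>de_giorgi\<close>. Both quantities scale like R^N, so the choice of
  \<theta> does not involve R.\<close>

lemma sup_decay:
  obtains \<theta> where "\<theta> > 0" "\<And>R. R > 0 \<Longrightarrow>
     ennreal (unit_ball_vol (real DIM('a)) * (2 * R) ^ DIM('a) / 2) \<le> emeasure lborel ({x. u x \<le> 1/2} \<inter> cball 0 (2 * R)) \<Longrightarrow>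
     emeasure lborel ({x. u x > 1 - \<theta>} \<inter> cball 0 R) = 0"
proof -
  obtain \<tau> where \<tau>: "\<tau> > 0" "\<And>R \<theta>. R > 0 \<Longrightarrow> 0 < \<theta> \<Longrightarrow>
     emeasure lborel ({x. u x > 1 - 2 * \<theta>} \<inter> cball 0 (2 * R)) \<le> ennreal (unit_ball_vol (real DIM('a)) * (\<tau> * R) ^ DIM('a) / 2 powr (p + 1)) \<Longrightarrow>
     emeasure lborel ({x. u x > 1 - \<theta>} \<inter> cball 0 R) = 0"
    using de_giorgi by blast
  define N where "N = DIM('a)"
  define \<omega> where "\<omega> = unit_ball_vol (real DIM('a))"
  have \<omega>: "\<omega> > 0" by (simp add: \<omega>_def)
  define C where "C = 2 * 2 ^ N * 4 ^ N * 2 * 2 powr p * 4 powr p * (4 powr p * p powr p) * (1 / (p - 1)) powr p * 16 powr p"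
  have C: "C > 0" using p by (simp add: C_def)
  \<comment> \<open>The size of the logarithm at which the bound C \<omega> (2 R)^N / L^p equals the
    threshold of \<open>de_giorgi\<close>.\<close>
  define L where "L = (C * 2 ^ N * 2 powr (p + 1) / \<tau> ^ N) powr (1 / p)"
  have L: "L > 0" "L powr p = C * 2 ^ N * 2 powr (p + 1) / \<tau> ^ N"
    using C \<tau> p by (auto simp: L_def powr_powr)
  \<comment> \<open>Then exp L * 4 \<theta> = 1/2, so the ratio (1/2 + 2 \<theta>) / (4 \<theta>)
    inside the logarithm is at least exp L. Positivity of L also gives 2 \<theta> < 1/2.\<close>
  define \<theta> where "\<theta> = exp (- L) / 8"
  have \<theta>: "\<theta> > 0" "2 * \<theta> < 1 / 2"
  proof -
    have "exp (- L) < 1" using L by simp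
    then have "2 * (exp (- L) / 8) < 1 / 2" by linarith
    then show "\<theta> > 0" "2 * \<theta> < 1 / 2" by (auto simp: \<theta>_def)
  qed
  have "emeasure lborel ({x. u x > 1 - \<theta>} \<inter> cball 0 R) = 0"
    if R: "R > 0" and half: "ennreal (\<omega> * (2 * R) ^ N / 2) \<le> emeasure lborel ({x. u x \<le> 1/2} \<inter> cball 0 (2 * R))" for R
  proof (rule \<tau>(2)[OF R \<theta>(1)])
    define l where "l = ln ((1/2 + 2 * \<theta>) / (2 * (2 * \<theta>)))"
    have "exp L \<le> (1/2 + 2 * \<theta>) / (2 * (2 * \<theta>))"
    proof -
      have "exp L * (2 * (2 * \<theta>)) = 1 / 2" by (simp add: \<theta>_def exp_minus field_simps)
      also have "\<dots> \<le> 1/2 + 2 * \<theta>" using \<theta> by simp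
      finally show ?thesis using \<theta> by (simp add: le_divide_eq)
    qed
    then have "L \<le> l" unfolding l_def using \<theta> by (subst ln_ge_iff) (auto intro!: divide_pos_pos)
    then have "L powr p \<le> l powr p" using L p by (intro powr_mono2) auto
    then have "C * (\<omega> * (2 * R) ^ N) / l powr p \<le> C * (\<omega> * (2 * R) ^ N) / L powr p"
      using C \<omega> R L(1) p by (intro divide_left_mono) (auto intro!: mult_pos_pos powr_gt_zero[THEN iffD2] dest: order_less_le_trans)
    also have "\<dots> = \<omega> * (\<tau> * R) ^ N / 2 powr (p + 1)"
      unfolding L(2) using C \<tau> by (simp add: power_mult_distrib)
    finally have le: "C * (\<omega> * (2 * R) ^ N) / l powr p \<le> \<omega> * (\<tau> * R) ^ N / 2 powr (p + 1)" .
    have "emeasure lborel ({x. u x > 1 - 2 * \<theta>} \<inter> cball 0 (2 * R)) \<le> ennreal (C * (\<omega> * (2 * R) ^ N) / l powr p)"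
      unfolding C_def \<omega>_def N_def l_def
      by (rule log_estimate) (use R \<theta> half in \<open>auto simp: \<omega>_def N_def\<close>)
    also have "\<dots> \<le> ennreal (\<omega> * (\<tau> * R) ^ N / 2 powr (p + 1))"
      using le by (rule ennreal_leI)
    finally show "emeasure lborel ({x. u x > 1 - 2 * \<theta>} \<inter> cball 0 (2 * R)) \<le> ennreal (unit_ball_vol (real DIM('a)) * (\<tau> * R) ^ DIM('a) / 2 powr (p + 1))"
      unfolding \<omega>_def N_def .
  qed
  then show ?thesis using that[OF \<theta>(1)] unfolding \<omega>_def N_def by blast
qed

end

section \<open>Liouville theorem\<close>

lemma C1_cmult_add:
  assumes "C1 f G"
  shows "C1 (\<lambda>x. c * f x + b) (\<lambda>x. c *\<^sub>R G x)"
proof -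
  have "C1 (\<lambda>x. c * f x + b) (\<lambda>x. (\<lambda>_. c) (f x) *\<^sub>R G x)"
    by (rule C1_compose[OF assms, of UNIV]) (auto intro!: derivative_eq_intros)
  then show ?thesis by simp
qed

text \<open>The flux is odd in the gradient, so the equation survives the reflection. This turns the
  one-sided \<open>sup_decay\<close> into a bound from below.\<close>

lemma p_solution_reflect:
  assumes "p_solution p u g"
  shows "p_solution p (\<lambda>x. 1 - u x) (\<lambda>x. - g x)"
proof -
  interpret p_solution p u g by (rule assms)
  show ?thesis
  proof
    show "p > 1" by (rule p)
    show "(\<lambda>x. 1 - u x) \<in> borel_measurable borel" by measurable
    show "1 - u x \<in> {0..1}" for x using u01[of x] by auto
    show "locLp p (\<lambda>x. - g x)" using g by (auto simp: locLp_def Lpow_def)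
    show "(\<integral>x. (norm (- g x) powr (p - 2) *\<^sub>R - g x) \<bullet> G x \<partial>lborel) = 0"
      if "C1 \<phi> G" "\<And>x. R < norm x \<Longrightarrow> \<phi> x = 0" for \<phi> G R
      using weak_eq[OF that] by simp
    fix R
    obtain U V where U: "\<And>n. C1 (U n) (V n)" "\<And>n x. U n x \<in> {0..1}"
      "AE x in lborel. x \<in> cball 0 R \<longrightarrow> (\<lambda>n. U n x) \<longlonglongrightarrow> u x"
      "(\<lambda>n. Lpow p (cball 0 R) (\<lambda>x. V n x - g x)) \<longlonglongrightarrow> 0"
      using approx[of R] by blast
    have "C1 (\<lambda>x. 1 - U n x) (\<lambda>x. - V n x)" for n
      using C1_cmult_add[OF U(1)[of n], of "-1" 1] by simp
    moreover have "1 - U n x \<in> {0..1}" for n x using U(2)[of n x] by auto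
    moreover have "AE x in lborel. x \<in> cball 0 R \<longrightarrow> (\<lambda>n. 1 - U n x) \<longlonglongrightarrow> 1 - u x"
      using U(3) by eventually_elim (auto intro!: tendsto_intros)
    moreover have "(\<lambda>n. Lpow p (cball 0 R) (\<lambda>x. - V n x - - g x)) \<longlonglongrightarrow> 0"
      using U(4) by (simp add: Lpow_def norm_minus_commute)
    ultimately show "\<exists>U V. (\<forall>n. C1 (U n) (V n)) \<and> (\<forall>n x. U n x \<in> {0..1}) \<and>
        (AE x in lborel. x \<in> cball 0 R \<longrightarrow> (\<lambda>n. U n x) \<longlonglongrightarrow> 1 - u x) \<and>
        (\<lambda>n. Lpow p (cball 0 R) (\<lambda>x. V n x - - g x)) \<longlonglongrightarrow> 0"
      by (intro exI[of _ "\<lambda>n x. 1 - U n x"] exI[of _ "\<lambda>n x. - V n x"]) simp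
  qed
qed

text \<open>Arbitrarily large radii suffice because balls are nested; the dichotomy below may change
  sides from one scale to the next.\<close>

lemma AE_of_null_balls:
  fixes P :: "'a::euclidean_space \<Rightarrow> bool"
  assumes [measurable]: "{x. \<not> P x} \<in> sets borel"
    and "\<And>n::nat. \<exists>m\<ge>n. emeasure lborel ({x. \<not> P x} \<inter> cball 0 (real (Suc m))) = 0"
  shows "AE x in lborel. P x"
proof -
  have "AE x in lborel. x \<notin> {x. \<not> P x} \<inter> cball 0 (real n)" for n
  proof -
    obtain m where m: "m \<ge> n" "emeasure lborel ({x. \<not> P x} \<inter> cball 0 (real (Suc m))) = 0"
      using assms(2) by blast
    have "emeasure lborel ({x. \<not> P x} \<inter> cball 0 (real n)) \<le> emeasure lborel ({x. \<not> P x} \<inter> cball 0 (real (Suc m)))"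
      using m(1) by (intro emeasure_mono) auto
    then have "{x. \<not> P x} \<inter> cball 0 (real n) \<in> null_sets lborel"
      using m(2) by (intro null_setsI) auto
    then show ?thesis by (rule AE_not_in)
  qed
  then have "AE x in lborel. \<forall>n. x \<notin> {x. \<not> P x} \<inter> cball 0 (real n)"
    unfolding AE_all_countable by blast
  then show ?thesis
  proof eventually_elim
    fix x assume "\<forall>n. x \<notin> {x. \<not> P x} \<inter> cball 0 (real n)"
    then show "P x" using real_arch_simple[of "norm x"] by auto
  qed
qed

text \<open>Either the set where u is at most 1/2 has enough measure at arbitrarily large scales, or
  from some scale on it never does and the reflected set always does. In both cases one constant,
  independent of the scale, holds on balls exhausting the space.\<close>

lemma p_solution_oscillation_decay:
  fixes u :: "'a::euclidean_space \<Rightarrow> real"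
  assumes "p_solution p u g"
  shows "\<exists>\<theta>>0. (AE x in lborel. u x \<le> 1 - \<theta>) \<or> (AE x in lborel. u x \<ge> \<theta>)"
proof -
  interpret u: p_solution p u g by (rule assms)
  interpret w: p_solution p "\<lambda>x. 1 - u x" "\<lambda>x. - g x" by (rule p_solution_reflect[OF assms])
  let ?h = "\<lambda>R. ennreal (unit_ball_vol (real DIM('a)) * (2 * R) ^ DIM('a) / 2)"
  obtain \<theta>1 where 1: "\<theta>1 > 0" "\<And>R. R > 0 \<Longrightarrow> ?h R \<le> emeasure lborel ({x. u x \<le> 1/2} \<inter> cball 0 (2 * R)) \<Longrightarrow>
     emeasure lborel ({x. u x > 1 - \<theta>1} \<inter> cball 0 R) = 0"
    using u.sup_decay by blast
  obtain \<theta>2 where 2: "\<theta>2 > 0" "\<And>R. R > 0 \<Longrightarrow> ?h R \<le> emeasure lborel ({x. 1 - u x \<le> 1/2} \<inter> cball 0 (2 * R)) \<Longrightarrow>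
     emeasure lborel ({x. 1 - u x > 1 - \<theta>2} \<inter> cball 0 R) = 0"
    using w.sup_decay by blast
  have u_meas [measurable]: "u \<in> borel_measurable borel" by (rule u.u_meas)
  \<comment> \<open>The two sets cover the ball, so they cannot both have less than half of its
    volume.\<close>
  have alt: "?h R \<le> emeasure lborel ({x. u x \<le> 1/2} \<inter> cball 0 (2 * R)) \<or> ?h R \<le> emeasure lborel ({x. 1 - u x \<le> 1/2} \<inter> cball 0 (2 * R))"
    if "R > 0" for R
  proof (rule ccontr)
    let ?A = "{x. u x \<le> 1/2} \<inter> cball 0 (2 * R)" and ?B = "{x. 1 - u x \<le> 1/2} \<inter> cball 0 (2 * R)"
    assume "\<not> ?thesis"
    then have "emeasure lborel ?A + emeasure lborel ?B < ?h R + ?h R"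
      by (intro add_strict_mono) (auto simp: not_le)
    also have "\<dots> = emeasure lborel (cball (0::'a) (2 * R))"
      using that by (simp add: emeasure_cball ennreal_plus[symmetric] del: ennreal_plus)
    also have "\<dots> \<le> emeasure lborel (?A \<union> ?B)"
      by (rule emeasure_mono) auto
    also have "\<dots> \<le> emeasure lborel ?A + emeasure lborel ?B"
      by (rule emeasure_subadditive) auto
    finally show False by simp
  qed
  let ?P = "\<lambda>n. ?h (real (Suc n)) \<le> emeasure lborel ({x. u x \<le> 1/2} \<inter> cball 0 (2 * real (Suc n)))"
  show ?thesis
  proof (cases "\<forall>n. \<exists>m\<ge>n. ?P m")
    case True
    have "AE x in lborel. u x \<le> 1 - \<theta>1"
    proof (rule AE_of_null_balls)
      fix n
      obtain m where "m \<ge> n" "?P m" using True by blast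
      then show "\<exists>m\<ge>n. emeasure lborel ({x. \<not> u x \<le> 1 - \<theta>1} \<inter> cball 0 (real (Suc m))) = 0"
        using 1(2)[of "real (Suc m)"] by (auto simp: not_le)
    qed measurable
    then show ?thesis using 1(1) by blast
  next
    case False
    then obtain n0 where n0: "\<And>m. m \<ge> n0 \<Longrightarrow> \<not> ?P m" by blast
    have "AE x in lborel. u x \<ge> \<theta>2"
    proof (rule AE_of_null_balls)
      fix n
      define m where "m = max n n0"
      have "?h (real (Suc m)) \<le> emeasure lborel ({x. 1 - u x \<le> 1/2} \<inter> cball 0 (2 * real (Suc m)))"
        using alt[of "real (Suc m)"] n0[of m] by (auto simp: m_def)
      then have "emeasure lborel ({x. 1 - u x > 1 - \<theta>2} \<inter> cball 0 (real (Suc m))) = 0"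
        by (intro 2(2)) auto
      then show "\<exists>m\<ge>n. emeasure lborel ({x. \<not> \<theta>2 \<le> u x} \<inter> cball 0 (real (Suc m))) = 0"
        by (intro exI[of _ m]) (auto simp: m_def not_le)
    qed measurable
    then show ?thesis using 2(1) by blast
  qed
qed

section \<open>Reduction of a bounded p-harmonic function to the normalised setting\<close>

lemma C1_test_equation:
  fixes A :: "'a::euclidean_space \<Rightarrow> 'a"
  assumes A: "locint A"
    and eq: "\<And>\<phi>. \<phi> \<in> C_c_infinity UNIV \<Longrightarrow> (\<integral>x. A x \<bullet> gradient \<phi> x \<partial>lborel) = 0"
    and \<phi>: "C1 \<phi> G" "\<And>x. R < norm x \<Longrightarrow> \<phi> x = 0"
  shows "(\<integral>x. A x \<bullet> G x \<partial>lborel) = 0"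
proof -
  note [measurable] = locint_measurable[OF A] C1_measurable[OF \<phi>(1)]
  have G0: "\<And>x. R < norm x \<Longrightarrow> G x = 0" using C1_gradient_eq_0[OF \<phi>] by blast
  define I where "I = (\<integral>x. norm (indicator (cball 0 (R + 1)) x *\<^sub>R A x) \<partial>lborel)"
  have I: "I \<ge> 0" by (simp add: I_def)
  have iI: "integrable lborel (\<lambda>x. norm (indicator (cball 0 (R + 1)) x *\<^sub>R A x))"
    using A by (intro integrable_norm) (auto simp: locint_def set_integrable_def)
  \<comment> \<open>The equation is given for smooth test functions, while the Caccioppoli argument
    tests with C^1 ones. Mollifying \<phi> changes its gradient uniformly by at most e and spreads
    its support by at most 1, so the equation fails by at most e * I.\<close>
  have small: "\<bar>\<integral>x. A x \<bullet> G x \<partial>lborel\<bar> \<le> e * I" if e: "e > 0" for e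
  proof -
    obtain d where d: "d > 0" "d \<le> 1" "\<And>x y. dist x y < d \<Longrightarrow> norm (G x - G y) < e"
      using compact_support_uniformly_continuous[OF C1_D(2)[OF \<phi>(1)] G0 e] by metis
    obtain n where n: "inverse (real (Suc n)) < d" using reals_Archimedean[OF d(1)] by blast
    let ?m = "moll n :: 'a \<Rightarrow> real"
    let ?\<psi> = "convol \<phi> ?m"
    have li\<phi>: "locint \<phi>" by (rule locint_continuous[OF C1_D(3)[OF \<phi>(1)]])
    have lim: "locint ?m" by (rule locint_continuous[OF moll_continuous])
    \<comment> \<open>Each order of convolution has its use: smoothing \<phi> by the kernel gives a
      test function, while letting the derivative fall on \<phi> identifies the gradient as the
      mollified \<open>G\<close>.\<close>
    have comm: "?\<psi> = convol ?m \<phi>"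
      unfolding fun_eq_iff convol_commute[of \<phi> ?m, OF C1_measurable(1)[OF \<phi>(1)] moll_measurable]
      by (simp add: convol_def mult.commute)
    have C: "C1 ?\<psi> (convol ?m G)" unfolding comm by (rule convol_C1[OF lim \<phi>])
    have int: "integrable lborel (\<lambda>y. ?m y *\<^sub>R G (x - y))" for x
      by (rule convol_integrable'[OF lim C1_D(2)[OF \<phi>(1)] G0])
    have close: "norm (convol ?m G x - G x) \<le> e" for x
    proof -
      have ic: "integrable lborel (\<lambda>y. ?m y *\<^sub>R G x)" by (intro integrable_scaleR_left moll_props)
      have "G x = (\<integral>y. ?m y *\<^sub>R G x \<partial>lborel)"
        by (subst integral_scaleR_left[OF moll_props(3)]) (simp only: moll_props(4) scaleR_one)
      then have "convol ?m G x - G x = (\<integral>y. ?m y *\<^sub>R G (x - y) \<partial>lborel) - (\<integral>y. ?m y *\<^sub>R G x \<partial>lborel)"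
        by (subst convol_commute) auto
      also have "\<dots> = (\<integral>y. ?m y *\<^sub>R (G (x - y) - G x) \<partial>lborel)"
        using Bochner_Integration.integral_diff[OF int[of x] ic] by (simp add: scaleR_diff_right)
      also have "norm \<dots> \<le> (\<integral>y. e * ?m y \<partial>lborel)"
      proof (rule Bochner_Integration.integral_norm_bound_integral)
        show "integrable lborel (\<lambda>y. ?m y *\<^sub>R (G (x - y) - G x))"
          using Bochner_Integration.integrable_diff[OF int[of x] ic] by (simp add: scaleR_diff_right)
        show "integrable lborel (\<lambda>y. e * ?m y)" by (intro integrable_mult_right moll_props)
        fix y :: 'a
        show "norm (?m y *\<^sub>R (G (x - y) - G x)) \<le> e * ?m y"
        proof (cases "norm y \<le> inverse (real (Suc n))")
          case True
          then have "norm (G (x - y) - G x) \<le> e" using d(3)[of "x - y" x] n by (simp add: dist_norm)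
          from mult_right_mono[OF this moll_props(1)[of n y]] show ?thesis
            by (simp add: moll_props(1) mult.commute)
        qed (simp add: moll_props(2))
      qed
      also have "\<dots> = e" using moll_props(4)[where 'a='a] by simp
      finally show ?thesis .
    qed
    have in1: "inverse (real (Suc n)) \<le> 1" using n d by simp
    have supp: "convol ?m h x = 0" if h0: "\<And>x. R < norm x \<Longrightarrow> h x = 0" and x: "R + 1 < norm x" for x and h :: "'a \<Rightarrow> 'b::euclidean_space"
    proof -
      have "?m (x - y) *\<^sub>R h y = 0" for y
      proof (cases "norm y > R")
        case False
        then have "inverse (real (Suc n)) < norm (x - y)" using norm_triangle_ineq2[of x y] x in1 by simp
        then show ?thesis by (simp add: moll_props(2))
      qed (simp add: h0)
      then show ?thesis unfolding convol_def by (simp only: Bochner_Integration.integral_zero)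
    qed
    have "?\<psi> \<in> C_c_infinity UNIV"
      by (rule C_c_infinityI[where K="cball 0 (R + 1)"])
         (use convol_C_k[OF li\<phi> moll_props(5)] supp[of \<phi>] \<phi>(2) in \<open>auto simp: comm[symmetric]\<close>)
    from eq[OF this] have z: "(\<integral>x. A x \<bullet> convol ?m G x \<partial>lborel) = 0"
      by (simp add: gradient_eqI[OF C1_D(1)[OF C]])
    obtain B where B: "\<And>x. norm (G x) \<le> B" using compact_support_bounded[OF C1_D(2)[OF \<phi>(1)] G0] by blast
    have G1: "\<And>x. R + 1 < norm x \<Longrightarrow> convol ?m G x = 0" using supp[of G] G0 by blast
    obtain B' where B': "\<And>x. norm (convol ?m G x) \<le> B'" using compact_support_bounded[OF C1_D(2)[OF C] G1] by blast
    have iG: "integrable lborel (\<lambda>x. A x \<bullet> G x)"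
      by (rule locint_inner_integrable[OF A _ B G0]) auto
    have iG': "integrable lborel (\<lambda>x. A x \<bullet> convol ?m G x)"
      by (rule locint_inner_integrable[OF A C1_measurable(2)[OF C] B' G1])
    have "(\<integral>x. A x \<bullet> G x \<partial>lborel) = (\<integral>x. A x \<bullet> G x - A x \<bullet> convol ?m G x \<partial>lborel)"
      using iG iG' z by simp
    also have "norm \<dots> \<le> (\<integral>x. e * norm (indicator (cball 0 (R + 1)) x *\<^sub>R A x) \<partial>lborel)"
    proof (rule Bochner_Integration.integral_norm_bound_integral)
      show "integrable lborel (\<lambda>x. A x \<bullet> G x - A x \<bullet> convol ?m G x)" using iG iG' by auto
      show "integrable lborel (\<lambda>x. e * norm (indicator (cball 0 (R + 1)) x *\<^sub>R A x))" using iI by auto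
      fix x
      show "norm (A x \<bullet> G x - A x \<bullet> convol ?m G x) \<le> e * norm (indicator (cball 0 (R + 1)) x *\<^sub>R A x)"
      proof (cases "norm x \<le> R + 1")
        case True
        have "\<bar>A x \<bullet> (G x - convol ?m G x)\<bar> \<le> norm (A x) * norm (G x - convol ?m G x)"
          by (rule Cauchy_Schwarz_ineq2)
        also have "\<dots> \<le> norm (A x) * e"
          using close[of x] by (intro mult_left_mono) (auto simp: norm_minus_commute)
        finally show ?thesis using True by (simp add: inner_diff_right mult.commute)
      qed (simp add: G0 G1)
    qed
    also have "\<dots> = e * I" by (simp add: I_def)
    finally show ?thesis by simp
  qed
  have "\<bar>\<integral>x. A x \<bullet> G x \<partial>lborel\<bar> \<le> 0"
  proof (rule field_le_epsilon)
    fix e :: real assume "e > 0"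
    then have "\<bar>\<integral>x. A x \<bullet> G x \<partial>lborel\<bar> \<le> e / (I + 1) * I" using I by (intro small) auto
    also have "\<dots> \<le> e" using I \<open>e > 0\<close> by (simp add: field_simps)
    finally show "\<bar>\<integral>x. A x \<bullet> G x \<partial>lborel\<bar> \<le> 0 + e" by simp
  qed
  then show ?thesis by simp
qed

text \<open>The definition of the weak gradient is tested with the reflected kernel centred at x:
  the derivative of the mollified function, which falls on the kernel, becomes the mollification of
  g. The sign from reflecting the kernel cancels the sign from integration by parts.\<close>

lemma mollified_weak_gradient:
  fixes u :: "'a::euclidean_space \<Rightarrow> real"
  assumes u: "locint u" and g: "locint g"
    and weak: "\<And>\<phi>. \<phi> \<in> C_c_infinity UNIV \<Longrightarrow> (\<integral>x. u x *\<^sub>R gradient \<phi> x \<partial>lborel) = - (\<integral>x. \<phi> x *\<^sub>R g x \<partial>lborel)"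
  shows "C1 (convol (moll n) u) (convol (moll n) g)"
proof -
  note [measurable] = locint_measurable[OF u] locint_measurable[OF g]
  let ?m = "moll n :: 'a \<Rightarrow> real"
  have m: "C1 ?m (gradient ?m)" by (rule C1_C_c_infinity[OF moll_props(5)])
  note [measurable] = C1_measurable[OF m]
  have C: "C1 (convol u ?m) (convol u (gradient ?m))"
    by (rule convol_C1[OF u m moll_props(2)])
  have "convol u ?m = convol ?m u"
    unfolding fun_eq_iff convol_commute[of u ?m, OF locint_measurable[OF u] moll_measurable]
    by (simp add: convol_def mult.commute)
  moreover have "convol u (gradient ?m) x = convol ?m g x" for x
  proof -
    have "((\<lambda>y. ?m (x - y)) has_derivative (\<lambda>h. (- gradient ?m (x - y)) \<bullet> h)) (at y)" for y
    proof -
      have "((\<lambda>y. x - y) has_derivative (\<lambda>h. - h)) (at y)" by (auto intro!: derivative_eq_intros)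
      from has_derivative_compose[OF this C1_D(1)[OF m]] show ?thesis by simp
    qed
    then have gr: "gradient (\<lambda>y. ?m (x - y)) y = - gradient ?m (x - y)" for y
      by (rule gradient_eqI)
    have "convol u (gradient ?m) x = (\<integral>y. u y *\<^sub>R gradient ?m (x - y) \<partial>lborel)"
      by (rule convol_commute) auto
    also have "\<dots> = - (\<integral>y. u y *\<^sub>R gradient (\<lambda>y. ?m (x - y)) y \<partial>lborel)"
      by (simp add: gr)
    also have "\<dots> = convol ?m g x"
      unfolding weak[OF moll_props(6)] convol_def by simp
    finally show ?thesis .
  qed
  then have "convol u (gradient ?m) = convol ?m g" by (rule ext)
  ultimately show ?thesis using C by (simp only:)
qed

text \<open>A weighted mean turns almost everywhere bounds on \<open>u\<close> into bounds at every
  point, as \<open>p_solution\<close> demands of \<open>U n\<close>.\<close>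

lemma moll_average_bounds:
  fixes u :: "'a::euclidean_space \<Rightarrow> real"
  assumes u: "locint u" and b: "AE x in lborel. s \<le> u x \<and> u x \<le> S"
  shows "s \<le> convol (moll n) u x" "convol (moll n) u x \<le> S"
proof -
  let ?m = "\<lambda>y::'a. moll n (x - y) :: real"
  have i: "integrable lborel (\<lambda>y. ?m y *\<^sub>R u y)"
    by (rule convol_integrable[OF u moll_continuous moll_props(2)])
  have im: "integrable lborel ?m"
    by (rule lborel_integrable_reflect[OF moll_props(3)])
  have m1: "(\<integral>y. ?m y \<partial>lborel) = 1"
    by (subst lborel_integral_reflect) (auto simp: moll_props(4))
  have lower: "AE y in lborel. ?m y * s \<le> ?m y *\<^sub>R u y" and upper: "AE y in lborel. ?m y *\<^sub>R u y \<le> ?m y * S"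
    using b by (eventually_elim, simp add: mult_left_mono moll_props(1))+
  have "(\<integral>y. ?m y * s \<partial>lborel) \<le> (\<integral>y. ?m y *\<^sub>R u y \<partial>lborel)"
    by (intro integral_mono_AE i integrable_mult_left im lower)
  then show "s \<le> convol (moll n) u x" using m1 by (simp add: convol_def)
  have "(\<integral>y. ?m y *\<^sub>R u y \<partial>lborel) \<le> (\<integral>y. ?m y * S \<partial>lborel)"
    by (intro integral_mono_AE i integrable_mult_left im upper)
  then show "convol (moll n) u x \<le> S" using m1 by (simp add: convol_def)
qed

text \<open>The clamp alters the affine rescaling of \<open>u\<close> on a null set only and makes
  the bounds hold everywhere. The approximations are rescaled mollifications, whose gradients are
  the rescaled mollifications of \<open>g\<close>.\<close>

lemma p_solution_normalized:
  fixes u :: "'a::euclidean_space \<Rightarrow> real"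
  assumes p: "p > 1" and u: "locLp p u" and g: "locLp p g"
    and weak: "\<And>\<phi>. \<phi> \<in> C_c_infinity UNIV \<Longrightarrow> (\<integral>x. u x *\<^sub>R gradient \<phi> x \<partial>lborel) = - (\<integral>x. \<phi> x *\<^sub>R g x \<partial>lborel)"
    and eq: "\<And>\<phi>. \<phi> \<in> C_c_infinity UNIV \<Longrightarrow> (\<integral>x. (norm (g x) powr (p - 2) *\<^sub>R g x) \<bullet> gradient \<phi> x \<partial>lborel) = 0"
    and b: "AE x in lborel. s \<le> u x \<and> u x \<le> S" and sS: "s < S"
  shows "p_solution p (\<lambda>x. max 0 (min 1 ((u x - s) / (S - s)))) (\<lambda>x. inverse (S - s) *\<^sub>R g x)"
proof
  let ?v = "\<lambda>x. max 0 (min 1 ((u x - s) / (S - s)))"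
  define c where "c = inverse (S - s)"
  have c: "c > 0" using sS by (simp add: c_def)
  have [measurable]: "u \<in> borel_measurable borel" "g \<in> borel_measurable borel" using u g by (auto simp: locLp_def)
  have liu: "locint u" and lig: "locint g" using locLp_imp_locint[OF u] locLp_imp_locint[OF g] p by auto
  show "p > 1" by (rule p)
  show "(\<lambda>x. ?v x) \<in> borel_measurable borel" by measurable
  show "?v x \<in> {0..1}" for x by auto
  have Lc: "Lpow p A (\<lambda>x. c *\<^sub>R h x) = ennreal (c powr p) * Lpow p A h" if [measurable]: "h \<in> borel_measurable borel" "A \<in> sets borel" for h :: "'a \<Rightarrow> 'a" and A
    unfolding Lpow_def using c
    by (subst nn_integral_cmult[symmetric]) (auto simp: powr_mult ennreal_mult mult.assoc)
  show "locLp p (\<lambda>x. inverse (S - s) *\<^sub>R g x)"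
    using g unfolding c_def[symmetric] by (auto simp: locLp_def Lc ennreal_mult_less_top)
  show "(\<integral>x. (norm (inverse (S - s) *\<^sub>R g x) powr (p - 2) *\<^sub>R inverse (S - s) *\<^sub>R g x) \<bullet> G x \<partial>lborel) = 0"
    if "C1 \<phi> G" "\<And>x. R < norm x \<Longrightarrow> \<phi> x = 0" for \<phi> G R
  proof -
    have "(norm (c *\<^sub>R g x) powr (p - 2) *\<^sub>R c *\<^sub>R g x) \<bullet> G x = (c powr (p - 2) * c) * ((norm (g x) powr (p - 2) *\<^sub>R g x) \<bullet> G x)" for x
      using c by (simp add: powr_mult mult_ac)
    moreover have "(\<integral>x. (norm (g x) powr (p - 2) *\<^sub>R g x) \<bullet> G x \<partial>lborel) = 0"
      by (rule C1_test_equation[OF locint_flux[OF g p] eq that])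
    ultimately show ?thesis
      unfolding c_def[symmetric] by (simp only: integral_mult_right_zero mult_zero_right)
  qed
  fix R
  let ?U = "\<lambda>n. convol (moll n) u" and ?V = "\<lambda>n. convol (moll n) g"
  have C: "C1 (?U n) (?V n)" for n by (rule mollified_weak_gradient[OF liu lig weak])
  note [measurable] = C1_measurable[OF C]
  let ?I = "indicator (cball (0::'a) R) :: 'a \<Rightarrow> real"
  \<comment> \<open>The p-th powers of the differences tend to 0 in L^1 of the ball, which provides
    a subsequence converging almost everywhere there. It depends on R, and so do the sequences in
    \<open>approx\<close>.\<close>
  let ?W = "\<lambda>n x. ?I x *\<^sub>R (norm (?U n x - u x) powr p)"
  have iU: "integrable lborel (\<lambda>x. ?W n x)" for n
    using locLp_powr_locint[OF locLp_diff[OF locLp_continuous[OF C1_D(3)[OF C[of n]]] u]] p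
    by (simp add: locint_def set_integrable_def)
  have nU: "ennreal (\<integral>x. norm (?W n x) \<partial>lborel) = Lpow p (cball 0 R) (\<lambda>x. ?U n x - u x)" for n
  proof -
    have "ennreal (\<integral>x. norm (?W n x) \<partial>lborel) = (\<integral>\<^sup>+x. ennreal (norm (?W n x)) \<partial>lborel)"
      by (rule nn_integral_eq_integral[symmetric]) (use iU in auto)
    also have "\<dots> = Lpow p (cball 0 R) (\<lambda>x. ?U n x - u x)"
      unfolding Lpow_def by (intro nn_integral_cong) (auto simp: indicator_def)
    finally show ?thesis .
  qed
  have "(\<lambda>n. ennreal (\<integral>x. norm (?W n x) \<partial>lborel)) \<longlonglongrightarrow> ennreal 0"
    unfolding nU using convol_moll_tendsto[OF u p, of R] by simp
  then have "(\<lambda>n. \<integral>x. norm (?W n x) \<partial>lborel) \<longlonglongrightarrow> 0"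
    by (subst (asm) tendsto_ennreal_iff) auto
  from tendsto_L1_AE_subseq[OF iU this] obtain q where q: "strict_mono q"
    "AE x in lborel. (\<lambda>n. ?W (q n) x) \<longlonglongrightarrow> 0"
    by blast
  show "\<exists>U V. (\<forall>n. C1 (U n) (V n)) \<and> (\<forall>n x. U n x \<in> {0..1}) \<and>
      (AE x in lborel. x \<in> cball 0 R \<longrightarrow> (\<lambda>n. U n x) \<longlonglongrightarrow> ?v x) \<and>
      (\<lambda>n. Lpow p (cball 0 R) (\<lambda>x. V n x - inverse (S - s) *\<^sub>R g x)) \<longlonglongrightarrow> 0"
  proof (intro exI[of _ "\<lambda>n x. c * ?U (q n) x + (- c * s)"] exI[of _ "\<lambda>n x. c *\<^sub>R ?V (q n) x"] conjI allI)
    show "C1 (\<lambda>x. c * ?U (q n) x + - c * s) (\<lambda>x. c *\<^sub>R ?V (q n) x)" for n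
      by (rule C1_cmult_add[OF C])
    have eqc: "c * t + - c * s = (t - s) / (S - s)" for t by (simp add: c_def divide_inverse algebra_simps)
    show "c * ?U (q n) x + - c * s \<in> {0..1}" for n x
      unfolding eqc using moll_average_bounds[OF liu b, of "q n" x] sS by simp
    show "AE x in lborel. x \<in> cball 0 R \<longrightarrow> (\<lambda>n. c * ?U (q n) x + - c * s) \<longlonglongrightarrow> ?v x"
      using q(2) b
    proof eventually_elim
      fix x assume lim: "(\<lambda>n. ?W (q n) x) \<longlonglongrightarrow> 0" and bx: "s \<le> u x \<and> u x \<le> S"
      show "x \<in> cball 0 R \<longrightarrow> (\<lambda>n. c * ?U (q n) x + - c * s) \<longlonglongrightarrow> ?v x"
      proof
        assume "x \<in> cball 0 R"
        with lim have "(\<lambda>n. norm (?U (q n) x - u x) powr p) \<longlonglongrightarrow> 0" by simp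
        then have "(\<lambda>n. (norm (?U (q n) x - u x) powr p) powr (1 / p)) \<longlonglongrightarrow> 0"
          by (rule tendsto_zero_powrI[where b="1/p"]) (use p in auto)
        then have "(\<lambda>n. ?U (q n) x - u x) \<longlonglongrightarrow> 0"
          using p by (simp add: powr_powr tendsto_rabs_zero_iff)
        then have "(\<lambda>n. ?U (q n) x) \<longlonglongrightarrow> u x" by (rule LIM_zero_cancel)
        then have "(\<lambda>n. c * ?U (q n) x + - c * s) \<longlonglongrightarrow> c * u x + - c * s" by (intro tendsto_intros)
        moreover have "?v x = (u x - s) / (S - s)"
          using bx sS by (auto simp: max_def min_def divide_le_eq_1)
        ultimately show "(\<lambda>n. c * ?U (q n) x + - c * s) \<longlonglongrightarrow> ?v x"
          unfolding eqc by simp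
      qed
    qed
    have "(\<lambda>n. Lpow p (cball 0 R) (\<lambda>x. ?V (q n) x - g x)) \<longlonglongrightarrow> 0"
      using LIMSEQ_subseq_LIMSEQ[OF convol_moll_tendsto[OF g p, of R] q(1)] by (simp add: o_def)
    then have "(\<lambda>n. ennreal (c powr p) * Lpow p (cball 0 R) (\<lambda>x. ?V (q n) x - g x)) \<longlonglongrightarrow> ennreal (c powr p) * 0"
      by (intro ennreal_tendsto_cmult) auto
    moreover have "Lpow p (cball 0 R) (\<lambda>x. c *\<^sub>R ?V (q n) x - inverse (S - s) *\<^sub>R g x) = ennreal (c powr p) * Lpow p (cball 0 R) (\<lambda>x. ?V (q n) x - g x)" for n
      using Lc[of "\<lambda>x. ?V (q n) x - g x" "cball 0 R"] by (simp add: scaleR_diff_right c_def)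
    ultimately show "(\<lambda>n. Lpow p (cball 0 R) (\<lambda>x. c *\<^sub>R ?V (q n) x - inverse (S - s) *\<^sub>R g x)) \<longlonglongrightarrow> 0"
      by simp
  qed
qed

text \<open>S and s are the essential supremum and infimum. They are themselves essential bounds, by
  a countable intersection of sets of full measure; if they differed, the oscillation decay would
  improve one of them.\<close>

lemma liouville_borel:
  fixes u :: "'a::euclidean_space \<Rightarrow> real"
  assumes p: "p > 1" and u: "locLp p u" and g: "locLp p g"
    and weak: "\<And>\<phi>. \<phi> \<in> C_c_infinity UNIV \<Longrightarrow> (\<integral>x. u x *\<^sub>R gradient \<phi> x \<partial>lborel) = - (\<integral>x. \<phi> x *\<^sub>R g x \<partial>lborel)"
    and eq: "\<And>\<phi>. \<phi> \<in> C_c_infinity UNIV \<Longrightarrow> (\<integral>x. (norm (g x) powr (p - 2) *\<^sub>R g x) \<bullet> gradient \<phi> x \<partial>lborel) = 0"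
    and M: "AE x in lborel. \<bar>u x\<bar> \<le> M"
  shows "\<exists>c. AE x in lborel. u x = c"
proof -
  define X where "X = {c. AE x in lborel. u x \<le> c}"
  define Y where "Y = {c. AE x in lborel. c \<le> u x}"
  \<comment> \<open>The space is not a null set, so a property and its negation cannot both hold
    almost everywhere; this is what orders essential lower and upper bounds.\<close>
  have bot: "\<not> (AE x in (lborel :: 'a measure). False)"
    using AE_iff_measurable[of UNIV "lborel :: 'a measure" "\<lambda>_. False"] by (simp add: emeasure_lborel_UNIV)
  have YX: "c \<le> c'" if "c \<in> Y" "c' \<in> X" for c c'
  proof (rule ccontr)
    assume "\<not> c \<le> c'"
    moreover have "AE x in lborel. c \<le> u x" "AE x in lborel. u x \<le> c'" using that by (auto simp: X_def Y_def)
    ultimately have "AE x in (lborel :: 'a measure). False" by (auto elim!: eventually_elim2)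
    then show False using bot by blast
  qed
  have MX: "M \<in> X" unfolding X_def using M by (auto elim!: eventually_mono)
  have MY: "- M \<in> Y" unfolding Y_def using M by (auto elim!: eventually_mono)
  define S where "S = Inf X"
  define s where "s = Sup Y"
  have bX: "bdd_below X" using YX[OF MY] by (auto intro!: bdd_belowI)
  have bY: "bdd_above Y" using YX[OF _ MX] by (auto intro!: bdd_aboveI)
  have "AE x in lborel. u x \<le> S + inverse (real (Suc n))" for n
  proof -
    have "\<exists>c\<in>X. c < S + inverse (real (Suc n))"
      unfolding S_def using cInf_less_iff[of X "Inf X + inverse (real (Suc n))"] MX bX by auto
    then obtain c where "c \<in> X" "c < S + inverse (real (Suc n))" by blast
    then show ?thesis unfolding X_def by (auto elim!: eventually_mono)
  qed
  then have "AE x in lborel. \<forall>n. u x \<le> S + inverse (real (Suc n))" by (simp add: AE_all_countable)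
  then have uS: "AE x in lborel. u x \<le> S"
  proof eventually_elim
    fix x assume *: "\<forall>n. u x \<le> S + inverse (real (Suc n))"
    have "(\<lambda>n. S + inverse (real (Suc n))) \<longlonglongrightarrow> S + 0" by (intro tendsto_intros LIMSEQ_inverse_real_of_nat)
    then have "u x \<le> S + 0" by (rule LIMSEQ_le_const) (use * in blast)
    then show "u x \<le> S" by simp
  qed
  have "AE x in lborel. s - inverse (real (Suc n)) \<le> u x" for n
  proof -
    have "\<exists>c\<in>Y. s - inverse (real (Suc n)) < c"
      unfolding s_def using less_cSup_iff[of Y "Sup Y - inverse (real (Suc n))"] MY bY by auto
    then obtain c where "c \<in> Y" "s - inverse (real (Suc n)) < c" by blast
    then show ?thesis unfolding Y_def by (auto elim!: eventually_mono)
  qed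
  then have "AE x in lborel. \<forall>n. s - inverse (real (Suc n)) \<le> u x" by (simp add: AE_all_countable)
  then have us: "AE x in lborel. s \<le> u x"
  proof eventually_elim
    fix x assume *: "\<forall>n. s - inverse (real (Suc n)) \<le> u x"
    have "(\<lambda>n. s - inverse (real (Suc n))) \<longlonglongrightarrow> s - 0" by (intro tendsto_intros LIMSEQ_inverse_real_of_nat)
    then have "s - 0 \<le> u x" by (rule LIMSEQ_le_const2) (use * in blast)
    then show "s \<le> u x" by simp
  qed
  have b: "AE x in lborel. s \<le> u x \<and> u x \<le> S" using us uS by eventually_elim auto
  have "s \<in> Y" "S \<in> X" using us uS by (simp_all add: X_def Y_def)
  then have "s \<le> S" by (rule YX)
  show ?thesis
  proof (cases "s < S")
    case False
    from b have "AE x in lborel. u x = s"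
      by eventually_elim (use \<open>s \<le> S\<close> False in simp)
    then show ?thesis by blast
  next
    case True
    let ?v = "\<lambda>x. max 0 (min 1 ((u x - s) / (S - s)))"
    have v: "AE x in lborel. ?v x = (u x - s) / (S - s)"
      using b by eventually_elim (use True in \<open>auto simp: max_def min_def divide_le_eq_1\<close>)
    obtain \<theta> where \<theta>: "\<theta> > 0" "(AE x in lborel. ?v x \<le> 1 - \<theta>) \<or> (AE x in lborel. ?v x \<ge> \<theta>)"
      using p_solution_oscillation_decay[OF p_solution_normalized[OF p u g weak eq b True]] by blast
    have pos: "\<theta> * (S - s) > 0" using \<theta> True by simp
    show ?thesis
      using \<theta>(2)
    proof
      assume "AE x in lborel. ?v x \<le> 1 - \<theta>"
      with v have "AE x in lborel. u x \<le> S - \<theta> * (S - s)"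
      proof eventually_elim
        fix x assume "?v x = (u x - s) / (S - s)" "?v x \<le> 1 - \<theta>"
        then have "(u x - s) / (S - s) \<le> 1 - \<theta>" by simp
        then have "u x - s \<le> (1 - \<theta>) * (S - s)" using True by (simp only: pos_divide_le_eq diff_gt_0_iff_gt)
        then show "u x \<le> S - \<theta> * (S - s)" by (simp add: algebra_simps)
      qed
      then have "S - \<theta> * (S - s) \<in> X" by (simp add: X_def)
      then have "S \<le> S - \<theta> * (S - s)" unfolding S_def using bX by (rule cInf_lower)
      then show ?thesis using pos by simp
    next
      assume "AE x in lborel. ?v x \<ge> \<theta>"
      with v have "AE x in lborel. s + \<theta> * (S - s) \<le> u x"
      proof eventually_elim
        fix x assume "?v x = (u x - s) / (S - s)" "\<theta> \<le> ?v x"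
        then have "\<theta> \<le> (u x - s) / (S - s)" by simp
        then have "\<theta> * (S - s) \<le> u x - s" using True by (simp only: pos_le_divide_eq diff_gt_0_iff_gt)
        then show "s + \<theta> * (S - s) \<le> u x" by (simp add: algebra_simps)
      qed
      then have "s + \<theta> * (S - s) \<in> Y" by (simp add: Y_def)
      then have "s + \<theta> * (S - s) \<le> s" unfolding s_def using bY by (rule cSup_upper)
      then show ?thesis using pos by simp
    qed
  qed
qed

section \<open>Passage from Lebesgue to Borel measurable functions\<close>

lemma borel_representative:
  fixes f :: "'a::euclidean_space \<Rightarrow> 'b::euclidean_space"
  assumes "f \<in> borel_measurable lebesgue"
  obtains f' where "f' \<in> borel_measurable borel" "AE x in lborel. f x = f' x"
proof -
  \<comment> \<open>Representatives are found for the real coordinates and then reassembled along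
    the basis.\<close>
  have "\<exists>h\<in>borel_measurable lborel. AE x in lborel. f x \<bullet> i = h x" for i
    using assms by (intro completion_ex_borel_measurable_real) auto
  then obtain h where h: "\<And>i. h i \<in> borel_measurable lborel" "\<And>i. AE x in lborel. f x \<bullet> i = h i x"
    by metis
  have "AE x in lborel. \<forall>i\<in>Basis. f x \<bullet> i = h i x"
    using h(2) by (intro AE_finite_allI) auto
  then have "AE x in lborel. f x = (\<Sum>i\<in>Basis. h i x *\<^sub>R i)"
  proof eventually_elim
    fix x assume "\<forall>i\<in>Basis. f x \<bullet> i = h i x"
    then have "(\<Sum>i\<in>Basis. h i x *\<^sub>R i) = (\<Sum>i\<in>Basis. (f x \<bullet> i) *\<^sub>R i)" by (intro sum.cong) auto
    then show "f x = (\<Sum>i\<in>Basis. h i x *\<^sub>R i)" by (simp add: euclidean_representation)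
  qed
  moreover have "(\<lambda>x. \<Sum>i\<in>Basis. h i x *\<^sub>R i) \<in> borel_measurable borel"
    using h(1) by (intro borel_measurable_sum borel_measurable_scaleR) auto
  ultimately show ?thesis using that by blast
qed

lemma Lp_loc_representative:
  fixes f :: "'a::euclidean_space \<Rightarrow> 'b::euclidean_space"
  assumes f: "f \<in> Lp_loc p UNIV"
  obtains f' where "locLp p f'" "AE x in lborel. f x = f' x"
proof -
  have "f \<in> borel_measurable lebesgue"
    using f by (simp add: Lp_loc_def lebesgue_on_UNIV_eq)
  from borel_representative[OF this] obtain f' where
    f'[measurable]: "f' \<in> borel_measurable borel" and eq: "AE x in lborel. f x = f' x" by blast
  have "Lpow p (cball 0 R) f' < \<infinity>" for R
  proof -
    have "Lpow p (cball 0 R) f' = (\<integral>\<^sup>+x. ennreal (norm (indicator (cball 0 R) x *\<^sub>R (norm (f' x) powr p))) \<partial>lborel)"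
      unfolding Lpow_def by (intro nn_integral_cong) (auto simp: indicator_def)
    also have "\<dots> = (\<integral>\<^sup>+x. ennreal (norm (indicator (cball 0 R) x *\<^sub>R (norm (f x) powr p))) \<partial>lborel)"
      using eq by (intro nn_integral_cong_AE) (auto elim!: eventually_mono)
    also have "\<dots> = (\<integral>\<^sup>+x. ennreal (norm (indicator (cball 0 R) x *\<^sub>R (norm (f x) powr p))) \<partial>lebesgue)"
      by (rule nn_integral_completion[symmetric])
    also have "\<dots> < \<infinity>"
    proof -
      have "set_integrable lebesgue (cball 0 R) (\<lambda>x. norm (f x) powr p)"
        using f by (auto simp: Lp_loc_def)
      then show ?thesis by (simp add: set_integrable_def integrable_iff_bounded)
    qed
    finally show ?thesis .
  qed
  then have "locLp p f'" by (simp add: locLp_def)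
  then show ?thesis using that eq by blast
qed

text \<open>Bochner integrals of measurable functions agree as soon as the functions do almost
  everywhere; if they are not integrable, both integrals take the default value 0.\<close>

lemma lebesgue_integral_representative:
  fixes h h' :: "'a::euclidean_space \<Rightarrow> 'b::euclidean_space"
  assumes [measurable]: "h' \<in> borel_measurable borel" and eq: "AE x in lborel. h x = h' x"
  shows "(LINT x:UNIV|lebesgue. h x) = (\<integral>x. h' x \<partial>lborel)"
proof -
  have h': "h' \<in> borel_measurable lebesgue" by (intro measurable_completion) auto
  have eq': "AE x in lebesgue. h' x = h x" using AE_completion[OF eq] by eventually_elim simp
  have "h \<in> borel_measurable lebesgue"
    by (rule borel_measurable_AE[OF h' eq'])
  then have "(\<integral>x. h x \<partial>lebesgue) = (\<integral>x. h' x \<partial>lebesgue)"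
    using h' eq' by (intro integral_cong_AE) auto
  then show ?thesis
    by (simp add: set_lebesgue_integral_def integral_completion)
qed

theorem theorem2p1:
  fixes u :: "real ^ 'n \<Rightarrow> real" and p :: real
  assumes "p > 1"
    and "p_harmonic_on p UNIV u"
    and "ess_bounded_on UNIV u"
  shows "ess_constant_on UNIV u"
proof -
  obtain g where g: "g \<in> Lp_loc p UNIV" "has_weak_gradient UNIV u g"
    "\<And>\<phi>. \<phi> \<in> C_c_infinity UNIV \<Longrightarrow> (LINT x:UNIV|lebesgue. (norm (g x) powr (p - 2) *\<^sub>R g x) \<bullet> gradient \<phi> x) = 0"
    and u: "u \<in> Lp_loc p UNIV"
    using assms(2) by (auto simp: p_harmonic_on_def W1p_loc_def)
  obtain u' where u': "locLp p u'" "AE x in lborel. u x = u' x" using Lp_loc_representative[OF u] by blast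
  obtain g' where g': "locLp p g'" "AE x in lborel. g x = g' x" using Lp_loc_representative[OF g(1)] by blast
  have [measurable]: "u' \<in> borel_measurable borel" "g' \<in> borel_measurable borel" using u' g' by (auto simp: locLp_def)
  obtain M where M: "AE x in lebesgue. \<bar>u x\<bar> \<le> M" using assms(3) by (auto simp: ess_bounded_on_def)
  have "\<exists>c. AE x in lborel. u' x = c"
  proof (rule liouville_borel[OF assms(1) u'(1) g'(1)])
    fix \<phi> :: "real ^ 'n \<Rightarrow> real" assume \<phi>: "\<phi> \<in> C_c_infinity UNIV"
    note [measurable] = C1_measurable[OF C1_C_c_infinity[OF \<phi>]]
    have "(LINT x:UNIV|lebesgue. u x *\<^sub>R gradient \<phi> x) = (\<integral>x. u' x *\<^sub>R gradient \<phi> x \<partial>lborel)"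
      by (rule lebesgue_integral_representative) (use u'(2) in \<open>auto elim!: eventually_mono\<close>)
    moreover have "(LINT x:UNIV|lebesgue. \<phi> x *\<^sub>R g x) = (\<integral>x. \<phi> x *\<^sub>R g' x \<partial>lborel)"
      by (rule lebesgue_integral_representative) (use g'(2) in \<open>auto elim!: eventually_mono\<close>)
    ultimately show "(\<integral>x. u' x *\<^sub>R gradient \<phi> x \<partial>lborel) = - (\<integral>x. \<phi> x *\<^sub>R g' x \<partial>lborel)"
      using g(2) \<phi> by (simp add: has_weak_gradient_def)
    have "(LINT x:UNIV|lebesgue. (norm (g x) powr (p - 2) *\<^sub>R g x) \<bullet> gradient \<phi> x) = (\<integral>x. (norm (g' x) powr (p - 2) *\<^sub>R g' x) \<bullet> gradient \<phi> x \<partial>lborel)"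
      by (rule lebesgue_integral_representative) (use g'(2) in \<open>auto elim!: eventually_mono\<close>)
    then show "(\<integral>x. (norm (g' x) powr (p - 2) *\<^sub>R g' x) \<bullet> gradient \<phi> x \<partial>lborel) = 0"
      using g(3)[OF \<phi>] by simp
  next
    have "AE x in lborel. \<bar>u x\<bar> \<le> M" using M by (simp add: AE_completion_iff)
    with u'(2) show "AE x in lborel. \<bar>u' x\<bar> \<le> M" by eventually_elim simp
  qed
  then obtain c where "AE x in lborel. u' x = c" by blast
  with u'(2) have "AE x in lborel. u x = c" by eventually_elim simp
  then have "AE x in lebesgue. u x = c" by (rule AE_completion)
  then show ?thesis by (auto simp: ess_constant_on_def)
qed

end
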